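(* Assume $H$ is continuous. Let $u^-\in USC(\overline{Q_T})$ be a viscosity subsolution and $u^+\in LSC(\overline{Q_T})$ a viscosity supersolution of $\partial_t^\alpha u+H(t,x,u,Du)=0$ in $Q_T$ such that $(u^-)_*>-\infty$ and $(u^+)^*<+\infty$ on $\overline{Q_T}$, and suppose $u^-\le u^+$ on $\overline{Q_T}$. Then there exists a viscosity solution $u$ of the equation satisfying $u^-\le u\le u^+$ on $\overline{Q_T}$.
   Context: Fix $d\ge1$, $T>0$, $\alpha\in(0,1)$. $\mathbb{T}^d=\mathbb{R}^d/\mathbb{Z}^d$; functions on $[0,T]\times\mathbb{T}^d$ are identified with functions on $[0,T]\times\mathbb{R}^d$ $\mathbb{Z}^d$-periodic in $x$. $Q_T=(0,T]\times\mathbb{T}^d$, $\overline{Q_T}=[0,T]\times\mathbb{T}^d$; $D$ spatial gradient; $\partial_t^\alpha$ Caputo's derivative $(\partial_t^\alpha f)(t)=\frac{1}{\Gamma(1-\alpha)}\int_0^t f'(s)(t-s)^{-\alpha}ds$. $H:\overline{Q_T}\times\mathbb{R}\times\mathbb{R}^d\to\mathbb{R}$. Envelopes: $w^*(t,x)=\lim_{\delta\searrow0}\sup\{w(s,y):(s,y)\in Q_T\cap\overline{B_\delta(t,x)}\}$, $w_*=-(-w)^*$. $\mathcal{C}^1([a,b]\times O)=\{\phi\in C^1((a,b]\times O)\cap C([a,b]\times O):\partial_t\phi(\cdot,x)\in L^1(a,b)\ \forall x\in O\}$. For measurable $f(t,x)$, $t\in(0,T]$, $r\in[0,t]$: $J_r[f](t,x)=\frac{\alpha}{\Gamma(1-\alpha)}\int_0^r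 (f(t,x)-f(t-\tau,x))\tau^{-\alpha-1}d\tau$, $K_r[f](t,x)=\frac{f(t,x)-f(0,x)}{t^\alpha\Gamma(1-\alpha)}+\frac{\alpha}{\Gamma(1-\alpha)}\int_r^t (f(t,x)-f(t-\tau,x))\tau^{-\alpha-1}d\tau$ (improper at lower limit $0$). Viscosity sub/supersolution: $u\in USC(\overline{Q_T})$ (resp. $LSC$) such that for all $a<b$ in $[0,T]$, every open ball $B\subset\mathbb{R}^d$, every $\phi\in\mathcal{C}^1([0,T]\times\mathbb{R}^d)$ and every $(\hat t,\hat x)\in(a,b]\times B$ where $u-\phi$ attains its maximum (resp. minimum) over $[a,b]\times\overline B$: $J_{\hat t-a}[\phi](\hat t,\hat x)+K_{\hat t-a}[u](\hat t,\hat x)+H(\hat t,\hat x,u(\hat t,\hat x),D\phi(\hat t,\hat x))\le0$ (resp. $\ge0$). A viscosity solution is both a sub- and a supersolution.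
   Formalization: "Viscosity solution" is taken in Ishii's sense (u^* is a subsolution and u_* a supersolution); u itself need not be continuous, since a solution both USC and LSC can fail to exist, e.g. for H=b(x)p with b=-sign(x)|x|^{1/2} near 0. *)

theory Defs
  imports "HOL-Analysis.Analysis"
begin

text \<open>Points of the closed cylinder are pairs (t,x) with t in [0,T] and x in R^d
  (the index type 'd :: finite has CARD('d) = d >= 1 elements).  Functions on the
  torus are Z^d-periodic functions on R^d.\<close>

definition periodic_x :: "real \<Rightarrow> (real \<Rightarrow> real^'d \<Rightarrow> real) \<Rightarrow> bool" where
  "periodic_x T u \<longleftrightarrow>
     (\<forall>t\<in>{0..T}. \<forall>x k. (\<forall>i. k $ i \<in> \<int>) \<longrightarrow> u t (x + k) = u t x)"

definition cyl :: "real \<Rightarrow> (real \<times> (real^'d)) set" where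
  "cyl T = {0..T} \<times> UNIV"

definition QT :: "real \<Rightarrow> (real \<times> (real^'d)) set" where
  "QT T = {0<..T} \<times> UNIV"

definition usc_on :: "('a::metric_space) set \<Rightarrow> ('a \<Rightarrow> real) \<Rightarrow> bool" where
  "usc_on S f \<longleftrightarrow> (\<forall>z\<in>S. \<forall>e>0. \<exists>d>0. \<forall>z'\<in>S. dist z' z < d \<longrightarrow> f z' < f z + e)"

definition lsc_on :: "('a::metric_space) set \<Rightarrow> ('a \<Rightarrow> real) \<Rightarrow> bool" where
  "lsc_on S f \<longleftrightarrow> (\<forall>z\<in>S. \<forall>e>0. \<exists>d>0. \<forall>z'\<in>S. dist z' z < d \<longrightarrow> f z - e < f z')"

text \<open>Envelopes w^* and w_* (extended-real valued); the limit as delta decreases to 0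
  of the (monotone) suprema equals their infimum over delta > 0.\<close>
definition usc_env :: "real \<Rightarrow> (real \<Rightarrow> real^'d \<Rightarrow> real) \<Rightarrow> real \<Rightarrow> real^'d \<Rightarrow> ereal" where
  "usc_env T w t x =
     (INF \<delta>\<in>{0<..}. SUP z\<in>QT T \<inter> cball (t,x) \<delta>. ereal (w (fst z) (snd z)))"

definition lsc_env :: "real \<Rightarrow> (real \<Rightarrow> real^'d \<Rightarrow> real) \<Rightarrow> real \<Rightarrow> real^'d \<Rightarrow> ereal" where
  "lsc_env T w t x = - usc_env T (\<lambda>s y. - w s y) t x"

definition eint :: "real set \<Rightarrow> (real \<Rightarrow> real) \<Rightarrow> ereal" where
  "eint A f = enn2ereal (\<integral>\<^sup>+ \<tau>. ennreal (f \<tau>) * indicator A \<tau> \<partial>lborel)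
            - enn2ereal (\<integral>\<^sup>+ \<tau>. ennreal (- f \<tau>) * indicator A \<tau> \<partial>lborel)"

definition Jop :: "real \<Rightarrow> real \<Rightarrow> (real \<Rightarrow> real^'d \<Rightarrow> real) \<Rightarrow> real \<Rightarrow> real^'d \<Rightarrow> ereal" where
  "Jop \<alpha> r f t x = ereal (\<alpha> / Gamma (1 - \<alpha>)) *
      eint {0..r} (\<lambda>\<tau>. (f t x - f (t - \<tau>) x) * \<tau> powr (- \<alpha> - 1))"

definition Kop :: "real \<Rightarrow> real \<Rightarrow> (real \<Rightarrow> real^'d \<Rightarrow> real) \<Rightarrow> real \<Rightarrow> real^'d \<Rightarrow> ereal" where
  "Kop \<alpha> r f t x = ereal ((f t x - f 0 x) / (t powr \<alpha> * Gamma (1 - \<alpha>)))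
      + ereal (\<alpha> / Gamma (1 - \<alpha>)) *
        eint {r..t} (\<lambda>\<tau>. (f t x - f (t - \<tau>) x) * \<tau> powr (- \<alpha> - 1))"

definition test_fun :: "real \<Rightarrow> (real \<Rightarrow> real^'d \<Rightarrow> real) \<Rightarrow> (real \<Rightarrow> real^'d \<Rightarrow> real)
                         \<Rightarrow> (real \<Rightarrow> real^'d \<Rightarrow> real^'d) \<Rightarrow> bool" where
  "test_fun T \<phi> \<phi>t D\<phi> \<longleftrightarrow>
     continuous_on (cyl T) (\<lambda>z. \<phi> (fst z) (snd z)) \<and>
     continuous_on (QT T) (\<lambda>z. \<phi>t (fst z) (snd z)) \<and>
     continuous_on (QT T) (\<lambda>z. D\<phi> (fst z) (snd z)) \<and>
     (\<forall>t\<in>{0<..T}. \<forall>x. ((\<lambda>z. \<phi> (fst z) (snd z)) has_derivative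
          (\<lambda>h. fst h * \<phi>t t x + D\<phi> t x \<bullet> snd h)) (at (t, x) within QT T)) \<and>
     (\<forall>x. set_integrable lborel {0<..<T} (\<lambda>t. \<phi>t t x))"

definition visc_sub :: "real \<Rightarrow> real \<Rightarrow> (real \<Rightarrow> real^'d \<Rightarrow> real \<Rightarrow> real^'d \<Rightarrow> real)
                        \<Rightarrow> (real \<Rightarrow> real^'d \<Rightarrow> real) \<Rightarrow> bool" where
  "visc_sub \<alpha> T H u \<longleftrightarrow>
     usc_on (cyl T) (\<lambda>z. u (fst z) (snd z)) \<and>
     (\<forall>a b c \<rho> \<phi> \<phi>t D\<phi> th xh.
        0 \<le> a \<and> a < b \<and> b \<le> T \<and> \<rho> > 0 \<and> test_fun T \<phi> \<phi>t D\<phi> \<and>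
        th \<in> {a<..b} \<and> xh \<in> ball c \<rho> \<and>
        (\<forall>s\<in>{a..b}. \<forall>y\<in>cball c \<rho>. u s y - \<phi> s y \<le> u th xh - \<phi> th xh) \<longrightarrow>
        Jop \<alpha> (th - a) \<phi> th xh + Kop \<alpha> (th - a) u th xh
          + ereal (H th xh (u th xh) (D\<phi> th xh)) \<le> 0)"

definition visc_super :: "real \<Rightarrow> real \<Rightarrow> (real \<Rightarrow> real^'d \<Rightarrow> real \<Rightarrow> real^'d \<Rightarrow> real)
                        \<Rightarrow> (real \<Rightarrow> real^'d \<Rightarrow> real) \<Rightarrow> bool" where
  "visc_super \<alpha> T H u \<longleftrightarrow>
     lsc_on (cyl T) (\<lambda>z. u (fst z) (snd z)) \<and>
     (\<forall>a b c \<rho> \<phi> \<phi>t D\<phi> th xh.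
        0 \<le> a \<and> a < b \<and> b \<le> T \<and> \<rho> > 0 \<and> test_fun T \<phi> \<phi>t D\<phi> \<and>
        th \<in> {a<..b} \<and> xh \<in> ball c \<rho> \<and>
        (\<forall>s\<in>{a..b}. \<forall>y\<in>cball c \<rho>. u s y - \<phi> s y \<ge> u th xh - \<phi> th xh) \<longrightarrow>
        Jop \<alpha> (th - a) \<phi> th xh + Kop \<alpha> (th - a) u th xh
          + ereal (H th xh (u th xh) (D\<phi> th xh)) \<ge> 0)"

definition visc_sol :: "real \<Rightarrow> real \<Rightarrow> (real \<Rightarrow> real^'d \<Rightarrow> real \<Rightarrow> real^'d \<Rightarrow> real)
                        \<Rightarrow> (real \<Rightarrow> real^'d \<Rightarrow> real) \<Rightarrow> bool" where
  "visc_sol \<alpha> T H u \<longleftrightarrow>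
     (\<forall>t\<in>{0..T}. \<forall>x. usc_env T u t x < \<infinity> \<and> lsc_env T u t x > -\<infinity>) \<and>
     visc_sub \<alpha> T H (\<lambda>t x. real_of_ereal (usc_env T u t x)) \<and>
     visc_super \<alpha> T H (\<lambda>t x. real_of_ereal (lsc_env T u t x))"

end

theory Submission
  imports Defs
begin

text \<open>Perron's method: the solution is the supremum \<open>u\<close> of a class of subsolutions between \<open>um\<close> and \<open>up\<close>.
  Its upper envelope is a subsolution because subsolutions are stable under half-relaxed limits.
  Where its lower envelope failed to be a supersolution, a test function raised slightly near the
  contact point could be glued into \<open>u\<close> without leaving the class, contradicting maximality.

  The envelopes of the statement only see positive times, whereas the operator \<open>K\<close> involves the
  initial value, so taking all subsolutions between \<open>um\<close> and \<open>up\<close> is not enough: the envelopes of the supremum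
  may violate the ordering with \<open>um\<close> and \<open>up\<close> at time \<open>0\<close>.  One therefore inserts a continuous function \<open>g\<close>
  between \<open>um 0\<close> and \<open>up 0\<close> and restricts the class to initial values below \<open>g\<close>.  Barriers
  \<open>g y \<plusminus> (e + C * norm (x - y)\<^sup>2 + K * t powr \<alpha>)\<close> then force both envelopes to equal \<open>g\<close> at time \<open>0\<close>.\<close>

subsection \<open>The Caputo kernel\<close>

text \<open>Boundedness carries the analysis. Semicontinuity, periodicity and the envelope
  hypotheses bound \<open>um\<close> and \<open>up\<close>, so the increments in time are dominated
  by multiples of \<open>min \<tau> 1\<close>, which is integrable against the kernel. The
  extended-real operator then becomes a real number \<open>Lop\<close>, monotone in the increments
  and lower semicontinuous along sequences. No comparison principle enters: gluing rests on the fact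
  that enlarging the past of a function lowers the operator. Supersolutions are subsolutions of a
  reflected equation, so stability and comparison with barriers are proved once and used for both
  envelopes. The obstacle is the end of the test interval. A test over \<open>[a,b]\<close> with
  contact at \<open>b\<close> says nothing about later times, whereas a bump occupies a full
  neighbourhood of the contact point and requires the test function to lie below the lower envelope
  after the contact as well. Hence the bump argument is run only for tests over \<open>[a,T]\<close>
  (\<open>weak_sub\<close>), and the stability lemma, applied to a family with one element, recovers
  all intervals.\<close>

lemma kern_integrable_tail:
  fixes \<alpha> s :: real
  assumes "0 < \<alpha>" "0 < s"
  shows "set_integrable lborel {s..} (\<lambda>\<tau>. \<tau> powr (-\<alpha> - 1))"
    and "(LINT \<tau>:{s..}|lborel. \<tau> powr (-\<alpha> - 1)) = s powr (-\<alpha>) / \<alpha>"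
proof -
  have "(\<integral>\<^sup>+ \<tau>. ennreal (\<tau> powr (-\<alpha> - 1)) * indicator {s..} \<tau> \<partial>lborel) = ennreal (0 - (- (s powr (-\<alpha>) / \<alpha>)))"
  proof (rule nn_integral_FTC_atLeast[where F = "\<lambda>\<tau>. - (\<tau> powr (-\<alpha>) / \<alpha>)"])
    show "((\<lambda>\<tau>. - (\<tau> powr (-\<alpha>) / \<alpha>)) has_real_derivative \<tau> powr (-\<alpha> - 1)) (at \<tau>)" if "s \<le> \<tau>" for \<tau>
      using that assms by (auto intro!: derivative_eq_intros)
    have "((\<lambda>\<tau>. \<tau> powr (-\<alpha>)) \<longlongrightarrow> 0) at_top"
      using assms by (intro tendsto_neg_powr filterlim_ident) auto
    then have "((\<lambda>\<tau>. - (\<tau> powr (-\<alpha>) / \<alpha>)) \<longlongrightarrow> - (0 / \<alpha>)) at_top"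
      using assms by (intro tendsto_intros) auto
    then show "((\<lambda>\<tau>. - (\<tau> powr (-\<alpha>) / \<alpha>)) \<longlongrightarrow> 0) at_top" by simp
  qed auto
  then have *: "(\<integral>\<^sup>+ \<tau>. ennreal (indicator {s..} \<tau> *\<^sub>R \<tau> powr (-\<alpha> - 1)) \<partial>lborel) = ennreal (s powr (-\<alpha>) / \<alpha>)"
    by (simp add: ennreal_mult'' ennreal_indicator mult.commute)
  have "has_bochner_integral lborel (\<lambda>\<tau>. indicator {s..} \<tau> *\<^sub>R \<tau> powr (-\<alpha> - 1)) (s powr (-\<alpha>) / \<alpha>)"
    by (rule has_bochner_integral_nn_integral[OF _ _ _ *]) (use assms in auto)
  then show "set_integrable lborel {s..} (\<lambda>\<tau>. \<tau> powr (-\<alpha> - 1))"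
    and "(LINT \<tau>:{s..}|lborel. \<tau> powr (-\<alpha> - 1)) = s powr (-\<alpha>) / \<alpha>"
    by (auto simp: has_bochner_integral_iff set_integrable_def set_lebesgue_integral_def)
qed

lemma powr_set_integrable:
  fixes a c :: real
  assumes "-1 < a" "0 \<le> c"
  shows "set_integrable lborel {0<..c} (\<lambda>\<tau>. \<tau> powr a)"
proof -
  have "(\<lambda>\<tau>. \<tau> powr a) integrable_on {0<..c}"
    by (rule integrable_on_powr_from_0') (use assms in auto)
  then have "(\<lambda>\<tau>. \<tau> powr a) absolutely_integrable_on {0<..c}"
    by (subst absolutely_integrable_on_iff_nonneg) auto
  then have "integrable lebesgue (\<lambda>\<tau>::real. indicator {0<..c} \<tau> *\<^sub>R \<tau> powr a)"
    by (simp add: set_integrable_def)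
  then show ?thesis
    unfolding set_integrable_def by (subst (asm) integrable_completion) auto
qed

text \<open>The kernel is not integrable at 0, but increments that are of order \<tau> near 0 and
  bounded for large \<tau> are integrable against it. The function \<open>min \<tau> 1\<close> is
  the majorant used for all of them.\<close>

lemma kern_integrable_min:
  fixes \<alpha> :: real
  assumes "0 < \<alpha>" "\<alpha> < 1"
  shows "set_integrable lborel {0<..} (\<lambda>\<tau>. min \<tau> 1 * \<tau> powr (-\<alpha> - 1))"
proof -
  have "set_integrable lborel {0<..1} (\<lambda>\<tau>. \<tau> powr (-\<alpha>))"
    by (rule powr_set_integrable) (use assms in auto)
  moreover have "set_integrable lborel {1..} (\<lambda>\<tau>. \<tau> powr (-\<alpha> - 1))"
    by (rule kern_integrable_tail) (use assms in auto)
  ultimately have "integrable lborel (\<lambda>\<tau>::real. indicator {0<..1} \<tau> *\<^sub>R \<tau> powr (-\<alpha>) + indicator {1..} \<tau> *\<^sub>R \<tau> powr (-\<alpha> - 1))"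
    unfolding set_integrable_def by (rule Bochner_Integration.integrable_add)
  then show ?thesis unfolding set_integrable_def
  proof (rule Bochner_Integration.integrable_bound)
    show "AE \<tau> in lborel. norm (indicat_real {0<..} \<tau> *\<^sub>R (min \<tau> 1 * \<tau> powr (- \<alpha> - 1)))
      \<le> norm (indicat_real {0<..1} \<tau> *\<^sub>R \<tau> powr - \<alpha> + indicat_real {1..} \<tau> *\<^sub>R \<tau> powr (- \<alpha> - 1))"
    proof (intro always_eventually allI)
      fix \<tau> :: real
      have "\<tau> * \<tau> powr (- \<alpha> - 1) = \<tau> powr (-\<alpha>)" if "\<tau> > 0"
        using that by (simp add: powr_diff field_simps)
      then show "norm (indicat_real {0<..} \<tau> *\<^sub>R (min \<tau> 1 * \<tau> powr (- \<alpha> - 1)))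
      \<le> norm (indicat_real {0<..1} \<tau> *\<^sub>R \<tau> powr - \<alpha> + indicat_real {1..} \<tau> *\<^sub>R \<tau> powr (- \<alpha> - 1))"
        by (auto simp: indicator_def min_def abs_mult)
    qed
  qed auto
qed

lemma kern_integrable:
  fixes \<alpha> C :: real
  assumes "0 < \<alpha>" "\<alpha> < 1" and [measurable]: "h \<in> borel_measurable borel"
    and "\<And>\<tau>. 0 < \<tau> \<Longrightarrow> \<bar>h \<tau>\<bar> \<le> C * min \<tau> 1"
  shows "set_integrable lborel {0<..} (\<lambda>\<tau>. h \<tau> * \<tau> powr (-\<alpha> - 1))"
proof -
  have "set_integrable lborel {0<..} (\<lambda>\<tau>. C * (min \<tau> 1 * \<tau> powr (-\<alpha> - 1)))"
    by (intro set_integrable_mult_right kern_integrable_min assms)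
  then show ?thesis
  proof (rule set_integrable_bound)
    show "set_borel_measurable lborel {0<..} (\<lambda>\<tau>. h \<tau> * \<tau> powr (- \<alpha> - 1))"
      unfolding set_borel_measurable_def by measurable
    show "AE x in lborel. x \<in> {0<..} \<longrightarrow> norm (h x * x powr (- \<alpha> - 1)) \<le> norm (C * (min x 1 * x powr (- \<alpha> - 1)))"
    proof (intro always_eventually allI impI)
      fix \<tau> :: real assume "\<tau> \<in> {0<..}"
      then have "\<bar>h \<tau>\<bar> \<le> C * min \<tau> 1" using assms by auto
      then have "\<bar>h \<tau>\<bar> * \<tau> powr (- \<alpha> - 1) \<le> (C * min \<tau> 1) * \<tau> powr (- \<alpha> - 1)"
        by (intro mult_right_mono) auto
      also have "\<dots> \<le> norm (C * (min \<tau> 1 * \<tau> powr (- \<alpha> - 1)))"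
        by (simp add: mult.assoc)
      finally show "norm (h \<tau> * \<tau> powr (- \<alpha> - 1)) \<le> norm (C * (min \<tau> 1 * \<tau> powr (- \<alpha> - 1)))"
        by (simp add: abs_mult)
    qed
  qed
qed

text \<open>Dominated convergence applied to the truncations \<open>min (h\<^sub>n) h\<close>.\<close>

lemma kern_fatou:
  fixes \<alpha> C c :: real
  assumes \<alpha>: "0 < \<alpha>" "\<alpha> < 1"
    and h: "h \<in> borel_measurable borel" "\<And>\<tau>. 0 < \<tau> \<Longrightarrow> \<bar>h \<tau>\<bar> \<le> C * min \<tau> 1"
    and hn: "\<And>n. hn n \<in> borel_measurable borel" "\<And>n \<tau>. 0 < \<tau> \<Longrightarrow> \<bar>hn n \<tau>\<bar> \<le> C * min \<tau> 1"
    and lim: "\<And>\<tau> e. 0 < \<tau> \<Longrightarrow> \<tau> \<noteq> s \<Longrightarrow> 0 < e \<Longrightarrow> eventually (\<lambda>n. hn n \<tau> > h \<tau> - e) sequentially"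
    and le: "\<And>n. (LINT \<tau>:{0<..}|lborel. hn n \<tau> * \<tau> powr (-\<alpha> - 1)) \<le> cn n"
    and cn: "cn \<longlonglongrightarrow> c"
  shows "(LINT \<tau>:{0<..}|lborel. h \<tau> * \<tau> powr (-\<alpha> - 1)) \<le> c"
proof -
  define g where "g = (\<lambda>n \<tau>. min (hn n \<tau>) (h \<tau>))"
  note [measurable] = h(1) hn(1)
  have [measurable]: "g n \<in> borel_measurable borel" for n unfolding g_def by measurable
  have gb: "\<bar>g n \<tau>\<bar> \<le> C * min \<tau> 1" if "0 < \<tau>" for n \<tau>
    using h(2)[OF that] hn(2)[OF that, of n] by (auto simp: g_def min_def)
  have glim: "(\<lambda>n. g n \<tau>) \<longlonglongrightarrow> h \<tau>" if "0 < \<tau>" "\<tau> \<noteq> s" for \<tau>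
  proof (rule LIMSEQ_I)
    fix e :: real assume "0 < e"
    from lim[OF that this] obtain N where "\<forall>n\<ge>N. hn n \<tau> > h \<tau> - e"
      by (auto simp: eventually_sequentially)
    then show "\<exists>no. \<forall>n\<ge>no. norm (g n \<tau> - h \<tau>) < e" using \<open>0 < e\<close>
      by (intro exI[of _ N]) (auto simp: g_def min_def)
  qed
  have "(\<lambda>n. LINT \<tau>:{0<..}|lborel. g n \<tau> * \<tau> powr (-\<alpha> - 1)) \<longlonglongrightarrow> (LINT \<tau>:{0<..}|lborel. h \<tau> * \<tau> powr (-\<alpha> - 1))"
    unfolding set_lebesgue_integral_def
  proof (rule integral_dominated_convergence)
    have "set_integrable lborel {0<..} (\<lambda>\<tau>. C * min \<tau> 1 * \<tau> powr (-\<alpha> - 1))"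
      unfolding mult.assoc by (intro set_integrable_mult_right kern_integrable_min \<alpha>)
    then show "integrable lborel (\<lambda>\<tau>. indicator {0<..} \<tau> *\<^sub>R (C * min \<tau> 1 * \<tau> powr (-\<alpha> - 1)))"
      by (simp add: set_integrable_def)
    \<comment> \<open>In the application \<open>s\<close> is the delay at which \<open>incr\<close>
      switches from \<phi> to the past; nothing is known about the limit there, and a single point
      is null.\<close>
    have "AE \<tau> in lborel. \<tau> \<noteq> s" by (rule AE_lborel_singleton)
    then show "AE \<tau> in lborel. (\<lambda>n. indicat_real {0<..} \<tau> *\<^sub>R (g n \<tau> * \<tau> powr (- \<alpha> - 1)))
        \<longlonglongrightarrow> indicat_real {0<..} \<tau> *\<^sub>R (h \<tau> * \<tau> powr (- \<alpha> - 1))"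
    proof eventually_elim
      case (elim \<tau>)
      then show ?case by (cases "0 < \<tau>") (auto intro!: tendsto_intros glim)
    qed
    show "AE \<tau> in lborel. norm (indicat_real {0<..} \<tau> *\<^sub>R (g n \<tau> * \<tau> powr (- \<alpha> - 1)))
        \<le> indicat_real {0<..} \<tau> *\<^sub>R (C * min \<tau> 1 * \<tau> powr (- \<alpha> - 1))" for n
      using gb by (intro always_eventually allI) (auto simp: indicator_def abs_mult intro!: mult_right_mono)
  qed auto
  moreover have "(LINT \<tau>:{0<..}|lborel. g n \<tau> * \<tau> powr (-\<alpha> - 1)) \<le> cn n" for n
  proof -
    have "(LINT \<tau>:{0<..}|lborel. g n \<tau> * \<tau> powr (-\<alpha> - 1)) \<le> (LINT \<tau>:{0<..}|lborel. hn n \<tau> * \<tau> powr (-\<alpha> - 1))"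
      by (intro set_integral_mono kern_integrable[OF \<alpha>, where C = C] gb hn mult_right_mono)
        (auto simp: g_def)
    with le[of n] show ?thesis by linarith
  qed
  ultimately show ?thesis using cn by (meson LIMSEQ_le)
qed

subsection \<open>Semicontinuous functions and test functions\<close>

abbreviation usc_cyl :: "real \<Rightarrow> (real \<Rightarrow> real^'d \<Rightarrow> real) \<Rightarrow> bool" where
  "usc_cyl T f \<equiv> usc_on (cyl T) (\<lambda>z. f (fst z) (snd z))"

text \<open>The nonlocal operator is linear, so replacing u by -u turns supersolutions for H into
  subsolutions for this Hamiltonian.\<close>

abbreviation (input) reflect :: "(real \<Rightarrow> real^'d \<Rightarrow> real \<Rightarrow> real^'d \<Rightarrow> real) \<Rightarrow> real \<Rightarrow> real^'d \<Rightarrow> real \<Rightarrow> real^'d \<Rightarrow> real" where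
  "reflect H \<equiv> \<lambda>t x r p. - H t x (- r) (- p)"

lemma lsc_on_iff_usc_on: "lsc_on S f \<longleftrightarrow> usc_on S (\<lambda>z. - f z)"
  by (simp add: lsc_on_def usc_on_def algebra_simps)

lemma continuous_on_imp_usc_on:
  fixes f :: "'a::metric_space \<Rightarrow> real"
  assumes "continuous_on S f"
  shows "usc_on S f"
  unfolding usc_on_def
proof (intro ballI allI impI)
  fix z and e :: real assume "z \<in> S" "0 < e"
  with assms obtain d where "d > 0" "\<forall>z'\<in>S. dist z' z < d \<longrightarrow> dist (f z') (f z) < e"
    unfolding continuous_on_iff by meson
  then show "\<exists>d>0. \<forall>z'\<in>S. dist z' z < d \<longrightarrow> f z' < f z + e"
    by (intro exI[of _ d]) (auto simp: dist_real_def)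
qed

lemma continuous_onE:
  assumes "continuous_on S f" "z \<in> S" "0 < e"
  obtains d where "d > 0" "\<And>z'. z' \<in> S \<Longrightarrow> dist z' z < d \<Longrightarrow> dist (f z') (f z) < e"
  using assms unfolding continuous_on_iff by metis

lemma usc_onE:
  assumes "usc_on S f" "z \<in> S" "0 < e"
  obtains d where "d > 0" "\<And>z'. z' \<in> S \<Longrightarrow> dist z' z < d \<Longrightarrow> f z' < f z + e"
  using assms unfolding usc_on_def by metis

lemma usc_on_sequence:
  assumes "usc_on S f" "zs \<longlonglongrightarrow> z" "\<And>n. zs n \<in> S" "z \<in> S" "0 < e"
  shows "eventually (\<lambda>n. f (zs n) < f z + e) sequentially"
proof -
  from usc_onE[OF assms(1,4,5)] obtain d where "d > 0" and d: "\<And>z'. z' \<in> S \<Longrightarrow> dist z' z < d \<Longrightarrow> f z' < f z + e"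
    by metis
  have "eventually (\<lambda>n. dist (zs n) z < d) sequentially"
    using assms(2) \<open>d > 0\<close> by (rule tendstoD)
  then show ?thesis by eventually_elim (rule d[OF assms(3)])
qed

lemma usc_on_add:
  assumes "usc_on S f" "usc_on S g"
  shows "usc_on S (\<lambda>z. f z + g z)"
  unfolding usc_on_def
proof (intro ballI allI impI)
  fix z and e :: real assume z: "z \<in> S" "0 < e"
  obtain d1 where d1: "d1 > 0" "\<forall>z'\<in>S. dist z' z < d1 \<longrightarrow> f z' < f z + e/2"
    using assms(1) z unfolding usc_on_def by (meson half_gt_zero)
  obtain d2 where d2: "d2 > 0" "\<forall>z'\<in>S. dist z' z < d2 \<longrightarrow> g z' < g z + e/2"
    using assms(2) z unfolding usc_on_def by (meson half_gt_zero)
  show "\<exists>d>0. \<forall>z'\<in>S. dist z' z < d \<longrightarrow> f z' + g z' < f z + g z + e"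
    using d1 d2 by (intro exI[of _ "min d1 d2"]) fastforce
qed

lemma usc_on_max:
  assumes "usc_on S f" "usc_on S g"
  shows "usc_on S (\<lambda>z. max (f z) (g z))"
  unfolding usc_on_def
proof (intro ballI allI impI)
  fix z and e :: real assume z: "z \<in> S" "0 < e"
  obtain d1 where d1: "d1 > 0" "\<forall>z'\<in>S. dist z' z < d1 \<longrightarrow> f z' < f z + e"
    using assms(1) z unfolding usc_on_def by meson
  obtain d2 where d2: "d2 > 0" "\<forall>z'\<in>S. dist z' z < d2 \<longrightarrow> g z' < g z + e"
    using assms(2) z unfolding usc_on_def by meson
  show "\<exists>d>0. \<forall>z'\<in>S. dist z' z < d \<longrightarrow> max (f z') (g z') < max (f z) (g z) + e"
    using d1 d2 by (intro exI[of _ "min d1 d2"]) fastforce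
qed

lemma usc_on_subset: "usc_on S f \<Longrightarrow> K \<subseteq> S \<Longrightarrow> usc_on K f"
  unfolding usc_on_def by (meson subsetD)

text \<open>If no maximum existed, the relatively open sets where f lies below \<open>f y\<close>
  would cover K. The point with the largest value among those indexing a finite subcover lies in
  none of its sets.\<close>

lemma usc_on_attains_sup:
  assumes "compact K" "K \<noteq> {}" "usc_on K f"
  obtains z where "z \<in> K" "\<And>y. y \<in> K \<Longrightarrow> f y \<le> f z"
proof -
  have "\<exists>z\<in>K. \<forall>y\<in>K. f y \<le> f z"
  proof (rule ccontr)
    assume "\<not> ?thesis"
    then have cov: "\<exists>y\<in>K. f z < f y" if "z \<in> K" for z
      using that by (auto simp: not_le)
    define O' where "O' y = {z\<in>K. f z < f y}" for y
    have op: "openin (top_of_set K) (O' y)" for y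
      unfolding openin_euclidean_subtopology_iff
    proof (intro conjI ballI)
      fix z assume "z \<in> O' y"
      then have z: "z \<in> K" "f y - f z > 0" by (auto simp: O'_def)
      then obtain d where "d > 0" "\<forall>z'\<in>K. dist z' z < d \<longrightarrow> f z' < f z + (f y - f z)"
        using assms(3) unfolding usc_on_def by meson
      then show "\<exists>e>0. \<forall>x'\<in>K. dist x' z < e \<longrightarrow> x' \<in> O' y"
        by (auto simp: O'_def)
    qed (auto simp: O'_def)
    have "\<exists>D'\<subseteq>O' ` K. finite D' \<and> K \<subseteq> \<Union>D'"
      using assms(1) unfolding compact_eq_openin_cover
      by (elim allE[of _ "O' ` K"] impE) (use op cov in \<open>auto simp: O'_def\<close>)
    then obtain Y where Y: "Y \<subseteq> K" "finite Y" "K \<subseteq> (\<Union>y\<in>Y. O' y)"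
      by (metis finite_subset_image)
    with assms(2) have "Y \<noteq> {}" by auto
    then obtain y where y: "y \<in> Y" "\<forall>y'\<in>Y. f y' \<le> f y"
      using Max_in[of "f ` Y"] Max_ge[of "f ` Y"] Y(2) by fastforce
    then have "y \<in> K" using Y by auto
    then obtain y' where "y' \<in> Y" "y \<in> O' y'" using Y by auto
    then show False using y by (fastforce simp: O'_def)
  qed
  then show ?thesis using that by auto
qed

lemma mem_cyl [simp]: "(t, x) \<in> cyl T \<longleftrightarrow> 0 \<le> t \<and> t \<le> T"
  by (auto simp: cyl_def)

lemma mem_QT [simp]: "(t, x) \<in> QT T \<longleftrightarrow> 0 < t \<and> t \<le> T"
  by (auto simp: QT_def)

lemma test_fun_add:
  assumes "test_fun T \<phi> \<phi>t D\<phi>" "test_fun T \<psi> \<psi>t D\<psi>"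
  shows "test_fun T (\<lambda>t x. \<phi> t x + \<psi> t x) (\<lambda>t x. \<phi>t t x + \<psi>t t x) (\<lambda>t x. D\<phi> t x + D\<psi> t x)"
proof -
  have "((\<lambda>z. \<phi> (fst z) (snd z) + \<psi> (fst z) (snd z)) has_derivative
          (\<lambda>h. fst h * (\<phi>t t x + \<psi>t t x) + (D\<phi> t x + D\<psi> t x) \<bullet> snd h)) (at (t, x) within QT T)"
    if "t \<in> {0<..T}" for t x
  proof -
    have "((\<lambda>z. \<phi> (fst z) (snd z) + \<psi> (fst z) (snd z)) has_derivative
          (\<lambda>h. (fst h * \<phi>t t x + D\<phi> t x \<bullet> snd h) + (fst h * \<psi>t t x + D\<psi> t x \<bullet> snd h))) (at (t, x) within QT T)"
      using assms that unfolding test_fun_def by (intro has_derivative_add) auto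
    then show ?thesis by (simp add: algebra_simps inner_add_left)
  qed
  then show ?thesis
    using assms unfolding test_fun_def by (auto intro!: continuous_on_add)
qed

lemma test_fun_uminus:
  assumes "test_fun T \<phi> \<phi>t D\<phi>"
  shows "test_fun T (\<lambda>t x. - \<phi> t x) (\<lambda>t x. - \<phi>t t x) (\<lambda>t x. - D\<phi> t x)"
proof -
  have "((\<lambda>z. - \<phi> (fst z) (snd z)) has_derivative
          (\<lambda>h. fst h * (- \<phi>t t x) + (- D\<phi> t x) \<bullet> snd h)) (at (t, x) within QT T)"
    if "t \<in> {0<..T}" for t x
  proof -
    have "((\<lambda>z. - \<phi> (fst z) (snd z)) has_derivative
          (\<lambda>h. - (fst h * \<phi>t t x + D\<phi> t x \<bullet> snd h))) (at (t, x) within QT T)"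
      using assms that unfolding test_fun_def by (intro has_derivative_minus) auto
    then show ?thesis by (simp add: algebra_simps)
  qed
  then show ?thesis
    using assms unfolding test_fun_def
    by (auto intro!: continuous_on_minus simp: set_integrable_def)
qed

lemma test_fun_time:
  assumes "continuous_on {0..T} g"
    and "\<And>t. 0 < t \<Longrightarrow> t \<le> T \<Longrightarrow> (g has_real_derivative g' t) (at t)"
    and "continuous_on {0<..T} g'" and "set_integrable lborel {0<..<T} g'"
  shows "test_fun T (\<lambda>t (x::real^'d). g t) (\<lambda>t x. g' t) (\<lambda>t x. 0)"
  unfolding test_fun_def
proof (intro conjI ballI allI)
  show "continuous_on (cyl T) (\<lambda>z. g (fst z))"
    by (rule continuous_on_compose2[OF assms(1)]) (auto intro!: continuous_intros simp: cyl_def)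
  show "continuous_on (QT T) (\<lambda>z. g' (fst z))"
    by (rule continuous_on_compose2[OF assms(3)]) (auto intro!: continuous_intros simp: QT_def)
  fix t and x :: "real^'d" assume t: "t \<in> {0<..T}"
  have "(*) (g' t) = (\<lambda>h. h * g' t)" by (simp add: fun_eq_iff)
  then have "(g has_derivative (\<lambda>h. h * g' t)) (at t)"
    using assms(2)[of t] t unfolding has_field_derivative_def by simp
  then have "(g has_derivative (\<lambda>h. h * g' t)) (at (fst (t, x)))" by simp
  then have "((\<lambda>z. g (fst z)) has_derivative (\<lambda>h. fst h * g' t)) (at (t, x) within QT T)"
    by (rule has_derivative_compose[rotated]) (auto intro!: derivative_eq_intros)
  then show "((\<lambda>z. g (fst z)) has_derivative (\<lambda>h. fst h * g' t + 0 \<bullet> snd h)) (at (t, x) within QT T)"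
    by simp
qed (use assms in auto)

lemma test_fun_time_C1:
  assumes "\<And>t. (g has_real_derivative g' t) (at t)" and "continuous_on UNIV g'"
  shows "test_fun T (\<lambda>t x. g t) (\<lambda>t x. g' t) (\<lambda>t x. 0)"
proof (rule test_fun_time)
  have "isCont g t" for t using assms(1) by (rule DERIV_isCont)
  then show "continuous_on {0..T} g" by (intro continuous_at_imp_continuous_on) auto
  show "continuous_on {0<..T} g'" using assms(2) continuous_on_subset by blast
  have "set_integrable lborel {0..T} g'"
    using assms(2) by (intro borel_integrable_atLeastAtMost') (meson continuous_on_subset subset_UNIV)
  then show "set_integrable lborel {0<..<T} g'" by (rule set_integrable_subset) auto
qed (use assms in auto)

lemma test_fun_const: "test_fun T (\<lambda>t x. c) (\<lambda>t x. 0) (\<lambda>t x. 0)"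
  by (rule test_fun_time_C1) (auto intro!: derivative_eq_intros)

lemma test_fun_space_square:
  "test_fun T (\<lambda>t x. C * (norm (x - y))\<^sup>2) (\<lambda>t x. 0) (\<lambda>t x. (2 * C) *\<^sub>R (x - y))"
  unfolding test_fun_def power2_norm_eq_inner
proof (intro conjI ballI allI)
  fix t x
  show "((\<lambda>z. C * ((snd z - y) \<bullet> (snd z - y))) has_derivative (\<lambda>h. fst h * 0 + (2 * C) *\<^sub>R (x - y) \<bullet> snd h)) (at (t, x) within QT T)"
    by (rule derivative_eq_intros refl)+ (simp add: fun_eq_iff inner_commute algebra_simps)
qed (intro continuous_intros | simp add: set_integrable_def)+

text \<open>The time derivative blows up at 0 but stays integrable. This is why barriers growing
  like \<open>t powr \<alpha>\<close> are admissible test functions.\<close>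

lemma test_fun_power:
  fixes \<alpha> K :: real
  assumes "0 < \<alpha>" "\<alpha> < 1" "0 < T"
  shows "test_fun T (\<lambda>t x. K * t powr \<alpha>) (\<lambda>t x. K * (\<alpha> * t powr (\<alpha> - 1))) (\<lambda>t x. 0)"
proof (rule test_fun_time)
  show "continuous_on {0..T} (\<lambda>t. K * t powr \<alpha>)"
    using assms by (intro continuous_intros continuous_on_powr') auto
  show "((\<lambda>t. K * t powr \<alpha>) has_real_derivative K * (\<alpha> * t powr (\<alpha> - 1))) (at t)" if "0 < t" for t
    using that by (auto intro!: derivative_eq_intros)
  show "continuous_on {0<..T} (\<lambda>t. K * (\<alpha> * t powr (\<alpha> - 1)))"
    by (intro continuous_intros) auto
  have "set_integrable lborel {0<..T} (\<lambda>\<tau>. \<tau> powr (\<alpha> - 1))"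
    by (rule powr_set_integrable) (use assms in auto)
  then have "set_integrable lborel {0<..<T} (\<lambda>\<tau>. \<tau> powr (\<alpha> - 1))"
    by (rule set_integrable_subset) auto
  then show "set_integrable lborel {0<..<T} (\<lambda>t. K * (\<alpha> * t powr (\<alpha> - 1)))"
    by (intro set_integrable_mult_right)
qed

lemma test_fun_continuous: "test_fun T \<phi> \<phi>t D\<phi> \<Longrightarrow> continuous_on (cyl T) (\<lambda>z. \<phi> (fst z) (snd z))"
  by (simp add: test_fun_def)

lemma test_fun_tendsto:
  assumes "test_fun T \<phi> \<phi>t D\<phi>" "ts \<longlonglongrightarrow> t" "xs \<longlonglongrightarrow> x" "\<And>n. ts n \<in> {0..T}"
  shows "(\<lambda>n. \<phi> (ts n) (xs n)) \<longlonglongrightarrow> \<phi> t x"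
proof -
  have "t \<in> {0..T}" using assms by (meson closed_atLeastAtMost closed_sequentially)
  have "(\<lambda>n. (\<lambda>z. \<phi> (fst z) (snd z)) (ts n, xs n)) \<longlonglongrightarrow> (\<lambda>z. \<phi> (fst z) (snd z)) (t, x)"
    by (rule continuous_on_tendsto_compose[OF test_fun_continuous[OF assms(1)]])
      (use assms \<open>t \<in> _\<close> in \<open>auto intro!: tendsto_intros\<close>)
  then show ?thesis by simp
qed

lemma test_fun_grad_tendsto:
  assumes "test_fun T \<phi> \<phi>t D\<phi>" "ts \<longlonglongrightarrow> t" "xs \<longlonglongrightarrow> x" "\<And>n. ts n \<in> {0<..T}" "t \<in> {0<..T}"
  shows "(\<lambda>n. D\<phi> (ts n) (xs n)) \<longlonglongrightarrow> D\<phi> t x"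
proof -
  have "continuous_on (QT T) (\<lambda>z. D\<phi> (fst z) (snd z))" using assms(1) by (simp add: test_fun_def)
  then have "(\<lambda>n. (\<lambda>z. D\<phi> (fst z) (snd z)) (ts n, xs n)) \<longlonglongrightarrow> (\<lambda>z. D\<phi> (fst z) (snd z)) (t, x)"
    by (rule continuous_on_tendsto_compose)
      (use assms in \<open>auto intro!: tendsto_intros\<close>)
  then show ?thesis by simp
qed

lemma test_fun_time_derivative:
  fixes \<phi> :: "real \<Rightarrow> real^'a \<Rightarrow> real"
  assumes "test_fun T \<phi> \<phi>t D\<phi>" "t \<in> {0<..T}"
  shows "((\<lambda>t. \<phi> t x) has_real_derivative \<phi>t t x) (at t within {0<..T})"
proof -
  have "((\<lambda>z. \<phi> (fst z) (snd z)) has_derivative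
          (\<lambda>h. fst h * \<phi>t t x + D\<phi> t x \<bullet> snd h)) (at (t, x) within (\<lambda>t. (t, x)) ` {0<..T})"
    by (rule has_derivative_subset[of _ _ _ "QT T"]) (use assms in \<open>auto simp: test_fun_def\<close>)
  then have "((\<lambda>t. (\<lambda>z. \<phi> (fst z) (snd z)) (t, x)) has_derivative
      (\<lambda>h. fst (h, 0::real^'a) * \<phi>t t x + D\<phi> t x \<bullet> snd (h, 0::real^'a))) (at t within {0<..T})"
    by (rule has_derivative_in_compose[rotated]) (auto intro!: derivative_eq_intros)
  then show ?thesis by (simp add: has_field_derivative_def mult.commute[of _ "\<phi>t t x"])
qed

lemma test_fun_space_derivative:
  fixes \<phi> :: "real \<Rightarrow> real^'a \<Rightarrow> real"
  assumes "test_fun T \<phi> \<phi>t D\<phi>" "t \<in> {0<..T}"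
  shows "(\<phi> t has_derivative (\<lambda>h. D\<phi> t x \<bullet> h)) (at x)"
proof -
  have "((\<lambda>z. \<phi> (fst z) (snd z)) has_derivative
          (\<lambda>h. fst h * \<phi>t t x + D\<phi> t x \<bullet> snd h)) (at (t, x) within (\<lambda>y. (t, y)) ` UNIV)"
    by (rule has_derivative_subset[of _ _ _ "QT T"]) (use assms in \<open>auto simp: test_fun_def\<close>)
  then have "((\<lambda>y. (\<lambda>z. \<phi> (fst z) (snd z)) (t, y)) has_derivative
      (\<lambda>h. fst (0::real, h) * \<phi>t t x + D\<phi> t x \<bullet> snd (0::real, h))) (at x within UNIV)"
    by (rule has_derivative_in_compose[rotated]) (auto intro!: derivative_eq_intros)
  then show ?thesis by simp
qed

text \<open>The time derivative may be unbounded near time 0, so two estimates are combined: for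
  \<open>t' >= s/2\<close> the mean value theorem on a compact set, and for smaller
  \<open>t'\<close> mere boundedness of \<phi>, since then the two times are at least
  \<open>s/2\<close> apart. The second case produces the constant \<open>4 * C2 / s\<close>.\<close>

lemma test_fun_lipschitz_time:
  assumes "test_fun T \<phi> \<phi>t D\<phi>" "0 < s" "s \<le> T"
  obtains C where "C \<ge> 0" "\<And>x t t'. x \<in> cball y 1 \<Longrightarrow> t \<in> {s..T} \<Longrightarrow> t' \<in> {0..T} \<Longrightarrow> \<bar>\<phi> t x - \<phi> t' x\<bar> \<le> C * \<bar>t - t'\<bar>"
proof -
  have "continuous_on ({s/2..T} \<times> cball y 1) (\<lambda>z. \<phi>t (fst z) (snd z))"
    using assms by (auto simp: test_fun_def QT_def elim!: continuous_on_subset)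
  then have "bounded ((\<lambda>z. \<phi>t (fst z) (snd z)) ` ({s/2..T} \<times> cball y 1))"
    by (intro compact_imp_bounded compact_continuous_image compact_Times) auto
  then obtain C1 where C1: "\<And>t x. t \<in> {s/2..T} \<Longrightarrow> x \<in> cball y 1 \<Longrightarrow> \<bar>\<phi>t t x\<bar> \<le> C1"
    unfolding bounded_iff by force
  have "continuous_on ({0..T} \<times> cball y 1) (\<lambda>z. \<phi> (fst z) (snd z))"
    using assms by (auto simp: test_fun_def cyl_def elim!: continuous_on_subset)
  then have "bounded ((\<lambda>z. \<phi> (fst z) (snd z)) ` ({0..T} \<times> cball y 1))"
    by (intro compact_imp_bounded compact_continuous_image compact_Times) auto
  then obtain C2 where C2: "\<And>t x. t \<in> {0..T} \<Longrightarrow> x \<in> cball y 1 \<Longrightarrow> \<bar>\<phi> t x\<bar> \<le> C2"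
    unfolding bounded_iff by force
  have "C1 \<ge> 0" using C1[of T y] assms by force
  have "C2 \<ge> 0" using C2[of T y] assms by force
  define C where "C = max C1 (4 * C2 / s)"
  show thesis
  proof
    show "C \<ge> 0" using \<open>C1 \<ge> 0\<close> by (auto simp: C_def)
    fix x t t' assume x: "x \<in> cball y 1" and t: "t \<in> {s..T}" and t': "t' \<in> {0..T}"
    show "\<bar>\<phi> t x - \<phi> t' x\<bar> \<le> C * \<bar>t - t'\<bar>"
    proof (cases "t' \<ge> s/2")
      case True
      have "norm (\<phi> t x - \<phi> t' x) \<le> C1 * norm (t - t')"
      proof (rule field_differentiable_bound[of "{s/2..T}"])
        fix r assume r: "r \<in> {s/2..T}"
        have "((\<lambda>t. \<phi> t x) has_real_derivative \<phi>t r x) (at r within {0<..T})"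
          by (rule test_fun_time_derivative) (use assms r in auto)
        then show "((\<lambda>t. \<phi> t x) has_real_derivative \<phi>t r x) (at r within {s/2..T})"
          by (rule DERIV_subset) (use assms in auto)
        show "norm (\<phi>t r x) \<le> C1" using C1 r x by auto
      qed (use True t t' assms in auto)
      also have "\<dots> \<le> C * norm (t - t')" by (intro mult_right_mono) (auto simp: C_def)
      finally show ?thesis by simp
    next
      case False
      then have *: "\<bar>t - t'\<bar> \<ge> s / 2" using t by (simp add: abs_if)
      have "\<bar>\<phi> t x - \<phi> t' x\<bar> \<le> 2 * C2" using C2[of t x] C2[of t' x] t t' x assms by auto
      also have "\<dots> = (4 * C2 / s) * (s / 2)" using assms by simp
      also have "\<dots> \<le> C * \<bar>t - t'\<bar>"
        using * \<open>C2 \<ge> 0\<close> \<open>C1 \<ge> 0\<close> assms by (intro mult_mono) (auto simp: C_def)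
      finally show ?thesis .
    qed
  qed
qed

subsection \<open>The nonlocal operator\<close>

text \<open>Clamping the time to [0,T] gives a function on the whole line that ignores values
  outside the cylinder, so ordinary Borel measurability can be used.\<close>

definition slice_measurable :: "real \<Rightarrow> (real \<Rightarrow> real^'d \<Rightarrow> real) \<Rightarrow> bool" where
  "slice_measurable T f \<longleftrightarrow> (\<forall>x. (\<lambda>s. f (max 0 (min T s)) x) \<in> borel_measurable borel)"

definition bounded_cyl :: "real \<Rightarrow> (real \<Rightarrow> real^'d \<Rightarrow> real) \<Rightarrow> real \<Rightarrow> bool" where
  "bounded_cyl T f M \<longleftrightarrow> (\<forall>t\<in>{0..T}. \<forall>x. \<bar>f t x\<bar> \<le> M)"

lemma bounded_cylD: "bounded_cyl T f M \<Longrightarrow> 0 \<le> t \<Longrightarrow> t \<le> T \<Longrightarrow> \<bar>f t x\<bar> \<le> M"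
  by (simp add: bounded_cyl_def)

lemma bounded_cyl_mono: "bounded_cyl T f M \<Longrightarrow> M \<le> M' \<Longrightarrow> bounded_cyl T f M'"
  unfolding bounded_cyl_def by (meson order_trans)

lemma bounded_cyl_uminus [simp]: "bounded_cyl T (\<lambda>t x. - f t x) M \<longleftrightarrow> bounded_cyl T f M"
  by (simp add: bounded_cyl_def)

lemma slice_measurable_uminus: "slice_measurable T f \<Longrightarrow> slice_measurable T (\<lambda>t x. - f t x)"
  by (simp add: slice_measurable_def)

lemma usc_on_imp_slice_measurable:
  assumes "usc_cyl T f" "0 \<le> T"
  shows "slice_measurable T f"
  unfolding slice_measurable_def
proof
  fix x
  have "open {s. f (max 0 (min T s)) x < c}" for c
    unfolding open_dist
  proof
    fix s assume "s \<in> {s. f (max 0 (min T s)) x < c}"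
    then have "c - f (max 0 (min T s)) x > 0" by simp
    moreover have "(max 0 (min T s), x) \<in> cyl T" using assms by auto
    ultimately obtain d where "d > 0" and d: "\<forall>z'\<in>cyl T. dist z' (max 0 (min T s), x) < d \<longrightarrow>
        f (fst z') (snd z') < f (max 0 (min T s)) x + (c - f (max 0 (min T s)) x)"
      using assms(1) unfolding usc_on_def by (metis fst_conv snd_conv)
    have "f (max 0 (min T s')) x < c" if "dist s' s < d" for s'
    proof -
      have "dist (max 0 (min T s'), x) (max 0 (min T s), x) \<le> dist s' s"
        by (auto simp: dist_Pair_Pair dist_real_def)
      with that have "dist (max 0 (min T s'), x) (max 0 (min T s), x) < d" by simp
      moreover have "(max 0 (min T s'), x) \<in> cyl T" using assms(2) by auto
      ultimately have "f (max 0 (min T s')) x < f (max 0 (min T s)) x + (c - f (max 0 (min T s)) x)"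
        using d by (metis fst_conv snd_conv)
      then show ?thesis by simp
    qed
    with \<open>d > 0\<close> show "\<exists>e>0. \<forall>y. dist y s < e \<longrightarrow> y \<in> {s. f (max 0 (min T s)) x < c}" by blast
  qed
  then show "(\<lambda>s. f (max 0 (min T s)) x) \<in> borel_measurable borel"
    by (intro borel_measurableI_less) auto
qed

lemma lsc_on_imp_slice_measurable:
  assumes "lsc_on (cyl T) (\<lambda>z. f (fst z) (snd z))" "0 \<le> T"
  shows "slice_measurable T f"
proof -
  have "slice_measurable T (\<lambda>t x. - f t x)"
    using assms by (intro usc_on_imp_slice_measurable) (simp_all add: lsc_on_iff_usc_on)
  from slice_measurable_uminus[OF this] show ?thesis by simp
qed

lemma test_fun_slice_measurable: "test_fun T \<phi> \<phi>t D\<phi> \<Longrightarrow> 0 \<le> T \<Longrightarrow> slice_measurable T \<phi>"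
  by (intro usc_on_imp_slice_measurable continuous_on_imp_usc_on test_fun_continuous)

text \<open>The operator \<open>J\<^sub>r[\<phi>] + K\<^sub>r[f]\<close> with \<open>r = t - a\<close> as a single integral over \<open>(0,\<infinity>)\<close>: extending \<open>f\<close>
  by \<open>f 0\<close> to negative times turns the boundary term of \<open>K\<close> into the part of the integral over
  \<open>\<tau> > t\<close>, because \<open>\<alpha>\<close> times the integral of the kernel over \<open>(t,\<infinity>)\<close> is the power \<open>-\<alpha>\<close> of \<open>t\<close>.\<close>

definition incr :: "real \<Rightarrow> (real \<Rightarrow> real^'d \<Rightarrow> real) \<Rightarrow> (real \<Rightarrow> real^'d \<Rightarrow> real) \<Rightarrow> real \<Rightarrow> real^'d \<Rightarrow> real \<Rightarrow> real \<Rightarrow> real" where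
  "incr a \<phi> f t x r \<tau> = (if \<tau> \<le> 0 then 0 else if \<tau> < t - a then \<phi> t x - \<phi> (t - \<tau>) x else r - f (max 0 (t - \<tau>)) x)"

text \<open>The present value \<open>r\<close> is separate from the past \<open>f\<close>. In limits
  \<open>r\<close> comes from approximating functions while \<open>f\<close> supplies the past, and
  in certificates it is the value of one function over the past of another.\<close>

definition Lop :: "real \<Rightarrow> real \<Rightarrow> (real \<Rightarrow> real^'d \<Rightarrow> real) \<Rightarrow> (real \<Rightarrow> real^'d \<Rightarrow> real) \<Rightarrow> real \<Rightarrow> real^'d \<Rightarrow> real \<Rightarrow> real" where
  "Lop \<alpha> a \<phi> f t x r = \<alpha> / Gamma (1 - \<alpha>) * (LINT \<tau>:{0<..}|lborel. incr a \<phi> f t x r \<tau> * \<tau> powr (-\<alpha> - 1))"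

lemma incr_measurable:
  assumes "slice_measurable T \<phi>" "slice_measurable T f" "0 \<le> a" "0 \<le> t" "t \<le> T"
  shows "incr a \<phi> f t x r \<in> borel_measurable borel"
proof -
  have [measurable]: "(\<lambda>s. \<phi> (max 0 (min T s)) x) \<in> borel_measurable borel"
    "(\<lambda>s. f (max 0 (min T s)) x) \<in> borel_measurable borel"
    using assms by (auto simp: slice_measurable_def)
  have "incr a \<phi> f t x r = (\<lambda>\<tau>. if \<tau> \<le> 0 then 0 else if \<tau> < t - a
      then \<phi> t x - (\<lambda>s. \<phi> (max 0 (min T s)) x) (t - \<tau>) else r - (\<lambda>s. f (max 0 (min T s)) x) (t - \<tau>))"
    using assms by (auto simp: incr_def fun_eq_iff max_def min_def)
  also have "\<dots> \<in> borel_measurable borel" by measurable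
  finally show ?thesis .
qed

text \<open>Delays below \<open>t - a\<close> use the Lipschitz bound of \<phi>, with
  \<open>max T 1\<close> covering delays between 1 and T. The remaining delays are at least
  \<delta>, so there the bound \<open>2 * M\<close> is a multiple of \<open>min \<tau> 1\<close>.
  The constant is uniform in t and x, as dominated convergence along moving points requires.\<close>

lemma incr_bound:
  assumes \<phi>: "test_fun T \<phi> \<phi>t D\<phi>" and f: "bounded_cyl T f M" and "0 \<le> a" "0 < \<delta>" "a + \<delta> \<le> T"
  obtains C where "\<And>t x r \<tau>. t \<in> {a + \<delta>..T} \<Longrightarrow> x \<in> cball y 1 \<Longrightarrow> \<bar>r\<bar> \<le> M \<Longrightarrow> 0 < \<tau> \<Longrightarrow>
    \<bar>incr a \<phi> f t x r \<tau>\<bar> \<le> C * min \<tau> 1"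
proof -
  obtain C where C: "C \<ge> 0" "\<And>x t t'. x \<in> cball y 1 \<Longrightarrow> t \<in> {a + \<delta>..T} \<Longrightarrow> t' \<in> {0..T} \<Longrightarrow> \<bar>\<phi> t x - \<phi> t' x\<bar> \<le> C * \<bar>t - t'\<bar>"
    using test_fun_lipschitz_time[OF \<phi>, of "a + \<delta>" y] assms by (metis add_nonneg_pos)
  have M: "M \<ge> 0" using bounded_cylD[OF f, of T 0] assms by (auto intro: order_trans[of _ "\<bar>f T 0\<bar>"])
  define B where "B = C * max T 1 + 2 * M / min \<delta> 1"
  have B1: "C * max T 1 \<le> B" using M assms by (auto simp: B_def)
  have B2: "2 * M / min \<delta> 1 \<le> B" using C by (auto simp: B_def)
  have "0 \<le> C * max T 1" using C(1) by simp
  with B1 have B0: "0 \<le> B" by linarith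
  show thesis
  proof
    fix t r \<tau> :: real and x
    assume t: "t \<in> {a + \<delta>..T}" and x: "x \<in> cball y 1" and r: "\<bar>r\<bar> \<le> M" and \<tau>: "0 < \<tau>"
    show "\<bar>incr a \<phi> f t x r \<tau>\<bar> \<le> B * min \<tau> 1"
    proof (cases "\<tau> < t - a")
      case True
      then have "\<bar>incr a \<phi> f t x r \<tau>\<bar> \<le> C * \<tau>"
        using C(2)[OF x t, of "t - \<tau>"] \<tau> t \<open>0 \<le> a\<close> by (simp add: incr_def)
      also have "\<dots> \<le> C * (max T 1 * min \<tau> 1)"
      proof (rule mult_left_mono)
        show "\<tau> \<le> max T 1 * min \<tau> 1"
        proof (cases "\<tau> \<le> 1")
          case True
          then show ?thesis using \<tau> mult_right_mono[of 1 "max T 1" \<tau>] by simp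
        next
          case False
          then show ?thesis using \<open>\<tau> < t - a\<close> t assms by simp
        qed
      qed (rule C)
      also have "\<dots> = (C * max T 1) * min \<tau> 1" by simp
      also have "\<dots> \<le> B * min \<tau> 1" using B1 \<tau> by (intro mult_right_mono) auto
      finally show ?thesis .
    next
      case False
      then have *: "min \<tau> 1 \<ge> min \<delta> 1" using t by auto
      have "\<bar>incr a \<phi> f t x r \<tau>\<bar> \<le> 2 * M"
        using False \<tau> r bounded_cylD[OF f, of "max 0 (t - \<tau>)" x] t assms(3-5) by (simp add: incr_def)
      also have "\<dots> = 2 * M / min \<delta> 1 * min \<delta> 1" using assms by simp
      also have "\<dots> \<le> B * min \<tau> 1" 
        by (rule mult_mono[OF B2 * B0]) (use assms in simp)
      finally show ?thesis .
    qed
  qed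
qed

text \<open>Increments of the quadratic time penalties over a delay \<tau> have the form on the
  left; the bound makes them integrable against the kernel.\<close>

lemma quadratic_le_min:
  fixes \<tau> T c :: real
  assumes "0 < \<tau>" "\<tau> \<le> T" "0 \<le> c"
  shows "\<tau>\<^sup>2 + c * \<tau> \<le> (1 + T\<^sup>2 + c * (1 + T)) * min \<tau> 1"
proof (cases "\<tau> \<le> 1")
  case True
  have "\<tau>\<^sup>2 \<le> 1 * \<tau>" unfolding power2_eq_square using assms True by (intro mult_right_mono) auto
  moreover have "0 \<le> T\<^sup>2 * \<tau>" "0 \<le> c * (T * \<tau>)" using assms by auto
  ultimately show ?thesis using True by (simp add: algebra_simps)
next
  case False
  have "\<tau>\<^sup>2 \<le> T\<^sup>2" using assms by (intro power_mono) auto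
  moreover have "c * \<tau> \<le> c * (1 + T)" using assms by (intro mult_left_mono) auto
  ultimately show ?thesis using False by simp
qed

locale caputo =
  fixes \<alpha> T :: real
  assumes \<alpha>0: "0 < \<alpha>" and \<alpha>1: "\<alpha> < 1" and T0: "0 < T"
begin

lemma Gamma_pos: "Gamma (1 - \<alpha>) > 0"
  using \<alpha>1 by (intro Gamma_real_pos) auto

lemma incr_integrable:
  assumes "test_fun T \<phi> \<phi>t D\<phi>" "slice_measurable T f" "bounded_cyl T f M" "0 \<le> a" "a < t" "t \<le> T"
  shows "set_integrable lborel {0<..} (\<lambda>\<tau>. incr a \<phi> f t x r \<tau> * \<tau> powr (-\<alpha> - 1))"
proof -
  have "bounded_cyl T f (max M \<bar>r\<bar>)" using assms(3) by (rule bounded_cyl_mono) simp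
  from incr_bound[OF assms(1) this, of a "t - a" x] obtain C where
    C: "\<And>t' x' r' \<tau>. t' \<in> {a + (t - a)..T} \<Longrightarrow> x' \<in> cball x 1 \<Longrightarrow> \<bar>r'\<bar> \<le> max M \<bar>r\<bar> \<Longrightarrow> 0 < \<tau> \<Longrightarrow>
      \<bar>incr a \<phi> f t' x' r' \<tau>\<bar> \<le> C * min \<tau> 1"
    using assms(4-6) by auto
  show ?thesis
  proof (rule kern_integrable[OF \<alpha>0 \<alpha>1])
    show "incr a \<phi> f t x r \<in> borel_measurable borel"
      using test_fun_slice_measurable[OF assms(1)] assms(2,4-6) T0 by (intro incr_measurable) auto
    show "\<bar>incr a \<phi> f t x r \<tau>\<bar> \<le> C * min \<tau> 1" if "0 < \<tau>" for \<tau>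
      by (rule C) (use assms(4-6) that in auto)
  qed
qed

text \<open>Controls quadratic penalisations, whose increments are bounded by multiples of \<open>min \<tau> 1\<close>.\<close>

definition Lconst :: real where
  "Lconst = \<alpha> / Gamma (1 - \<alpha>) * (LINT \<tau>:{0<..}|lborel. min \<tau> 1 * \<tau> powr (-\<alpha> - 1))"

text \<open>Test function, past, present value and splitting time enter the operator through the
  increments alone, so all later comparisons reduce to pointwise inequalities between
  increments.\<close>

lemma Lop_le_add:
  assumes "test_fun T \<phi> \<phi>t D\<phi>" "slice_measurable T f" "bounded_cyl T f M" "0 \<le> a" "a < t" "t \<le> T"
    and "test_fun T \<psi> \<psi>t D\<psi>" "slice_measurable T g" "bounded_cyl T g M'" "0 \<le> b" "b < t"
    and "\<And>\<tau>. 0 < \<tau> \<Longrightarrow> incr a \<phi> f t x r \<tau> \<le> incr b \<psi> g t x q \<tau> + e * min \<tau> 1"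
  shows "Lop \<alpha> a \<phi> f t x r \<le> Lop \<alpha> b \<psi> g t x q + e * Lconst"
proof -
  let ?k = "\<lambda>\<tau>. \<tau> powr (-\<alpha> - 1)"
  have i1: "set_integrable lborel {0<..} (\<lambda>\<tau>. incr a \<phi> f t x r \<tau> * ?k \<tau>)"
    using assms by (intro incr_integrable) auto
  have i2: "set_integrable lborel {0<..} (\<lambda>\<tau>. incr b \<psi> g t x q \<tau> * ?k \<tau>)"
    using assms by (intro incr_integrable) auto
  have i3: "set_integrable lborel {0<..} (\<lambda>\<tau>. e * (min \<tau> 1 * ?k \<tau>))"
    by (intro set_integrable_mult_right kern_integrable_min \<alpha>0 \<alpha>1)
  have "(LINT \<tau>:{0<..}|lborel. incr a \<phi> f t x r \<tau> * ?k \<tau>)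
      \<le> (LINT \<tau>:{0<..}|lborel. incr b \<psi> g t x q \<tau> * ?k \<tau> + e * (min \<tau> 1 * ?k \<tau>))"
  proof (intro set_integral_mono i1 set_integral_add(1)[OF i2 i3])
    fix \<tau> :: real assume "\<tau> \<in> {0<..}"
    then have "incr a \<phi> f t x r \<tau> * ?k \<tau> \<le> (incr b \<psi> g t x q \<tau> + e * min \<tau> 1) * ?k \<tau>"
      using assms by (intro mult_right_mono) auto
    then show "incr a \<phi> f t x r \<tau> * ?k \<tau> \<le> incr b \<psi> g t x q \<tau> * ?k \<tau> + e * (min \<tau> 1 * ?k \<tau>)"
      by (simp add: algebra_simps)
  qed
  also have "\<dots> = (LINT \<tau>:{0<..}|lborel. incr b \<psi> g t x q \<tau> * ?k \<tau>) + e * (LINT \<tau>:{0<..}|lborel. min \<tau> 1 * ?k \<tau>)"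
    using set_integral_add(2)[OF i2 i3] by simp
  finally have "\<alpha> / Gamma (1 - \<alpha>) * (LINT \<tau>:{0<..}|lborel. incr a \<phi> f t x r \<tau> * ?k \<tau>) \<le>
     \<alpha> / Gamma (1 - \<alpha>) * ((LINT \<tau>:{0<..}|lborel. incr b \<psi> g t x q \<tau> * ?k \<tau>) + e * (LINT \<tau>:{0<..}|lborel. min \<tau> 1 * ?k \<tau>))"
    using Gamma_pos \<alpha>0 by (intro mult_left_mono) auto
  then show ?thesis
    unfolding Lop_def Lconst_def by (simp add: algebra_simps)
qed

lemma Lop_mono:
  assumes "test_fun T \<phi> \<phi>t D\<phi>" "slice_measurable T f" "bounded_cyl T f M" "0 \<le> a" "a < t" "t \<le> T"
    and "test_fun T \<psi> \<psi>t D\<psi>" "slice_measurable T g" "bounded_cyl T g M'" "0 \<le> b" "b < t"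
    and "\<And>\<tau>. 0 < \<tau> \<Longrightarrow> incr a \<phi> f t x r \<tau> \<le> incr b \<psi> g t x q \<tau>"
  shows "Lop \<alpha> a \<phi> f t x r \<le> Lop \<alpha> b \<psi> g t x q"
  using Lop_le_add[OF assms(1-11), of x r q 0] assms(12) by simp

lemma Lop_uminus:
  assumes "test_fun T \<phi> \<phi>t D\<phi>" "slice_measurable T f" "bounded_cyl T f M" "0 \<le> a" "a < t" "t \<le> T"
  shows "Lop \<alpha> a (\<lambda>t x. - \<phi> t x) (\<lambda>t x. - f t x) t x (- r) = - Lop \<alpha> a \<phi> f t x r"
proof -
  have "incr a (\<lambda>t x. - \<phi> t x) (\<lambda>t x. - f t x) t x (- r) \<tau> * k = - (incr a \<phi> f t x r \<tau> * k)" for \<tau> k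
    by (simp add: incr_def algebra_simps)
  then show ?thesis
    using set_integral_uminus[OF incr_integrable[OF assms, of x r]] by (simp add: Lop_def)
qed

lemma eint_eq:
  assumes "set_integrable lborel A g"
  shows "eint A g = ereal (LINT \<tau>:A|lborel. g \<tau>)"
proof -
  let ?G = "\<lambda>\<tau>. indicator A \<tau> *\<^sub>R g \<tau>"
  have i: "integrable lborel ?G" using assms by (simp add: set_integrable_def)
  have 1: "(\<integral>\<^sup>+ \<tau>. ennreal (g \<tau>) * indicator A \<tau> \<partial>lborel) = (\<integral>\<^sup>+ \<tau>. ennreal (?G \<tau>) \<partial>lborel)"
    and 2: "(\<integral>\<^sup>+ \<tau>. ennreal (- g \<tau>) * indicator A \<tau> \<partial>lborel) = (\<integral>\<^sup>+ \<tau>. ennreal (- ?G \<tau>) \<partial>lborel)"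
    by (auto intro!: nn_integral_cong simp: indicator_def)
  have f: "(\<integral>\<^sup>+ \<tau>. ennreal (?G \<tau>) \<partial>lborel) < \<infinity>" "(\<integral>\<^sup>+ \<tau>. ennreal (- ?G \<tau>) \<partial>lborel) < \<infinity>"
    using i by (auto simp: real_integrable_def top.not_eq_extremum)
  have "enn2ereal y = ereal (enn2real y)" if "y < \<infinity>" for y
    using that by (cases y) (auto simp: enn2ereal_ennreal)
  with f show ?thesis
    unfolding eint_def 1 2 set_lebesgue_integral_def real_lebesgue_integral_def[OF i] by simp
qed

lemma Jop_Kop_eq:
  assumes \<phi>: "test_fun T \<phi> \<phi>t D\<phi>" and f: "slice_measurable T f" "bounded_cyl T f M" and a: "0 \<le> a" "a < t" "t \<le> T"
  shows "Jop \<alpha> (t - a) \<phi> t x + Kop \<alpha> (t - a) f t x = ereal (Lop \<alpha> a \<phi> f t x (f t x))"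
proof -
  define h where "h = (\<lambda>\<tau>. incr a \<phi> f t x (f t x) \<tau> * \<tau> powr (-\<alpha> - 1))"
  have ih: "set_integrable lborel {0<..} h"
    unfolding h_def by (rule incr_integrable[OF assms])
  have sub: "set_integrable lborel A h" if "A \<subseteq> {0<..}" "A \<in> sets borel" for A
    using set_integrable_subset[OF ih] that by auto
  let ?j = "\<lambda>\<tau>. (\<phi> t x - \<phi> (t - \<tau>) x) * \<tau> powr (-\<alpha> - 1)"
  let ?k = "\<lambda>\<tau>. (f t x - f (t - \<tau>) x) * \<tau> powr (-\<alpha> - 1)"
  have j0: "set_integrable lborel {0<..<t-a} ?j"
  proof (subst set_integrable_cong[where f' = h])
    show "set_integrable lborel {0<..<t-a} h" by (rule sub) auto
  qed (auto simp: h_def incr_def)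
  have jeq: "(LINT \<tau>:{0<..<t-a}|lborel. ?j \<tau>) = (LINT \<tau>:{0<..<t-a}|lborel. h \<tau>)"
    by (intro set_lebesgue_integral_cong) (auto simp: h_def incr_def)
  \<comment> \<open>The operator J integrates over a closed interval, but at its right end
    \<open>incr\<close> has already switched to the past and at 0 it is set to 0. Both ends are
    null.\<close>
  have dd: "set_integrable lborel {0..t-a} ?j = set_integrable lborel {0<..<t-a} ?j"
    by (rule set_integrable_discrete_difference[of "{0, t - a}"]) auto
  have dd2: "set_lebesgue_integral lborel {0..t-a} ?j = set_lebesgue_integral lborel {0<..<t-a} ?j"
    by (rule set_integral_discrete_difference[of "{0, t - a}"]) auto
  have J: "eint {0..t-a} ?j = ereal (LINT \<tau>:{0<..<t-a}|lborel. h \<tau>)"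
    using eint_eq[of "{0..t-a}" ?j] dd dd2 j0 jeq by simp
  have k0: "set_integrable lborel {t-a..t} ?k"
  proof (subst set_integrable_cong[where f' = h])
    show "set_integrable lborel {t-a..t} h" using a by (intro sub) auto
  qed (use a in \<open>auto simp: h_def incr_def\<close>)
  have keq: "(LINT \<tau>:{t-a..t}|lborel. ?k \<tau>) = (LINT \<tau>:{t-a..t}|lborel. h \<tau>)"
    using a by (intro set_lebesgue_integral_cong) (auto simp: h_def incr_def)
  have K: "eint {t-a..t} ?k = ereal (LINT \<tau>:{t-a..t}|lborel. h \<tau>)"
    using eint_eq[OF k0] keq by simp
  have "(LINT \<tau>:{t<..}|lborel. h \<tau>) = (LINT \<tau>:{t<..}|lborel. (f t x - f 0 x) * \<tau> powr (-\<alpha> - 1))"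
    using a by (intro set_lebesgue_integral_cong) (auto simp: h_def incr_def)
  also have "\<dots> = (f t x - f 0 x) * (LINT \<tau>:{t<..}|lborel. \<tau> powr (-\<alpha> - 1))" by simp
  also have "(LINT \<tau>:{t<..}|lborel. \<tau> powr (-\<alpha> - 1)) = (LINT \<tau>:{t..}|lborel. \<tau> powr (-\<alpha> - 1))"
    by (rule set_integral_discrete_difference[of "{t}"]) auto
  also have "\<dots> = t powr (-\<alpha>) / \<alpha>" using a by (intro kern_integrable_tail(2) \<alpha>0) auto
  finally have tail: "(LINT \<tau>:{t<..}|lborel. h \<tau>) = (f t x - f 0 x) / (t powr \<alpha> * \<alpha>)"
    by (simp add: powr_minus field_simps)
  have u1: "{0<..<t-a} \<union> {t-a..t} = {0<..t}" "{0<..t} \<union> {t<..} = {0<..}" using a by auto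
  have "(LINT \<tau>:{0<..t}|lborel. h \<tau>) = (LINT \<tau>:{0<..<t-a}|lborel. h \<tau>) + (LINT \<tau>:{t-a..t}|lborel. h \<tau>)"
    unfolding u1(1)[symmetric] using a by (intro set_integral_Un sub) auto
  moreover have "(LINT \<tau>:{0<..}|lborel. h \<tau>) = (LINT \<tau>:{0<..t}|lborel. h \<tau>) + (LINT \<tau>:{t<..}|lborel. h \<tau>)"
    unfolding u1(2)[symmetric] using a by (intro set_integral_Un sub) auto
  ultimately have tot: "(LINT \<tau>:{0<..}|lborel. h \<tau>) = (LINT \<tau>:{0<..<t-a}|lborel. h \<tau>) + (LINT \<tau>:{t-a..t}|lborel. h \<tau>)
      + (f t x - f 0 x) / (t powr \<alpha> * \<alpha>)" using tail by simp
  have "Lop \<alpha> a \<phi> f t x (f t x) = \<alpha> / Gamma (1 - \<alpha>) * (LINT \<tau>:{0<..<t-a}|lborel. h \<tau>)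
      + ((f t x - f 0 x) / (t powr \<alpha> * Gamma (1 - \<alpha>)) + \<alpha> / Gamma (1 - \<alpha>) * (LINT \<tau>:{t-a..t}|lborel. h \<tau>))"
    using tot \<alpha>0 Gamma_pos a unfolding Lop_def h_def[symmetric] by (simp add: field_simps)
  then show ?thesis unfolding Jop_def Kop_def J K by simp
qed

text \<open>A Fatou-type lower semicontinuity: increments of \<phi> converge, and upper
  semicontinuity of f means that increments taken over the past can only drop in the limit.
  \<open>incr_bound\<close> supplies one majorant for the whole sequence.\<close>

lemma Lop_limit:
  assumes \<phi>: "test_fun T \<phi> \<phi>t D\<phi>" and f: "usc_cyl T f" "bounded_cyl T f M"
    and a: "0 \<le> a" "a < t" and tn: "\<And>n. a < tn n" "\<And>n. tn n \<le> T"
    and lim: "tn \<longlonglongrightarrow> t" "xn \<longlonglongrightarrow> x" "rn \<longlonglongrightarrow> r" "cn \<longlonglongrightarrow> c"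
    and le: "\<And>n. Lop \<alpha> a \<phi> f (tn n) (xn n) (rn n) \<le> cn n"
  shows "Lop \<alpha> a \<phi> f t x r \<le> c"
proof -
  have t: "t \<le> T" by (rule LIMSEQ_le_const2[OF lim(1)]) (use tn in auto)
  \<comment> \<open>Half the distance keeps almost all approximating times at least \<delta> above
    a, where the majorant is uniform; N later removes the exceptions.\<close>
  define \<delta> where "\<delta> = (t - a) / 2"
  have \<delta>: "0 < \<delta>" "a + \<delta> < t" using a by (auto simp: \<delta>_def field_simps)
  have "Bseq rn" using lim(3) by (meson convergentI convergent_imp_Bseq)
  then obtain R where R: "\<And>n. \<bar>rn n\<bar> \<le> R" by (auto simp: Bseq_def)
  define M' where "M' = max M (max R \<bar>r\<bar>)"
  have f': "bounded_cyl T f M'" using f(2) by (rule bounded_cyl_mono) (simp add: M'_def)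
  obtain C where C: "\<And>t x' r \<tau>. t \<in> {a + \<delta>..T} \<Longrightarrow> x' \<in> cball x 1 \<Longrightarrow> \<bar>r\<bar> \<le> M' \<Longrightarrow> 0 < \<tau> \<Longrightarrow>
    \<bar>incr a \<phi> f t x' r \<tau>\<bar> \<le> C * min \<tau> 1"
    using incr_bound[OF \<phi> f', of a \<delta> x] \<delta> a t by auto
  have "eventually (\<lambda>n. tn n > a + \<delta>) sequentially"
    using lim(1) \<delta>(2) by (rule order_tendstoD)
  moreover have "eventually (\<lambda>n. dist (xn n) x < 1) sequentially"
    using lim(2) by (rule tendstoD) simp
  ultimately have "eventually (\<lambda>n. tn n > a + \<delta> \<and> dist (xn n) x < 1) sequentially"
    by eventually_elim simp
  then obtain N where N: "\<And>n. n \<ge> N \<Longrightarrow> tn n > a + \<delta> \<and> dist (xn n) x < 1"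
    by (auto simp: eventually_sequentially)
  have meas: "slice_measurable T \<phi>" "slice_measurable T f"
    using test_fun_slice_measurable[OF \<phi>] usc_on_imp_slice_measurable[OF f(1)] T0 by auto
  have "(LINT \<tau>:{0<..}|lborel. incr a \<phi> f t x r \<tau> * \<tau> powr (-\<alpha> - 1)) \<le> c * Gamma (1 - \<alpha>) / \<alpha>"
  proof (rule kern_fatou[where C = C and s = "t - a" and cn = "\<lambda>n. cn (n + N) * Gamma (1 - \<alpha>) / \<alpha>"
        and hn = "\<lambda>n. incr a \<phi> f (tn (n + N)) (xn (n + N)) (rn (n + N))"])
    show "incr a \<phi> f t x r \<in> borel_measurable borel"
      using meas a t by (intro incr_measurable) auto
    show "incr a \<phi> f (tn (n + N)) (xn (n + N)) (rn (n + N)) \<in> borel_measurable borel" for n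
      using meas a tn[of "n + N"] by (intro incr_measurable) auto
    show "\<bar>incr a \<phi> f t x r \<tau>\<bar> \<le> C * min \<tau> 1" if "0 < \<tau>" for \<tau>
      using that \<delta> t by (intro C) (auto simp: M'_def)
    show "\<bar>incr a \<phi> f (tn (n + N)) (xn (n + N)) (rn (n + N)) \<tau>\<bar> \<le> C * min \<tau> 1" if "0 < \<tau>" for n \<tau>
      using that N[of "n + N"] tn[of "n + N"] R[of "n + N"] by (intro C) (auto simp: M'_def dist_commute)
    show "(\<lambda>n. cn (n + N) * Gamma (1 - \<alpha>) / \<alpha>) \<longlonglongrightarrow> c * Gamma (1 - \<alpha>) / \<alpha>"
      using \<alpha>0 lim(4) by (intro tendsto_intros LIMSEQ_ignore_initial_segment) auto
    show "(LINT \<tau>:{0<..}|lborel. incr a \<phi> f (tn (n + N)) (xn (n + N)) (rn (n + N)) \<tau> * \<tau> powr (-\<alpha> - 1))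
        \<le> cn (n + N) * Gamma (1 - \<alpha>) / \<alpha>" for n
      using le[of "n + N"] \<alpha>0 Gamma_pos unfolding Lop_def by (simp add: field_simps)
    fix \<tau> e :: real assume \<tau>: "0 < \<tau>" "\<tau> \<noteq> t - a" and e: "0 < e"
    have "eventually (\<lambda>n. incr a \<phi> f (tn n) (xn n) (rn n) \<tau> > incr a \<phi> f t x r \<tau> - e) sequentially"
    proof (cases "\<tau> < t - a")
      case True
      have "(\<lambda>n. tn n - a) \<longlonglongrightarrow> t - a" by (intro tendsto_intros lim)
      then have ev1: "eventually (\<lambda>n. \<tau> < tn n - a) sequentially" using True by (rule order_tendstoD)
      have tt: "(\<lambda>n. max 0 (tn n - \<tau>)) \<longlonglongrightarrow> max 0 (t - \<tau>)" by (intro tendsto_intros lim)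
      have range: "tn n \<in> {0..T}" "max 0 (tn n - \<tau>) \<in> {0..T}" for n
        using tn(1)[of n] tn(2)[of n] \<tau> a T0 by auto
      have "(\<lambda>n. \<phi> (tn n) (xn n) - \<phi> (max 0 (tn n - \<tau>)) (xn n)) \<longlonglongrightarrow> \<phi> t x - \<phi> (max 0 (t - \<tau>)) x"
        by (intro tendsto_diff test_fun_tendsto[OF \<phi>] lim tt range)
      moreover have "\<phi> t x - \<phi> (max 0 (t - \<tau>)) x > incr a \<phi> f t x r \<tau> - e"
        using True \<tau> e a by (simp add: incr_def)
      ultimately have "eventually (\<lambda>n. \<phi> (tn n) (xn n) - \<phi> (max 0 (tn n - \<tau>)) (xn n) > incr a \<phi> f t x r \<tau> - e) sequentially"
        by (rule order_tendstoD)
      with ev1 show ?thesis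
        by eventually_elim (use \<tau> a in \<open>auto simp: incr_def\<close>)
    next
      case False
      then have "t - a < \<tau>" using \<tau> by auto
      moreover have "(\<lambda>n. tn n - a) \<longlonglongrightarrow> t - a" by (intro tendsto_intros lim)
      ultimately have ev1: "eventually (\<lambda>n. tn n - a < \<tau>) sequentially" by (metis order_tendstoD(2))
      have tt: "(\<lambda>n. (max 0 (tn n - \<tau>), xn n)) \<longlonglongrightarrow> (max 0 (t - \<tau>), x)" by (intro tendsto_intros lim)
      have "tn n - \<tau> \<le> T" "t - \<tau> \<le> T" for n using tn(2)[of n] t \<tau> by auto
      then have ev2: "eventually (\<lambda>n. (\<lambda>z. f (fst z) (snd z)) (max 0 (tn n - \<tau>), xn n) < (\<lambda>z. f (fst z) (snd z)) (max 0 (t - \<tau>), x) + e/2) sequentially"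
        using e T0 by (intro usc_on_sequence[OF f(1) tt]) auto
      have "eventually (\<lambda>n. rn n > r - e/2) sequentially"
        using lim(3) by (rule order_tendstoD) (use e in auto)
      with ev1 ev2 show ?thesis
        by eventually_elim (use \<tau> False in \<open>auto simp: incr_def\<close>)
    qed
    then show "eventually (\<lambda>n. incr a \<phi> f (tn (n + N)) (xn (n + N)) (rn (n + N)) \<tau> > incr a \<phi> f t x r \<tau> - e) sequentially"
      by (rule sequentially_offset)
  qed (use \<alpha>0 \<alpha>1 in auto)
  then show ?thesis unfolding Lop_def using \<alpha>0 Gamma_pos by (simp add: field_simps)
qed

end

subsection \<open>Stability of subsolutions\<close>

lemma visc_sub_usc: "visc_sub \<alpha> T H v \<Longrightarrow> usc_cyl T v"
  by (simp add: visc_sub_def)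

text \<open>The maximum is taken up to the final time T, so fewer contact points are tested than in
  \<open>visc_sub\<close>. \<open>visc_sub_stability\<close> leads back from this notion to the full
  one.\<close>

definition weak_sub :: "real \<Rightarrow> real \<Rightarrow> (real \<Rightarrow> real^'d \<Rightarrow> real \<Rightarrow> real^'d \<Rightarrow> real)
    \<Rightarrow> (real \<Rightarrow> real^'d \<Rightarrow> real) \<Rightarrow> bool" where
  "weak_sub \<alpha> T H u \<longleftrightarrow>
     (\<forall>a c \<rho> \<phi> \<phi>t D\<phi> t x.
        0 \<le> a \<and> a < t \<and> t \<le> T \<and> \<rho> > 0 \<and> test_fun T \<phi> \<phi>t D\<phi> \<and> x \<in> ball c \<rho> \<and>
        (\<forall>s\<in>{a..T}. \<forall>y\<in>cball c \<rho>. u s y - \<phi> s y \<le> u t x - \<phi> t x) \<longrightarrow>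
        Lop \<alpha> a \<phi> u t x (u t x) + H t x (u t x) (D\<phi> t x) \<le> 0)"

locale hamilton_jacobi = caputo +
  fixes H :: "real \<Rightarrow> real^'d \<Rightarrow> real \<Rightarrow> real^'d \<Rightarrow> real"
  assumes H_cont: "continuous_on ({0..T} \<times> UNIV \<times> UNIV \<times> UNIV) (\<lambda>(t, x, r, p). H t x r p)"
begin

lemma H_tendsto:
  assumes "tn \<longlonglongrightarrow> t" "xn \<longlonglongrightarrow> x" "rn \<longlonglongrightarrow> r" "pn \<longlonglongrightarrow> p" "\<And>n. tn n \<in> {0..T}"
  shows "(\<lambda>n. H (tn n) (xn n) (rn n) (pn n)) \<longlonglongrightarrow> H t x r p"
proof -
  have "t \<in> {0..T}" using assms by (meson closed_atLeastAtMost closed_sequentially)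
  have "(\<lambda>n. (\<lambda>(t, x, r, p). H t x r p) (tn n, xn n, rn n, pn n)) \<longlonglongrightarrow> (\<lambda>(t, x, r, p). H t x r p) (t, x, r, p)"
    by (rule continuous_on_tendsto_compose[OF H_cont])
      (use assms \<open>t \<in> _\<close> in \<open>auto intro!: tendsto_intros\<close>)
  then show ?thesis by simp
qed

lemma H_bounded:
  obtains B where "\<And>t x r p. t \<in> {0..T} \<Longrightarrow> x \<in> cball y R \<Longrightarrow> \<bar>r\<bar> \<le> M \<Longrightarrow> norm p \<le> P \<Longrightarrow> \<bar>H t x r p\<bar> \<le> B"
proof -
  let ?K = "{0..T} \<times> cball y R \<times> {-M..M} \<times> cball (0::real^'d) P"
  have "bounded ((\<lambda>(t, x, r, p). H t x r p) ` ?K)"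
    by (intro compact_imp_bounded compact_continuous_image compact_Times continuous_on_subset[OF H_cont]) auto
  then obtain B where B: "\<And>z. z \<in> ?K \<Longrightarrow> norm ((\<lambda>(t, x, r, p). H t x r p) z) \<le> B"
    unfolding bounded_iff by blast
  show thesis
  proof
    fix t x r p assume "t \<in> {0..T}" "x \<in> cball y R" "\<bar>r\<bar> \<le> M" "norm (p::real^'d) \<le> P"
    then show "\<bar>H t x r p\<bar> \<le> B" using B[of "(t, x, r, p)"] by (auto simp: abs_le_iff)
  qed
qed

lemma visc_subD:
  assumes "visc_sub \<alpha> T H u" "bounded_cyl T u M"
    and "0 \<le> a" "a < b" "b \<le> T" "\<rho> > 0" "test_fun T \<phi> \<phi>t D\<phi>" "a < t" "t \<le> b" "x \<in> ball c \<rho>"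
    and "\<And>s y. s \<in> {a..b} \<Longrightarrow> y \<in> cball c \<rho> \<Longrightarrow> u s y - \<phi> s y \<le> u t x - \<phi> t x"
  shows "Lop \<alpha> a \<phi> u t x (u t x) + H t x (u t x) (D\<phi> t x) \<le> 0"
proof -
  have "slice_measurable T u"
    using assms(1) T0 by (intro usc_on_imp_slice_measurable) (auto simp: visc_sub_def)
  then have eq: "Jop \<alpha> (t - a) \<phi> t x + Kop \<alpha> (t - a) u t x = ereal (Lop \<alpha> a \<phi> u t x (u t x))"
    using assms(2-9) by (intro Jop_Kop_eq[OF assms(7)]) auto
  have "0 \<le> a \<and> a < b \<and> b \<le> T \<and> \<rho> > 0 \<and> test_fun T \<phi> \<phi>t D\<phi> \<and> t \<in> {a<..b} \<and> x \<in> ball c \<rho> \<and>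
        (\<forall>s\<in>{a..b}. \<forall>y\<in>cball c \<rho>. u s y - \<phi> s y \<le> u t x - \<phi> t x)"
    using assms(3-11) by simp
  with assms(1)[unfolded visc_sub_def, THEN conjunct2]
  have "Jop \<alpha> (t - a) \<phi> t x + Kop \<alpha> (t - a) u t x + ereal (H t x (u t x) (D\<phi> t x)) \<le> 0"
    by blast
  then show ?thesis unfolding eq by simp
qed

lemma visc_subI:
  assumes "usc_cyl T u" "bounded_cyl T u M"
    and "\<And>a b c \<rho> \<phi> \<phi>t D\<phi> t x. 0 \<le> a \<Longrightarrow> a < t \<Longrightarrow> t \<le> b \<Longrightarrow> b \<le> T \<Longrightarrow> \<rho> > 0 \<Longrightarrow> test_fun T \<phi> \<phi>t D\<phi> \<Longrightarrow> x \<in> ball c \<rho> \<Longrightarrow>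
      (\<And>s y. s \<in> {a..b} \<Longrightarrow> y \<in> cball c \<rho> \<Longrightarrow> u s y - \<phi> s y \<le> u t x - \<phi> t x) \<Longrightarrow>
      Lop \<alpha> a \<phi> u t x (u t x) + H t x (u t x) (D\<phi> t x) \<le> 0"
  shows "visc_sub \<alpha> T H u"
  unfolding visc_sub_def
proof (intro conjI allI impI assms(1))
  fix a b c \<rho> \<phi> \<phi>t D\<phi> t x
  assume *: "0 \<le> a \<and> a < b \<and> b \<le> T \<and> 0 < \<rho> \<and> test_fun T \<phi> \<phi>t D\<phi> \<and> t \<in> {a<..b} \<and> x \<in> ball c \<rho> \<and>
       (\<forall>s\<in>{a..b}. \<forall>y\<in>cball c \<rho>. u s y - \<phi> s y \<le> u t x - \<phi> t x)"
  have "slice_measurable T u"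
    using assms(1) T0 by (intro usc_on_imp_slice_measurable) auto
  then have eq: "Jop \<alpha> (t - a) \<phi> t x + Kop \<alpha> (t - a) u t x = ereal (Lop \<alpha> a \<phi> u t x (u t x))"
    using assms(2) * by (intro Jop_Kop_eq[of \<phi> \<phi>t D\<phi>]) auto
  have "Lop \<alpha> a \<phi> u t x (u t x) + H t x (u t x) (D\<phi> t x) \<le> 0"
    using * by (intro assms(3)[of a t b \<rho> \<phi> \<phi>t D\<phi> x c]) auto
  then show "Jop \<alpha> (t - a) \<phi> t x + Kop \<alpha> (t - a) u t x + ereal (H t x (u t x) (D\<phi> t x)) \<le> 0"
    unfolding eq by simp
qed

lemma visc_sub_imp_weak_sub:
  assumes "visc_sub \<alpha> T H u" "bounded_cyl T u M"
  shows "weak_sub \<alpha> T H u"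
  unfolding weak_sub_def
proof (intro allI impI)
  fix a c \<rho> \<phi> \<phi>t D\<phi> t x
  assume *: "0 \<le> a \<and> a < t \<and> t \<le> T \<and> 0 < \<rho> \<and> test_fun T \<phi> \<phi>t D\<phi> \<and> x \<in> ball c \<rho> \<and>
       (\<forall>s\<in>{a..T}. \<forall>y\<in>cball c \<rho>. u s y - \<phi> s y \<le> u t x - \<phi> t x)"
  show "Lop \<alpha> a \<phi> u t x (u t x) + H t x (u t x) (D\<phi> t x) \<le> 0"
    by (rule visc_subD[OF assms, of a T \<rho> \<phi> \<phi>t D\<phi> t x c]) (use * in auto)
qed

text \<open>Half-relaxed limits.  A maximum over \<open>[a,b]\<close> at the final time \<open>t = b\<close> does not see the times
  after \<open>b\<close>, where the approximating points may lie.  The penalty \<open>exp (n * (n * (s - t) - 1))\<close>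
  pushes the approximating maxima back to times close to \<open>t\<close>, and being nondecreasing
  it changes the nonlocal operator in the favourable direction only.\<close>

lemma visc_sub_stability:
  assumes F: "\<And>v. v \<in> F \<Longrightarrow> usc_cyl T v" "\<And>v. v \<in> F \<Longrightarrow> bounded_cyl T v M"
      "\<And>v. v \<in> F \<Longrightarrow> weak_sub \<alpha> T H v" "\<And>v t x. v \<in> F \<Longrightarrow> 0 \<le> t \<Longrightarrow> t \<le> T \<Longrightarrow> v t x \<le> f t x"
    and f: "usc_cyl T f" "bounded_cyl T f M"
    and approx: "\<And>t x e. 0 < t \<Longrightarrow> t \<le> T \<Longrightarrow> 0 < e \<Longrightarrow>
        \<exists>v\<in>F. \<exists>s y. s \<le> T \<and> \<bar>s - t\<bar> < e \<and> dist y x < e \<and> v s y > f t x - e"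
  shows "visc_sub \<alpha> T H f"
proof (rule visc_subI[OF f])
  fix a b c \<rho> \<phi> \<phi>t D\<phi> t x
  assume a: "0 \<le> a" "a < t" and tb: "t \<le> b" "b \<le> T" and \<rho>: "\<rho> > (0::real)" and \<phi>: "test_fun T \<phi> \<phi>t D\<phi>"
    and x: "x \<in> ball c \<rho>"
    and max: "\<And>s y. s \<in> {a..b} \<Longrightarrow> y \<in> cball c \<rho> \<Longrightarrow> f s y - \<phi> s y \<le> f t x - \<phi> t x"
  have tT: "t \<le> T" using tb by simp
  have main: "Lop \<alpha> a \<phi> f t x (f t x) + H t x (f t x) (D\<phi> t x) \<le> (\<epsilon> * (1 + T\<^sup>2)) * Lconst" if \<epsilon>: "0 < \<epsilon>" for \<epsilon>
  proof -
    \<comment> \<open>The quadratic penalty makes the maximum strict, so approximating maxima can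
      accumulate only at (t,x). Its cost in the operator is proportional to \<epsilon>, which tends
      to 0 at the end.\<close>
    define \<psi> where "\<psi> = (\<lambda>s y. \<phi> s y + (\<epsilon> * (s - t)\<^sup>2 + \<epsilon> * (norm (y - x))\<^sup>2))"
    define \<psi>t where "\<psi>t = (\<lambda>s y. \<phi>t s y + (\<epsilon> * (2 * (s - t)) + 0))"
    define D\<psi> where "D\<psi> = (\<lambda>s y. D\<phi> s y + (0 + (2 * \<epsilon>) *\<^sub>R (y - x)))"
    have tf_q: "test_fun T (\<lambda>s (y::real^'d). \<epsilon> * (s - t)\<^sup>2) (\<lambda>s y. \<epsilon> * (2 * (s - t))) (\<lambda>s y. 0)"
      by (rule test_fun_time_C1) (auto intro!: derivative_eq_intros continuous_intros)
    have \<psi>: "test_fun T \<psi> \<psi>t D\<psi>"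
      unfolding \<psi>_def \<psi>t_def D\<psi>_def by (intro test_fun_add \<phi> tf_q test_fun_space_square)
    define \<theta> where "\<theta> = (\<lambda>(n::nat) s. exp (real n * (real n * (s - t) - 1)))"
    define \<theta>t where "\<theta>t = (\<lambda>(n::nat) s. exp (real n * (real n * (s - t) - 1)) * (real n * real n))"
    have \<theta>: "test_fun T (\<lambda>s (y::real^'d). \<theta> n s) (\<lambda>s y. \<theta>t n s) (\<lambda>s y. 0)" for n
      unfolding \<theta>_def \<theta>t_def
      by (rule test_fun_time_C1) (auto intro!: derivative_eq_intros continuous_intros)
    \<comment> \<open>This radius keeps the approximating points inside the domain of the
      maximisation, both in time and in space.\<close>
    define e0 where "e0 = min (t - a) (\<rho> - dist c x)"
    have e0: "e0 > 0" using a x by (simp add: e0_def)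
    \<comment> \<open>The square gives \<open>n\<^sup>2 * \<bar>sn n - t\<bar> <= 1\<close>, so the
      exponential penalty at the approximating point is at most \<open>exp (1 - n)\<close>, even
      when that point lies after t.\<close>
    define e where "e = (\<lambda>n. min e0 ((1 / real (Suc n))\<^sup>2))"
    have epos: "e n > 0" for n using e0 by (simp add: e_def)
    have "\<forall>n. \<exists>v s y. v \<in> F \<and> s \<le> T \<and> \<bar>s - t\<bar> < e n \<and> dist y x < e n \<and> v s y > f t x - e n"
      using approx[of t "e _" x] a tT epos by (meson le_less_trans)
    then obtain v sn yn where v: "\<And>n. v n \<in> F" and sn: "\<And>n. sn n \<le> T" "\<And>n. \<bar>sn n - t\<bar> < e n"
      and yn: "\<And>n. dist (yn n) x < e n" and vn: "\<And>n. v n (sn n) (yn n) > f t x - e n"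
      by metis
    have e_le: "e n \<le> e0" "e n \<le> (1 / real (Suc n))\<^sup>2" for n by (auto simp: e_def)
    have "(\<lambda>n. (1 / real (Suc n))\<^sup>2) \<longlonglongrightarrow> 0\<^sup>2"
      by (intro tendsto_intros LIMSEQ_Suc lim_1_over_n)
    then have e_lim: "e \<longlonglongrightarrow> 0"
      by (intro tendsto_sandwich[where f = "\<lambda>_. 0" and g = e and h = "\<lambda>n. (1 / real (Suc n))\<^sup>2"])
        (simp_all only: less_imp_le[OF epos] e_le eventually_True tendsto_const power_zero_numeral)
    have sn_lim: "sn \<longlonglongrightarrow> t"
      unfolding tendsto_dist_iff[of sn]
      by (rule tendsto_sandwich[OF _ _ tendsto_const e_lim]) (simp_all add: dist_real_def less_imp_le[OF sn(2)])
    have yn_lim: "yn \<longlonglongrightarrow> x"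
      unfolding tendsto_dist_iff[of yn]
      by (rule tendsto_sandwich[OF _ _ tendsto_const e_lim]) (simp_all add: less_imp_le[OF yn])
    have sn_mem: "sn n \<in> {a..T}" for n
      using sn(1,2)[of n] e_le(1)[of n] by (auto simp: e0_def)
    have sn_mem0: "sn n \<in> {0..T}" for n using sn_mem[of n] a by auto
    have yn_mem: "yn n \<in> cball c \<rho>" for n
      using yn[of n] e_le(1)[of n] dist_triangle[of c "yn n" x] by (auto simp: e0_def dist_commute)
    define K where "K = {a..T} \<times> cball c \<rho>"
    have K: "compact K" "K \<noteq> {}" "K \<subseteq> cyl T"
      using a tT \<rho> by (auto simp: K_def cyl_def intro!: compact_Times)
    \<comment> \<open>A lower bound for the maximal value of the penalised difference, obtained by
      evaluating it at \<open>(sn n, yn n)\<close>; it tends to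
      \<open>f t x - \<phi> t x\<close>.\<close>
    define m where "m = (\<lambda>n. f t x - e n - \<psi> (sn n) (yn n) - exp (1 - real n))"
    have max_ex: "\<exists>s y. s \<in> {a..T} \<and> y \<in> cball c \<rho> \<and>
        (\<forall>s'\<in>{a..T}. \<forall>y'\<in>cball c \<rho>. v n s' y' - (\<psi> s' y' + \<theta> n s') \<le> v n s y - (\<psi> s y + \<theta> n s))" for n
    proof -
      have "test_fun T (\<lambda>s y. - (\<psi> s y + \<theta> n s)) (\<lambda>s y. - (\<psi>t s y + \<theta>t n s)) (\<lambda>s y. - (D\<psi> s y + 0))"
        by (intro test_fun_uminus test_fun_add \<psi> \<theta>)
      then have "usc_on (cyl T) (\<lambda>z. v n (fst z) (snd z) + (- (\<psi> (fst z) (snd z) + \<theta> n (fst z))))"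
        by (intro usc_on_add F(1) v continuous_on_imp_usc_on test_fun_continuous[of T "\<lambda>s y. - (\<psi> s y + \<theta> n s)"])
      then have "usc_on K (\<lambda>z. v n (fst z) (snd z) + (- (\<psi> (fst z) (snd z) + \<theta> n (fst z))))"
        using K(3) by (rule usc_on_subset)
      from usc_on_attains_sup[OF K(1,2) this] obtain z where
        "z \<in> K" "\<And>z'. z' \<in> K \<Longrightarrow> v n (fst z') (snd z') + (- (\<psi> (fst z') (snd z') + \<theta> n (fst z'))) \<le> v n (fst z) (snd z) + (- (\<psi> (fst z) (snd z) + \<theta> n (fst z)))"
        by metis
      then show ?thesis
        by (intro exI[of _ "fst z"] exI[of _ "snd z"]) (force simp: K_def)
    qed
    then obtain tn xn where tn: "\<And>n. tn n \<in> {a..T}" and xn: "\<And>n. xn n \<in> cball c \<rho>"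
      and mx: "\<And>n s y. s \<in> {a..T} \<Longrightarrow> y \<in> cball c \<rho> \<Longrightarrow>
          v n s y - (\<psi> s y + \<theta> n s) \<le> v n (tn n) (xn n) - (\<psi> (tn n) (xn n) + \<theta> n (tn n))"
      by metis
    have key: "v n (tn n) (xn n) \<ge> \<psi> (tn n) (xn n) + \<theta> n (tn n) + m n" for n
    proof -
      have "real n * (real n * (sn n - t)) \<le> real n * (real n * (1 / real (Suc n))\<^sup>2)"
        using sn(2)[of n] e_le(2)[of n] by (intro mult_left_mono) auto
      also have "\<dots> = (real n / real (Suc n))\<^sup>2" by (simp add: power2_eq_square)
      also have "\<dots> \<le> 1\<^sup>2" by (intro power_mono) auto
      finally have "\<theta> n (sn n) \<le> exp (1 - real n)" by (simp add: \<theta>_def algebra_simps)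
      then show ?thesis using mx[OF sn_mem[of n] yn_mem[of n], of n] vn[of n] by (simp add: m_def)
    qed
    have "exp (1 - real n) = exp 1 * exp (-1) ^ n" for n
      by (simp add: exp_of_nat_mult[symmetric] exp_add[symmetric])
    moreover have "(\<lambda>n. exp 1 * exp (-1 :: real) ^ n) \<longlonglongrightarrow> exp 1 * 0"
      by (intro tendsto_mult tendsto_const LIMSEQ_power_zero) simp
    ultimately have "(\<lambda>n. exp (1 - real n)) \<longlonglongrightarrow> 0" by simp
    then have "m \<longlonglongrightarrow> f t x - 0 - \<psi> t x - 0"
      unfolding m_def
      by (intro tendsto_diff tendsto_const test_fun_tendsto[OF \<psi> sn_lim yn_lim] e_lim sn_mem0)
    then have m_lim: "m \<longlonglongrightarrow> f t x - \<phi> t x" by (simp add: \<psi>_def)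
    have sc: "seq_compact K" using K(1) by (simp add: compact_eq_seq_compact_metric)
    have inK: "\<forall>n. (tn n, xn n) \<in> K" using tn xn by (simp add: K_def)
    obtain z \<sigma> where z: "z \<in> K" "strict_mono (\<sigma> :: nat \<Rightarrow> nat)" "((\<lambda>n. (tn n, xn n)) \<circ> \<sigma>) \<longlonglongrightarrow> z"
      using seq_compactE[OF sc inK] by metis
    obtain t' x' where z': "z = (t', x')" by (cases z)
    have lim: "(\<lambda>n. tn (\<sigma> n)) \<longlonglongrightarrow> t'" "(\<lambda>n. xn (\<sigma> n)) \<longlonglongrightarrow> x'"
      using tendsto_fst[OF z(3)] tendsto_snd[OF z(3)] by (simp_all add: z' o_def)
    have mem': "t' \<in> {a..T}" "x' \<in> cball c \<rho>" using z(1) by (auto simp: z' K_def)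
    have m_lim': "(\<lambda>n. m (\<sigma> n)) \<longlonglongrightarrow> f t x - \<phi> t x"
      using LIMSEQ_subseq_LIMSEQ[OF m_lim z(2)] by (simp add: o_def)
    have \<psi>_lim: "(\<lambda>n. \<psi> (tn (\<sigma> n)) (xn (\<sigma> n))) \<longlonglongrightarrow> \<psi> t' x'"
      by (intro test_fun_tendsto[OF \<psi> lim]) (meson tn a(1) atLeastAtMost_iff order_trans)
    have vf: "v n (tn n) (xn n) \<le> f (tn n) (xn n)" for n
      using F(4)[OF v] tn[of n] a by auto
    \<comment> \<open>By \<open>key\<close> and the common bounds the penalty at the maximum point
      is at most D. Since \<open>1 + z <= exp z\<close>, its exponent is bounded above as well,
      which bounds \<open>tn (\<sigma> n) - t\<close> by a quantity of order
      \<open>1 / \<sigma> n\<close>.\<close>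
    have "t' \<le> t"
    proof -
      have "Bseq (\<lambda>n. \<psi> (tn (\<sigma> n)) (xn (\<sigma> n)) + m (\<sigma> n))"
        using tendsto_add[OF \<psi>_lim m_lim'] by (meson convergentI convergent_imp_Bseq)
      then obtain B where B: "\<And>n. \<bar>\<psi> (tn (\<sigma> n)) (xn (\<sigma> n)) + m (\<sigma> n)\<bar> \<le> B" by (auto simp: Bseq_def)
      define D where "D = M + B"
      have est: "tn (\<sigma> n) - t \<le> 1 / real (\<sigma> n) + D * (1 / real (\<sigma> n))\<^sup>2" if "n \<ge> 1" for n
      proof -
        have \<sigma>n: "real (\<sigma> n) > 0" using strict_mono_imp_increasing[OF z(2), of n] that by simp
        have "1 + real (\<sigma> n) * (real (\<sigma> n) * (tn (\<sigma> n) - t) - 1) \<le> \<theta> (\<sigma> n) (tn (\<sigma> n))"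
          unfolding \<theta>_def by (rule exp_ge_add_one_self)
        also have "\<dots> \<le> D"
          using key[of "\<sigma> n"] B[of n] bounded_cylD[OF F(2)[OF v], of "tn (\<sigma> n)" "\<sigma> n" "xn (\<sigma> n)"] tn[of "\<sigma> n"] a
          by (auto simp: D_def)
        finally have "(real (\<sigma> n))\<^sup>2 * (tn (\<sigma> n) - t) \<le> real (\<sigma> n) + D"
          by (simp add: algebra_simps power2_eq_square)
        then have "tn (\<sigma> n) - t \<le> (real (\<sigma> n) + D) / (real (\<sigma> n))\<^sup>2"
          using \<sigma>n by (simp add: pos_le_divide_eq mult.commute)
        also have "\<dots> = 1 / real (\<sigma> n) + D * (1 / real (\<sigma> n))\<^sup>2"
          using \<sigma>n by (simp add: field_simps power2_eq_square)
        finally show ?thesis .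
      qed
      have i: "(\<lambda>n. 1 / real (\<sigma> n)) \<longlonglongrightarrow> 0"
        using LIMSEQ_subseq_LIMSEQ[OF lim_1_over_n z(2)] by (simp add: o_def)
      have "(\<lambda>n. 1 / real (\<sigma> n) + D * (1 / real (\<sigma> n))\<^sup>2) \<longlonglongrightarrow> 0 + D * 0\<^sup>2"
        by (intro tendsto_intros i)
      moreover have "(\<lambda>n. tn (\<sigma> n) - t) \<longlonglongrightarrow> t' - t" by (intro tendsto_intros lim)
      ultimately have "t' - t \<le> 0 + D * 0\<^sup>2"
        using est by (intro LIMSEQ_le) auto
      then show ?thesis by simp
    qed
    have \<theta>pos: "\<theta> n s > 0" for n s by (simp add: \<theta>_def)
    have zlim: "(\<lambda>n. (tn (\<sigma> n), xn (\<sigma> n))) \<longlonglongrightarrow> (t', x')" by (intro tendsto_intros lim)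
    have cylmem: "(tn n, xn n) \<in> cyl T" "(t', x') \<in> cyl T" for n using tn[of n] mem' a by auto
    \<comment> \<open>This is the limit of \<open>key\<close> with the positive penalty dropped.
      Because \<open>t' <= t <= b\<close>, maximality of \<open>f - \<phi>\<close> now applies at
      the limit point, and the quadratic part of \<psi> has to vanish there.\<close>
    have lower: "\<psi> t' x' + (f t x - \<phi> t x) \<le> f t' x'"
    proof (rule field_le_epsilon)
      fix \<eta> :: real assume "0 < \<eta>"
      have "eventually (\<lambda>n. f (tn (\<sigma> n)) (xn (\<sigma> n)) < f t' x' + \<eta>) sequentially"
        using usc_on_sequence[OF f(1) zlim cylmem \<open>0 < \<eta>\<close>] by simp
      then have "eventually (\<lambda>n. \<psi> (tn (\<sigma> n)) (xn (\<sigma> n)) + m (\<sigma> n) \<le> f t' x' + \<eta>) sequentially"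
      proof eventually_elim
        case (elim n)
        then show ?case using key[of "\<sigma> n"] vf[of "\<sigma> n"] \<theta>pos[of "\<sigma> n" "tn (\<sigma> n)"] by linarith
      qed
      then show "\<psi> t' x' + (f t x - \<phi> t x) \<le> f t' x' + \<eta>"
        using tendsto_add[OF \<psi>_lim m_lim'] by (intro tendsto_upperbound[of _ _ sequentially]) auto
    qed
    have "f t' x' - \<phi> t' x' \<le> f t x - \<phi> t x" using mem' \<open>t' \<le> t\<close> tb by (intro max) auto
    with lower have "\<epsilon> * ((t' - t)\<^sup>2 + (norm (x' - x))\<^sup>2) \<le> 0" by (simp add: \<psi>_def algebra_simps)
    then have "(t' - t)\<^sup>2 + (norm (x' - x))\<^sup>2 \<le> 0" using \<epsilon> by (simp add: mult_le_0_iff)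
    then have eq: "t' = t" "x' = x" by (auto simp: sum_power2_le_zero_iff)
    define rn where "rn = (\<lambda>n. v n (tn n) (xn n))"
    have rn_lim: "(\<lambda>n. rn (\<sigma> n)) \<longlonglongrightarrow> f t x"
    proof (rule order_tendstoI)
      fix q assume "q < f t x"
      have "(\<lambda>n. \<psi> (tn (\<sigma> n)) (xn (\<sigma> n)) + m (\<sigma> n)) \<longlonglongrightarrow> \<psi> t x + (f t x - \<phi> t x)"
        using tendsto_add[OF \<psi>_lim m_lim'] eq by simp
      moreover have "\<psi> t x + (f t x - \<phi> t x) > q" using \<open>q < f t x\<close> by (simp add: \<psi>_def)
      ultimately have "eventually (\<lambda>n. \<psi> (tn (\<sigma> n)) (xn (\<sigma> n)) + m (\<sigma> n) > q) sequentially"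
        by (rule order_tendstoD)
      then show "eventually (\<lambda>n. rn (\<sigma> n) > q) sequentially"
      proof eventually_elim
        case (elim n)
        then show ?case using key[of "\<sigma> n"] \<theta>pos[of "\<sigma> n" "tn (\<sigma> n)"] by (simp add: rn_def)
      qed
    next
      fix q assume "f t x < q"
      then have "eventually (\<lambda>n. f (tn (\<sigma> n)) (xn (\<sigma> n)) < f t' x' + (q - f t x)) sequentially"
        using usc_on_sequence[OF f(1) zlim cylmem, of "q - f t x"] by simp
      then show "eventually (\<lambda>n. rn (\<sigma> n) < q) sequentially"
      proof eventually_elim
        case (elim n)
        then show ?case using vf[of "\<sigma> n"] eq by (simp add: rn_def)
      qed
    qed
    have "eventually (\<lambda>n. tn (\<sigma> n) > a) sequentially"
      using lim(1) a(2) unfolding eq by (rule order_tendstoD)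
    moreover have "eventually (\<lambda>n. xn (\<sigma> n) \<in> ball c \<rho>) sequentially"
      using lim(2) x unfolding eq by (intro topological_tendstoD) auto
    ultimately have "eventually (\<lambda>n. tn (\<sigma> n) > a \<and> xn (\<sigma> n) \<in> ball c \<rho>) sequentially"
      by eventually_elim simp
    then obtain N where N: "\<And>n. n \<ge> N \<Longrightarrow> tn (\<sigma> n) > a \<and> xn (\<sigma> n) \<in> ball c \<rho>"
      by (auto simp: eventually_sequentially)
    define \<kappa> where "\<kappa> = (\<lambda>n. \<sigma> (n + N))"
    have tn\<kappa>: "a < tn (\<kappa> n)" "tn (\<kappa> n) \<le> T" "xn (\<kappa> n) \<in> ball c \<rho>" for n
      using N[of "n + N"] tn by (auto simp: \<kappa>_def)
    have lim\<kappa>: "(\<lambda>n. tn (\<kappa> n)) \<longlonglongrightarrow> t" "(\<lambda>n. xn (\<kappa> n)) \<longlonglongrightarrow> x" "(\<lambda>n. rn (\<kappa> n)) \<longlonglongrightarrow> f t x"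
      unfolding \<kappa>_def using lim rn_lim eq
      by (simp_all add: LIMSEQ_ignore_initial_segment[of "\<lambda>n. tn (\<sigma> n)"] LIMSEQ_ignore_initial_segment[of "\<lambda>n. xn (\<sigma> n)"]
          LIMSEQ_ignore_initial_segment[of "\<lambda>n. rn (\<sigma> n)"])
    have meas: "slice_measurable T (v n)" "slice_measurable T f" for n
      using usc_on_imp_slice_measurable F(1)[OF v] f(1) T0 by (auto intro: usc_on_imp_slice_measurable)
    define cn where "cn = (\<lambda>n. - H (tn (\<kappa> n)) (xn (\<kappa> n)) (rn (\<kappa> n)) (D\<psi> (tn (\<kappa> n)) (xn (\<kappa> n))))"
    have "Lop \<alpha> a \<psi> f t x (f t x) \<le> - H t x (f t x) (D\<psi> t x)"
    proof (rule Lop_limit[OF \<psi> f a, where tn = "\<lambda>n. tn (\<kappa> n)" and xn = "\<lambda>n. xn (\<kappa> n)" and rn = "\<lambda>n. rn (\<kappa> n)" and cn = cn])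
      show "cn \<longlonglongrightarrow> - H t x (f t x) (D\<psi> t x)"
        unfolding cn_def using tn\<kappa> a tT
        by (intro tendsto_minus H_tendsto lim\<kappa> test_fun_grad_tendsto[OF \<psi>]) (auto intro: less_imp_le le_less_trans order_trans)
      fix n
      let ?n = "\<kappa> n"
      have tf: "test_fun T (\<lambda>s y. \<psi> s y + \<theta> ?n s) (\<lambda>s y. \<psi>t s y + \<theta>t ?n s) (\<lambda>s y. D\<psi> s y + 0)"
        by (intro test_fun_add \<psi> \<theta>)
      have "Lop \<alpha> a \<psi> f (tn ?n) (xn ?n) (rn ?n) \<le> Lop \<alpha> a (\<lambda>s y. \<psi> s y + \<theta> ?n s) (v ?n) (tn ?n) (xn ?n) (rn ?n)"
      proof (rule Lop_mono[OF \<psi> meas(2) f(2) a(1) tn\<kappa>(1,2) tf meas(1) F(2)[OF v] a(1) tn\<kappa>(1)])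
        fix \<tau> :: real assume \<tau>: "0 < \<tau>"
        have "\<theta> ?n (tn ?n - \<tau>) \<le> \<theta> ?n (tn ?n)"
          using \<tau> by (simp add: \<theta>_def mult_left_mono)
        moreover have "v ?n (max 0 (tn ?n - \<tau>)) (xn ?n) \<le> f (max 0 (tn ?n - \<tau>)) (xn ?n)"
          using \<tau> tn\<kappa>(2)[of n] T0 by (intro F(4) v) auto
        ultimately show "incr a \<psi> f (tn ?n) (xn ?n) (rn ?n) \<tau> \<le> incr a (\<lambda>s y. \<psi> s y + \<theta> ?n s) (v ?n) (tn ?n) (xn ?n) (rn ?n) \<tau>"
          using \<tau> by (auto simp: incr_def)
      qed
      also have "Lop \<alpha> a (\<lambda>s y. \<psi> s y + \<theta> ?n s) (v ?n) (tn ?n) (xn ?n) (rn ?n) \<le> cn n"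
      proof -
        have "0 \<le> a \<and> a < tn ?n \<and> tn ?n \<le> T \<and> \<rho> > 0 \<and>
          test_fun T (\<lambda>s y. \<psi> s y + \<theta> ?n s) (\<lambda>s y. \<psi>t s y + \<theta>t ?n s) (\<lambda>s y. D\<psi> s y + 0) \<and> xn ?n \<in> ball c \<rho> \<and>
          (\<forall>s\<in>{a..T}. \<forall>y\<in>cball c \<rho>. v ?n s y - (\<psi> s y + \<theta> ?n s) \<le> v ?n (tn ?n) (xn ?n) - (\<psi> (tn ?n) (xn ?n) + \<theta> ?n (tn ?n)))"
          using a tn\<kappa> \<rho> tf mx by blast
        with F(3)[OF v, unfolded weak_sub_def]
        have "Lop \<alpha> a (\<lambda>s y. \<psi> s y + \<theta> ?n s) (v ?n) (tn ?n) (xn ?n) (v ?n (tn ?n) (xn ?n))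
          + H (tn ?n) (xn ?n) (v ?n (tn ?n) (xn ?n)) ((\<lambda>s y. D\<psi> s y + 0) (tn ?n) (xn ?n)) \<le> 0"
          by blast
        then show ?thesis by (simp add: cn_def rn_def)
      qed
      finally show "Lop \<alpha> a \<psi> f (tn ?n) (xn ?n) (rn ?n) \<le> cn n" .
    qed (use tn\<kappa> lim\<kappa> in auto)
    moreover have "D\<psi> t x = D\<phi> t x" by (simp add: D\<psi>_def)
    \<comment> \<open>Going back a time \<tau> from t changes the penalty by exactly
      \<open>\<epsilon> * \<tau>\<^sup>2\<close>; the spatial part is constant along the
      segment.\<close>
    moreover have "Lop \<alpha> a \<phi> f t x (f t x) \<le> Lop \<alpha> a \<psi> f t x (f t x) + (\<epsilon> * (1 + T\<^sup>2)) * Lconst"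
    proof (rule Lop_le_add[OF \<phi> meas(2) f(2) a tT \<psi> meas(2) f(2) a])
      fix \<tau> :: real assume \<tau>: "0 < \<tau>"
      show "incr a \<phi> f t x (f t x) \<tau> \<le> incr a \<psi> f t x (f t x) \<tau> + \<epsilon> * (1 + T\<^sup>2) * min \<tau> 1"
      proof (cases "\<tau> < t - a")
        case True
        have "\<tau>\<^sup>2 \<le> (1 + T\<^sup>2) * min \<tau> 1"
          using quadratic_le_min[of \<tau> T 0] \<tau> True a tT by simp
        then have "\<epsilon> * \<tau>\<^sup>2 \<le> \<epsilon> * ((1 + T\<^sup>2) * min \<tau> 1)" using \<epsilon> by (intro mult_left_mono) auto
        then show ?thesis using True \<tau> by (simp add: incr_def \<psi>_def)
      next
        case False
        then show ?thesis using \<tau> \<epsilon> by (simp add: incr_def)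
      qed
    qed
    ultimately show ?thesis by simp
  qed
  have "(\<lambda>n. (1 / real (Suc n) * (1 + T\<^sup>2)) * Lconst) \<longlonglongrightarrow> (0 * (1 + T\<^sup>2)) * Lconst"
    by (intro tendsto_intros LIMSEQ_Suc lim_1_over_n)
  then have "(\<lambda>n. (1 / real (Suc n) * (1 + T\<^sup>2)) * Lconst) \<longlonglongrightarrow> 0" by simp
  moreover have "Lop \<alpha> a \<phi> f t x (f t x) + H t x (f t x) (D\<phi> t x) \<le> (1 / real (Suc n) * (1 + T\<^sup>2)) * Lconst" for n
    by (rule main) simp
  ultimately show "Lop \<alpha> a \<phi> f t x (f t x) + H t x (f t x) (D\<phi> t x) \<le> 0"
    by (intro LIMSEQ_le_const) auto
qed

end

subsection \<open>Certificates, barriers and duality\<close>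

lemma test_fun_gradient_eq:
  assumes "test_fun T \<phi> \<phi>t D\<phi>" "test_fun T \<psi> \<psi>t D\<psi>" "t \<in> {0<..T}"
    and "eventually (\<lambda>y. \<phi> t y - \<psi> t y \<le> \<phi> t x - \<psi> t x) (at x)"
  shows "D\<phi> t x = D\<psi> t x"
proof -
  have "((\<lambda>y. \<phi> t y - \<psi> t y) has_derivative (\<lambda>h. D\<phi> t x \<bullet> h - D\<psi> t x \<bullet> h)) (at x)"
    using assms by (intro has_derivative_diff test_fun_space_derivative)
  then have "(\<lambda>h. D\<phi> t x \<bullet> h - D\<psi> t x \<bullet> h) = (\<lambda>h. 0)"
    using assms(4) by (rule has_derivative_local_max)
  then have "(D\<phi> t x - D\<psi> t x) \<bullet> (D\<phi> t x - D\<psi> t x) = 0"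
    by (metis inner_diff_left)
  then show ?thesis by simp
qed

section \<open>Power-type barriers\<close>

context caputo
begin

text \<open>Only delays of at least t contribute. For \<open>r = K * t powr \<alpha>\<close> the
  result is the constant \<open>K / Gamma (1 - \<alpha>)\<close>, which is why the barriers grow
  like this power of t.\<close>

lemma Lop_const:
  assumes "0 < t"
  shows "Lop \<alpha> 0 (\<lambda>_ _. 0) (\<lambda>_ _. 0) t (x :: real^'d) r = r / (t powr \<alpha> * Gamma (1 - \<alpha>))"
proof -
  have "(LINT \<tau>:{0<..}|lborel. incr 0 (\<lambda>_ _. 0) (\<lambda>_ _. 0) t x r \<tau> * \<tau> powr (-\<alpha> - 1))
      = (LINT \<tau>:{t..}|lborel. r * \<tau> powr (-\<alpha> - 1))"
    unfolding set_lebesgue_integral_def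
    by (intro Bochner_Integration.integral_cong) (use assms in \<open>auto simp: incr_def indicator_def\<close>)
  also have "\<dots> = r * (t powr (-\<alpha>) / \<alpha>)"
    using kern_integrable_tail(2)[OF \<alpha>0 assms] by simp
  finally show ?thesis
    unfolding Lop_def using \<alpha>0 Gamma_pos by (simp add: powr_minus field_simps)
qed

lemma const_admissible [simp]: "slice_measurable T (\<lambda>_ _. c)" "bounded_cyl T (\<lambda>_ _. c) \<bar>c\<bar>"
  by (auto simp: slice_measurable_def bounded_cyl_def)

text \<open>Increments of \<phi> are nonnegative and can be discarded; with a = 0 the remaining
  delays see the initial value \<open>f 0 x\<close> alone. The comparison is with the explicit case
  \<open>Lop_const\<close>.\<close>

lemma Lop_ge_power:
  assumes "test_fun T \<phi> \<phi>t D\<phi>" "slice_measurable T f" "bounded_cyl T f M" "0 < t" "t \<le> T"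
    and "\<And>s. s \<in> {0..t} \<Longrightarrow> \<phi> s x \<le> \<phi> t x" "r - f 0 x \<ge> K * t powr \<alpha>"
  shows "Lop \<alpha> 0 \<phi> f t (x :: real^'d) r \<ge> K / Gamma (1 - \<alpha>)"
proof -
  have "Lop \<alpha> 0 (\<lambda>_ _. 0) (\<lambda>_ _. 0) t x (K * t powr \<alpha>) \<le> Lop \<alpha> 0 \<phi> f t x r"
    by (rule Lop_mono[OF test_fun_const const_admissible _ assms(4,5,1,2,3)])
      (use assms in \<open>auto simp: incr_def\<close>)
  then show ?thesis unfolding Lop_const[OF assms(4)] using assms(4) by simp
qed

lemma Lop_le_power:
  assumes "test_fun T \<phi> \<phi>t D\<phi>" "slice_measurable T f" "bounded_cyl T f M" "0 < t" "t \<le> T"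
    and "\<And>s. s \<in> {0..t} \<Longrightarrow> \<phi> t x \<le> \<phi> s x" "r - f 0 x \<le> - (K * t powr \<alpha>)"
  shows "Lop \<alpha> 0 \<phi> f t (x :: real^'d) r \<le> - (K / Gamma (1 - \<alpha>))"
proof -
  have "Lop \<alpha> 0 \<phi> f t x r \<le> Lop \<alpha> 0 (\<lambda>_ _. 0) (\<lambda>_ _. 0) t x (- (K * t powr \<alpha>))"
    by (rule Lop_mono[OF assms(1,2,3) _ assms(4,5) test_fun_const const_admissible])
      (use assms in \<open>auto simp: incr_def\<close>)
  then show ?thesis unfolding Lop_const[OF assms(4)] using assms(4) by simp
qed

definition barrier :: "real \<Rightarrow> real \<Rightarrow> real^'d \<Rightarrow> real \<Rightarrow> real \<Rightarrow> real^'d \<Rightarrow> real" where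
  "barrier A C y K t x = A + (C * (norm (x - y))\<^sup>2 + K * t powr \<alpha>)"

lemma test_fun_barrier:
  "test_fun T (barrier A C y K) (\<lambda>t x. K * (\<alpha> * t powr (\<alpha> - 1))) (\<lambda>t x. (2 * C) *\<^sub>R (x - y))"
  using test_fun_add[OF test_fun_const test_fun_add[OF test_fun_space_square test_fun_power[OF \<alpha>0 \<alpha>1 T0]], of A C y K]
  unfolding barrier_def[abs_def] by simp

lemma barrier_zero: "barrier A C y K 0 x = A + C * (norm (x - y))\<^sup>2"
  by (simp add: barrier_def)

lemma barrier_uminus: "- barrier A C y K t x = barrier (- A) (- C) y (- K) t x"
  by (simp add: barrier_def)

lemma barrier_mono: "0 \<le> K \<Longrightarrow> 0 \<le> s \<Longrightarrow> s \<le> t \<Longrightarrow> barrier A C y K s x \<le> barrier A C y K t x"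
  using \<alpha>0 by (auto simp: barrier_def intro!: mult_left_mono powr_mono2)

end

text \<open>A point where \<open>U\<close> is not touched from below by a subsolution needs a certificate: a test
  function \<open>\<phi>\<close> below \<open>U\<close> on the time segment \<open>[a,t]\<close>, continued into the past by a function \<open>w\<close> below
  \<open>U\<close>, at which the inequality holds classically.\<close>

definition sub_witness :: "real \<Rightarrow> real \<Rightarrow> (real \<Rightarrow> real^'d \<Rightarrow> real \<Rightarrow> real^'d \<Rightarrow> real)
    \<Rightarrow> (real \<Rightarrow> real^'d \<Rightarrow> real) \<Rightarrow> real \<Rightarrow> real^'d \<Rightarrow> bool" where
  "sub_witness \<alpha> T H U t x \<longleftrightarrow>
      (\<exists>v M. visc_sub \<alpha> T H v \<and> bounded_cyl T v M \<and> (\<forall>s\<in>{0..T}. \<forall>y. v s y \<le> U s y) \<and> v t x = U t x) \<or>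
      (\<exists>a \<phi> \<phi>t D\<phi> w M. test_fun T \<phi> \<phi>t D\<phi> \<and> 0 \<le> a \<and> a < t \<and> slice_measurable T w \<and> bounded_cyl T w M \<and>
         (\<forall>s\<in>{a..t}. \<phi> s x \<le> U s x) \<and> (\<forall>s\<in>{0..a}. w s x \<le> U s x) \<and> \<phi> t x = U t x \<and>
         eventually (\<lambda>y. \<phi> t y \<le> U t y) (at x) \<and>
         Lop \<alpha> a \<phi> w t x (U t x) + H t x (U t x) (D\<phi> t x) \<le> 0)"

lemma sub_witness_sub:
  assumes "visc_sub \<alpha> T H v" "bounded_cyl T v M" "\<And>s y. s \<in> {0..T} \<Longrightarrow> v s y \<le> U s y" "v t x = U t x"
  shows "sub_witness \<alpha> T H U t x"
  unfolding sub_witness_def using assms by blast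

lemma sub_witness_test:
  assumes "test_fun T \<phi> \<phi>t D\<phi>" "0 \<le> a" "a < t" "slice_measurable T w" "bounded_cyl T w M"
    "\<And>s. s \<in> {a..t} \<Longrightarrow> \<phi> s x \<le> U s x" "\<And>s. s \<in> {0..a} \<Longrightarrow> w s x \<le> U s x" "\<phi> t x = U t x"
    "eventually (\<lambda>y. \<phi> t y \<le> U t y) (at x)" "Lop \<alpha> a \<phi> w t x (U t x) + H t x (U t x) (D\<phi> t x) \<le> 0"
  shows "sub_witness \<alpha> T H U t x"
  unfolding sub_witness_def using assms by blast

context hamilton_jacobi
begin

text \<open>A test function touching U from above also touches the subsolution of the first kind of
  certificate, and the larger past of U lowers the operator. For the second kind the gradients agree
  at the spatial contact point, and the increments of U compare the two operators.\<close>

lemma visc_sub_criterion: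
  assumes U: "usc_cyl T U" "bounded_cyl T U M"
    and cert: "\<And>t x. 0 < t \<Longrightarrow> t \<le> T \<Longrightarrow> sub_witness \<alpha> T H U t x"
  shows "visc_sub \<alpha> T H U"
proof (rule visc_subI[OF U])
  fix a b c \<rho> \<psi> \<psi>t D\<psi> t x
  assume a: "0 \<le> a" "a < t" and tb: "t \<le> b" "b \<le> T" and \<rho>: "\<rho> > (0::real)" and \<psi>: "test_fun T \<psi> \<psi>t D\<psi>"
    and x: "x \<in> ball c \<rho>"
    and max: "\<And>s y. s \<in> {a..b} \<Longrightarrow> y \<in> cball c \<rho> \<Longrightarrow> U s y - \<psi> s y \<le> U t x - \<psi> t x"
  have t: "0 < t" "t \<le> T" using a tb by auto
  have Um: "slice_measurable T U" using U T0 by (intro usc_on_imp_slice_measurable) auto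
  from cert[OF t, of x] show "Lop \<alpha> a \<psi> U t x (U t x) + H t x (U t x) (D\<psi> t x) \<le> 0"
    unfolding sub_witness_def
  proof (elim disjE exE conjE)
    fix v Mv assume v: "visc_sub \<alpha> T H v" "bounded_cyl T v Mv" "\<forall>s\<in>{0..T}. \<forall>y. v s y \<le> U s y" "v t x = U t x"
    have vm: "slice_measurable T v" using v(1) T0 by (intro usc_on_imp_slice_measurable) (auto dest: visc_sub_usc)
    have "Lop \<alpha> a \<psi> v t x (v t x) + H t x (v t x) (D\<psi> t x) \<le> 0"
    proof (rule visc_subD[OF v(1,2) a(1) _ tb(2) \<rho> \<psi> a(2) tb(1) x])
      fix s y assume "s \<in> {a..b}" "y \<in> cball c \<rho>"
      then show "v s y - \<psi> s y \<le> v t x - \<psi> t x"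
        using max[of s y] v(3)[rule_format, of s y] v(4) a tb by auto
    qed (use a tb in auto)
    moreover have "Lop \<alpha> a \<psi> U t x (U t x) \<le> Lop \<alpha> a \<psi> v t x (U t x)"
    proof (rule Lop_mono[OF \<psi> Um U(2) a t(2) \<psi> vm v(2) a])
      fix \<tau> :: real assume "0 < \<tau>"
      then show "incr a \<psi> U t x (U t x) \<tau> \<le> incr a \<psi> v t x (U t x) \<tau>"
        using v(3)[rule_format, of "max 0 (t - \<tau>)" x] t by (auto simp: incr_def)
    qed
    ultimately show ?thesis using v(4) by simp
  next
    fix a' \<phi> \<phi>t D\<phi> w M'
    assume \<phi>: "test_fun T \<phi> \<phi>t D\<phi>" and a': "0 \<le> a'" "a' < t" and w: "slice_measurable T w" "bounded_cyl T w M'"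
      and below: "\<forall>s\<in>{a'..t}. \<phi> s x \<le> U s x" "\<forall>s\<in>{0..a'}. w s x \<le> U s x" "\<phi> t x = U t x"
      and ev: "eventually (\<lambda>y. \<phi> t y \<le> U t y) (at x)"
      and le: "Lop \<alpha> a' \<phi> w t x (U t x) + H t x (U t x) (D\<phi> t x) \<le> 0"
    have "eventually (\<lambda>y. y \<in> ball c \<rho>) (at x)"
      using x by (intro eventually_at_in_open') auto
    with ev have "eventually (\<lambda>y. \<phi> t y - \<psi> t y \<le> \<phi> t x - \<psi> t x) (at x)"
    proof eventually_elim
      case (elim y)
      then show ?case using max[of t y] a tb below(3) by auto
    qed
    then have "D\<phi> t x = D\<psi> t x" using t by (intro test_fun_gradient_eq[OF \<phi> \<psi>]) auto
    moreover have "Lop \<alpha> a \<psi> U t x (U t x) \<le> Lop \<alpha> a' \<phi> w t x (U t x)"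
    proof (rule Lop_mono[OF \<psi> Um U(2) a t(2) \<phi> w a'])
      fix \<tau> :: real assume \<tau>: "0 < \<tau>"
      \<comment> \<open>The increment of U itself is the intermediate quantity: \<psi> touches U
        from above, while \<phi> and w lie below U.\<close>
      have "incr a \<psi> U t x (U t x) \<tau> \<le> U t x - U (max 0 (t - \<tau>)) x"
        using max[of "t - \<tau>" x] \<tau> tb a x by (auto simp: incr_def)
      also have "\<dots> \<le> incr a' \<phi> w t x (U t x) \<tau>"
        using below(1)[rule_format, of "t - \<tau>"] below(2)[rule_format, of "max 0 (t - \<tau>)"] below(3) \<tau> a' t
        by (auto simp: incr_def)
      finally show "incr a \<psi> U t x (U t x) \<tau> \<le> incr a' \<phi> w t x (U t x) \<tau>" .
    qed
    ultimately show ?thesis using le by simp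
  qed
qed

text \<open>Outside the ball of radius R the quadratic term alone exceeds the oscillation
  \<open>2 * M\<close>. Inside it the arguments of H, including the gradient of the quadratic, stay
  in a compact set, so a large K makes the operator dominate H.\<close>

lemma barrier_constants:
  assumes "0 < C"
  obtains R K0 where "0 < R" "2 * M < C * R\<^sup>2" "0 \<le> K0"
    "\<And>K t x r p. K0 \<le> K \<Longrightarrow> t \<in> {0..T} \<Longrightarrow> x \<in> cball y R \<Longrightarrow> \<bar>r\<bar> \<le> M \<Longrightarrow> norm p \<le> 2 * C * R \<Longrightarrow> \<bar>H t x r p\<bar> < K / Gamma (1 - \<alpha>)"
proof -
  \<comment> \<open>As \<open>R >= 1\<close>, the square gives
    \<open>C * R\<^sup>2 >= C * R = C + 2 * \<bar>M\<bar>\<close>.\<close>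
  define R where "R = 1 + 2 * \<bar>M\<bar> / C"
  have R: "R > 0" "R \<ge> 1" using assms by (auto simp: R_def add_pos_nonneg)
  have CR: "C * R\<^sup>2 > 2 * \<bar>M\<bar>"
  proof -
    have "C * R\<^sup>2 \<ge> C * R" using R assms by (simp add: power2_eq_square)
    moreover have "C * R = C + 2 * \<bar>M\<bar>" using assms by (simp add: R_def field_simps)
    ultimately show ?thesis using assms by simp
  qed
  obtain B where B: "\<And>t x r p. t \<in> {0..T} \<Longrightarrow> x \<in> cball y R \<Longrightarrow> \<bar>r\<bar> \<le> M \<Longrightarrow> norm p \<le> 2 * C * R \<Longrightarrow> \<bar>H t x r p\<bar> \<le> B"
    using H_bounded by metis
  define K0 where "K0 = max 0 (Gamma (1 - \<alpha>) * (B + 1))"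
  show thesis
  proof
    fix K t r and x p :: "real^'d" assume K: "K0 \<le> K" and *: "t \<in> {0..T}" "x \<in> cball y R" "\<bar>r\<bar> \<le> M" "norm p \<le> 2 * C * R"
    have "K / Gamma (1 - \<alpha>) \<ge> B + 1"
      using K Gamma_pos by (simp add: K0_def pos_le_divide_eq mult.commute)
    then show "\<bar>H t x r p\<bar> < K / Gamma (1 - \<alpha>)" using B[OF *] by linarith
  qed (use R CR in \<open>auto simp: K0_def\<close>)
qed

text \<open>A positive maximum of v minus the barrier would occur at a positive time inside the ball
  of radius R. Testing v with the barrier there makes the operator at least
  \<open>K / Gamma (1 - \<alpha>)\<close>, more than H can compensate. The threshold
  \<open>K0\<close> does not depend on v or A, so it serves a whole class of subsolutions.\<close>

lemma visc_sub_le_barrier: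
  assumes "0 < C"
  obtains K0 where "\<And>v A K t x. visc_sub \<alpha> T H v \<Longrightarrow> bounded_cyl T v M \<Longrightarrow> \<bar>A\<bar> \<le> M \<Longrightarrow> K0 \<le> K \<Longrightarrow>
      \<forall>x. v 0 x \<le> A + C * (norm (x - y))\<^sup>2 \<Longrightarrow> 0 \<le> t \<Longrightarrow> t \<le> T \<Longrightarrow> v t x \<le> barrier A C y K t x"
proof -
  obtain R K0 where R: "0 < R" and CR: "2 * M < C * R\<^sup>2" and K0: "0 \<le> K0"
    and B: "\<And>K t x r p. K0 \<le> K \<Longrightarrow> t \<in> {0..T} \<Longrightarrow> x \<in> cball y R \<Longrightarrow> \<bar>r\<bar> \<le> M \<Longrightarrow> norm p \<le> 2 * C * R \<Longrightarrow> \<bar>H t x r p\<bar> < K / Gamma (1 - \<alpha>)"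
    using barrier_constants[OF assms, of M y] by blast
  show thesis
  proof
    fix v A K t x
    assume v: "visc_sub \<alpha> T H v" "bounded_cyl T v M" and A: "\<bar>A\<bar> \<le> M" and K: "K0 \<le> K"
      and init': "\<forall>x. v 0 x \<le> A + C * (norm (x - y))\<^sup>2" and t: "0 \<le> t" "t \<le> T"
    have init: "v 0 x \<le> A + C * (norm (x - y))\<^sup>2" for x using init' by blast
    have K': "K \<ge> 0" using K K0 by simp
    let ?b = "barrier A C y K"
    note tb = test_fun_barrier[of A C y K]
    have outside: "v s z < ?b s z" if "0 \<le> s" "s \<le> T" "norm (z - y) \<ge> R" for s z
    proof -
      have "C * (norm (z - y))\<^sup>2 \<ge> C * R\<^sup>2" using that R assms by (intro mult_left_mono power_mono) auto
      moreover have "K * s powr \<alpha> \<ge> 0" using K' by simp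
      ultimately show ?thesis using CR A bounded_cylD[OF v(2), of s z] that by (auto simp: barrier_def)
    qed
    let ?S = "{0..T} \<times> cball y R"
    have "usc_on (cyl T) (\<lambda>z. v (fst z) (snd z) + (- ?b (fst z) (snd z)))"
      by (intro usc_on_add[OF visc_sub_usc[OF v(1)] continuous_on_imp_usc_on] continuous_on_minus test_fun_continuous[OF tb])
    then have us: "usc_on ?S (\<lambda>z. v (fst z) (snd z) + (- ?b (fst z) (snd z)))"
      by (rule usc_on_subset) (auto simp: cyl_def)
    have S: "compact ?S" "?S \<noteq> {}" using T0 R by (auto intro!: compact_Times)
    from usc_on_attains_sup[OF S us] obtain z where z: "z \<in> ?S" "\<And>z'. z' \<in> ?S \<Longrightarrow> v (fst z') (snd z') + (- ?b (fst z') (snd z')) \<le> v (fst z) (snd z) + (- ?b (fst z) (snd z))"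
      by metis
    obtain s w where sw: "z = (s, w)" by (cases z)
    have s: "0 \<le> s" "s \<le> T" using z(1) sw by auto
    have mx: "v s' w' - ?b s' w' \<le> v s w - ?b s w" if "s' \<in> {0..T}" "w' \<in> cball y R" for s' w'
      using z(2)[of "(s', w')"] that sw by simp
    have "v s w \<le> ?b s w"
    proof (rule ccontr)
      assume "\<not> v s w \<le> ?b s w"
      then have gt: "v s w > ?b s w" by simp
      then have "s \<noteq> 0" using init[of w] by (auto simp: barrier_zero)
      then have s0: "0 < s" using s by simp
      have wR: "norm (w - y) < R" using outside[OF s, of w] gt by linarith
      then have "w \<in> ball y R" by (simp add: dist_norm norm_minus_commute)
      from visc_subD[OF v order_refl T0 order_refl R tb s0 s(2) this mx]
      have "Lop \<alpha> 0 ?b v s w (v s w) + H s w (v s w) ((2 * C) *\<^sub>R (w - y)) \<le> 0" by simp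
      moreover have "K / Gamma (1 - \<alpha>) \<le> Lop \<alpha> 0 ?b v s w (v s w)"
      proof (rule Lop_ge_power[OF tb _ v(2) s0 s(2)])
        show "slice_measurable T v" using v(1) T0 by (intro usc_on_imp_slice_measurable) (auto dest: visc_sub_usc)
        show "?b s' w \<le> ?b s w" if "s' \<in> {0..s}" for s' using that K' by (intro barrier_mono) auto
        show "K * s powr \<alpha> \<le> v s w - v 0 w" using gt init[of w] by (simp add: barrier_def)
      qed
      moreover have "\<bar>H s w (v s w) ((2 * C) *\<^sub>R (w - y))\<bar> < K / Gamma (1 - \<alpha>)"
        using s wR assms bounded_cylD[OF v(2) s] by (intro B[OF K]) (auto simp: dist_norm norm_minus_commute)
      ultimately show False by linarith
    qed
    then have inside: "v s' w' \<le> ?b s' w'" if "s' \<in> {0..T}" "w' \<in> cball y R" for s' w'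
      using mx[OF that] by linarith
    show "v t x \<le> ?b t x"
      using inside[of t x] outside[OF t, of x] t by (cases "norm (x - y) \<ge> R") (auto simp: dist_norm norm_minus_commute)
  qed
qed

text \<open>Where v is the larger function it is its own certificate. Elsewhere the decreasing
  barrier certifies itself, because its operator is at most
  \<open>- K / Gamma (1 - \<alpha>)\<close>, below every value of \<open>- H\<close> in
  question.\<close>

lemma visc_sub_max_barrier:
  assumes "0 < C"
  obtains K0 where "\<And>v A K. visc_sub \<alpha> T H v \<Longrightarrow> bounded_cyl T v M \<Longrightarrow> \<bar>A\<bar> \<le> M \<Longrightarrow> K0 \<le> K \<Longrightarrow>
      visc_sub \<alpha> T H (\<lambda>t x. max (v t x) (barrier A (- C) y (- K) t x))"
proof -
  obtain R K0 where R: "0 < R" and CR: "2 * M < C * R\<^sup>2" and K0: "0 \<le> K0"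
    and B: "\<And>K t x r p. K0 \<le> K \<Longrightarrow> t \<in> {0..T} \<Longrightarrow> x \<in> cball y R \<Longrightarrow> \<bar>r\<bar> \<le> M \<Longrightarrow> norm p \<le> 2 * C * R \<Longrightarrow> \<bar>H t x r p\<bar> < K / Gamma (1 - \<alpha>)"
    using barrier_constants[OF assms, of M y] by blast
  show thesis
  proof
    fix v A K
    assume v: "visc_sub \<alpha> T H v" "bounded_cyl T v M" and A: "\<bar>A\<bar> \<le> M" and K: "K0 \<le> K"
    have K': "K \<ge> 0" using K K0 by simp
    let ?b = "barrier A (- C) y (- K)"
    let ?U = "\<lambda>t x. max (v t x) (?b t x)"
    note tb = test_fun_barrier[of A "- C" y "- K"]
    have b_le: "?b t x \<le> A" if "0 \<le> t" for t x
    proof -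
      have "C * (norm (x - y))\<^sup>2 \<ge> 0" "K * t powr \<alpha> \<ge> 0" using assms K' by auto
      then show ?thesis by (simp add: barrier_def)
    qed
    show "visc_sub \<alpha> T H ?U"
    proof (rule visc_sub_criterion)
      show "usc_on (cyl T) (\<lambda>z. ?U (fst z) (snd z))"
        by (intro usc_on_max[OF visc_sub_usc[OF v(1)] continuous_on_imp_usc_on] test_fun_continuous[OF tb])
      show "bounded_cyl T ?U M"
        unfolding bounded_cyl_def
      proof (intro ballI allI)
        fix t x assume "t \<in> {0..T}"
        then show "\<bar>?U t x\<bar> \<le> M" using bounded_cylD[OF v(2), of t x] b_le[of t x] A by (auto simp: max_def)
      qed
      fix t x assume t: "0 < t" "t \<le> T"
      show "sub_witness \<alpha> T H ?U t x"
      proof (cases "?b t x \<le> v t x")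
        case True
        then show ?thesis by (intro sub_witness_sub[OF v]) auto
      next
        case False
        then have gt: "?b t x > v t x" "?U t x = ?b t x" by auto
        have wR: "norm (x - y) < R"
        proof (rule ccontr)
          assume "\<not> ?thesis"
          then have "C * (norm (x - y))\<^sup>2 \<ge> C * R\<^sup>2" using R assms by (intro mult_left_mono power_mono) auto
          moreover have "K * t powr \<alpha> \<ge> 0" using K' by simp
          ultimately show False using CR A bounded_cylD[OF v(2), of t x] t gt by (auto simp: barrier_def)
        qed
        show ?thesis
        \<comment> \<open>With a = 0 the past consists of time 0 only, so the constant function with
          value \<open>?b 0 x\<close> serves as w.\<close>
        proof (rule sub_witness_test[OF tb order_refl t(1) const_admissible])
          have "Lop \<alpha> 0 ?b (\<lambda>_ _. ?b 0 x) t x (?b t x) \<le> - (K / Gamma (1 - \<alpha>))"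
          proof (rule Lop_le_power[OF tb const_admissible t])
            show "?b t x \<le> ?b s x" if "s \<in> {0..t}" for s
              using barrier_mono[of K s t "- A" C y x] K' that by (simp add: barrier_def)
          qed (simp add: barrier_def)
          moreover have "\<bar>H t x (?b t x) ((2 * - C) *\<^sub>R (x - y))\<bar> < K / Gamma (1 - \<alpha>)"
            using t wR assms bounded_cylD[OF v(2), of t x] b_le[of t x] A gt
            by (intro B[OF K]) (auto simp: dist_norm norm_minus_commute abs_mult)
          ultimately show "Lop \<alpha> 0 ?b (\<lambda>_ _. ?b 0 x) t x (?U t x) + H t x (?U t x) ((2 * - C) *\<^sub>R (x - y)) \<le> 0"
            unfolding gt(2) by linarith
        qed (use gt in auto)
      qed
    qed
  qed
qed

section \<open>Duality between sub- and supersolutions\<close>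

lemma hamilton_jacobi_dual: "hamilton_jacobi \<alpha> T (reflect H)"
proof (unfold_locales)
  have "continuous_on ({0..T} \<times> UNIV \<times> UNIV \<times> UNIV) (\<lambda>z. - (\<lambda>(t, x, r, p). H t x r p) ((\<lambda>(t, x, r, p). (t, x, - r, - p)) z))"
    by (intro continuous_on_minus continuous_on_compose2[OF H_cont]) (auto simp: case_prod_beta intro!: continuous_intros)
  then show "continuous_on ({0..T} \<times> UNIV \<times> UNIV \<times> UNIV) (\<lambda>(t, x, r, p). - H t x (- r) (- p))"
    by (simp add: case_prod_beta)
qed

text \<open>Boundedness makes the extended-real operator finite, so a sign can be moved through the
  sum of J and K by way of \<open>Lop\<close>.\<close>

lemma visc_super_iff_visc_sub_dual:
  assumes "bounded_cyl T u M"
  shows "visc_super \<alpha> T H u \<longleftrightarrow> visc_sub \<alpha> T (reflect H) (\<lambda>t x. - u t x)"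
proof -
  interpret dual: hamilton_jacobi \<alpha> T "reflect H" by (rule hamilton_jacobi_dual)
  show ?thesis
  proof
    assume sup: "visc_super \<alpha> T H u"
    then have lsc: "lsc_on (cyl T) (\<lambda>z. u (fst z) (snd z))" by (simp add: visc_super_def)
    have um: "slice_measurable T u" using lsc T0 by (intro lsc_on_imp_slice_measurable) auto
    show "visc_sub \<alpha> T (reflect H) (\<lambda>t x. - u t x)"
    proof (rule dual.visc_subI)
      show "usc_on (cyl T) (\<lambda>z. - u (fst z) (snd z))" using lsc by (simp add: lsc_on_iff_usc_on)
      show "bounded_cyl T (\<lambda>t x. - u t x) M" using assms by simp
      fix a b c \<rho> \<phi> \<phi>t D\<phi> t x
      assume *: "0 \<le> a" "a < t" "t \<le> b" "b \<le> T" "\<rho> > (0::real)" "test_fun T \<phi> \<phi>t D\<phi>" "x \<in> ball c \<rho>"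
        and max: "\<And>s y. s \<in> {a..b} \<Longrightarrow> y \<in> cball c \<rho> \<Longrightarrow> - u s y - \<phi> s y \<le> - u t x - \<phi> t x"
      note tm = test_fun_uminus[OF *(6)]
      have tT: "t \<le> T" using * by simp
      have max': "u s y - (- \<phi> s y) \<ge> u t x - (- \<phi> t x)" if "s \<in> {a..b}" "y \<in> cball c \<rho>" for s y
        using max[OF that] by simp
      have "0 \<le> a \<and> a < b \<and> b \<le> T \<and> \<rho> > 0 \<and> test_fun T (\<lambda>t x. - \<phi> t x) (\<lambda>t x. - \<phi>t t x) (\<lambda>t x. - D\<phi> t x) \<and>
        t \<in> {a<..b} \<and> x \<in> ball c \<rho> \<and>
        (\<forall>s\<in>{a..b}. \<forall>y\<in>cball c \<rho>. u s y - (\<lambda>t x. - \<phi> t x) s y \<ge> u t x - (\<lambda>t x. - \<phi> t x) t x)"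
        using * tm max' by auto
      from sup[unfolded visc_super_def, THEN conjunct2, rule_format, OF this]
      have "Jop \<alpha> (t - a) (\<lambda>t x. - \<phi> t x) t x + Kop \<alpha> (t - a) u t x + ereal (H t x (u t x) (- D\<phi> t x)) \<ge> 0" .
      then have "Lop \<alpha> a (\<lambda>t x. - \<phi> t x) u t x (u t x) + H t x (u t x) (- D\<phi> t x) \<ge> 0"
        unfolding Jop_Kop_eq[OF tm um assms *(1,2) tT] by simp
      moreover have "Lop \<alpha> a \<phi> (\<lambda>t x. - u t x) t x (- u t x) = - Lop \<alpha> a (\<lambda>t x. - \<phi> t x) u t x (u t x)"
        using Lop_uminus[OF tm um assms *(1,2) tT, of x "u t x"] by simp
      ultimately show "Lop \<alpha> a \<phi> (\<lambda>t x. - u t x) t x (- u t x) + - H t x (- (- u t x)) (- D\<phi> t x) \<le> 0" by simp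
    qed
  next
    assume sub: "visc_sub \<alpha> T (reflect H) (\<lambda>t x. - u t x)"
    then have lsc: "lsc_on (cyl T) (\<lambda>z. u (fst z) (snd z))" by (simp add: visc_sub_def lsc_on_iff_usc_on)
    have um: "slice_measurable T u" using lsc T0 by (intro lsc_on_imp_slice_measurable) auto
    show "visc_super \<alpha> T H u"
      unfolding visc_super_def
    proof (intro conjI allI impI lsc)
      fix a b c \<rho> \<phi> \<phi>t D\<phi> t x
      assume *: "0 \<le> a \<and> a < b \<and> b \<le> T \<and> 0 < \<rho> \<and> test_fun T \<phi> \<phi>t D\<phi> \<and> t \<in> {a<..b} \<and> x \<in> ball c \<rho> \<and>
       (\<forall>s\<in>{a..b}. \<forall>y\<in>cball c \<rho>. u s y - \<phi> s y \<ge> u t x - \<phi> t x)"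
      then have \<phi>: "test_fun T \<phi> \<phi>t D\<phi>" and a: "0 \<le> a" "a < t" and tb: "t \<le> b" "b \<le> T" and \<rho>: "0 < \<rho>"
        and x: "x \<in> ball c \<rho>" and ab: "a < b" by auto
      have tT: "t \<le> T" using tb by simp
      have max: "- u s y - - \<phi> s y \<le> - u t x - - \<phi> t x" if "s \<in> {a..b}" "y \<in> cball c \<rho>" for s y
      proof -
        have "u s y - \<phi> s y \<ge> u t x - \<phi> t x" using * that by blast
        then show ?thesis by simp
      qed
      have "Lop \<alpha> a (\<lambda>t x. - \<phi> t x) (\<lambda>t x. - u t x) t x (- u t x) + - H t x (- (- u t x)) (- (- D\<phi> t x)) \<le> 0"
        by (rule dual.visc_subD[OF sub _ a(1) ab tb(2) \<rho> test_fun_uminus[OF \<phi>] a(2) tb(1) x max, of M])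
          (use assms in auto)
      then have "Lop \<alpha> a \<phi> u t x (u t x) + H t x (u t x) (D\<phi> t x) \<ge> 0"
        using Lop_uminus[OF \<phi> um assms a tT, of x "u t x"] by simp
      then show "Jop \<alpha> (t - a) \<phi> t x + Kop \<alpha> (t - a) u t x + ereal (H t x (u t x) (D\<phi> t x)) \<ge> 0"
        unfolding Jop_Kop_eq[OF \<phi> um assms a tT] by simp
    qed
  qed
qed

end

subsection \<open>Insertion and envelopes\<close>

text \<open>These are the sup-convolutions with the cone \<open>n * dist x y\<close>. They are
  n-Lipschitz, decrease in n, and tend to f because f is bounded and upper semicontinuous. The
  formula commutes with translations, which preserves periodicity.\<close>

lemma sup_convolution_approx:
  fixes f :: "'a::real_normed_vector \<Rightarrow> real"
  assumes usc: "usc_on UNIV f" and bd: "\<And>x. \<bar>f x\<bar> \<le> M"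
  obtains F :: "nat \<Rightarrow> 'a \<Rightarrow> real" where
    "\<And>n. continuous_on UNIV (F n)" "\<And>n x. f x \<le> F n x" "\<And>n x. F (Suc n) x \<le> F n x"
    "\<And>n x. F n x \<le> M" "\<And>x e. 0 < e \<Longrightarrow> \<exists>n. F n x < f x + e"
    "\<And>n k. \<forall>x. f (x + k) = f x \<Longrightarrow> \<forall>x. F n (x + k) = F n x"
proof
  define F where "F = (\<lambda>(n::nat) x. SUP y. f y - real n * dist x y)"
  have le_M: "f y - real n * dist x y \<le> M" for n x y
    using bd[of y] by (smt (verit) mult_nonneg_nonneg of_nat_0_le_iff zero_le_dist)
  then have bdd: "bdd_above (range (\<lambda>y. f y - real n * dist x y))" for n x
    by (auto intro!: bdd_aboveI[of _ M])
  have F_ge: "f y - real n * dist x y \<le> F n x" for n x y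
    unfolding F_def by (intro cSUP_upper bdd UNIV_I)
  show "f x \<le> F n x" for n x using F_ge[of x n x] by simp
  show "F n x \<le> M" for n x unfolding F_def by (intro cSUP_least le_M) auto
  show "F (Suc n) x \<le> F n x" for n x
  proof (subst F_def, rule cSUP_least)
    fix y
    have "f y - real (Suc n) * dist x y \<le> f y - real n * dist x y" by (simp add: mult_right_mono)
    also have "\<dots> \<le> F n x" by (rule F_ge)
    finally show "f y - real (Suc n) * dist x y \<le> F n x" .
  qed auto
  have lip: "F n x \<le> F n x' + real n * dist x x'" for n x x'
  proof (subst F_def, rule cSUP_least)
    fix y
    have "real n * dist x' y \<le> real n * (dist x x' + dist x y)"
      using dist_triangle3[of x' y x] by (intro mult_left_mono) (auto simp: dist_commute)
    then show "f y - real n * dist x y \<le> F n x' + real n * dist x x'"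
      using F_ge[of y n x'] by (simp add: algebra_simps)
  qed auto
  show "continuous_on UNIV (F n)" for n
    unfolding continuous_on_iff
  proof (intro ballI allI impI)
    fix x and e :: real assume e: "0 < e"
    show "\<exists>d>0. \<forall>x'\<in>UNIV. dist x' x < d \<longrightarrow> dist (F n x') (F n x) < e"
    proof (intro exI[of _ "e / (real n + 1)"] conjI ballI impI)
      fix x' assume "dist x' x < e / (real n + 1)"
      then have "(real n + 1) * dist x' x < e" by (simp add: pos_less_divide_eq mult.commute)
      moreover have "real n * dist x' x \<le> (real n + 1) * dist x' x" by (intro mult_right_mono) auto
      ultimately show "dist (F n x') (F n x) < e"
        using lip[of n x x'] lip[of n x' x] by (simp add: dist_real_def dist_commute abs_less_iff)
    qed (use e in simp)
  qed
  show "\<exists>n. F n x < f x + e" if "0 < e" for x e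
  proof -
    have "\<exists>d>0. \<forall>y. dist y x < d \<longrightarrow> f y < f x + e/2"
      using usc that unfolding usc_on_def by simp
    then obtain d where d: "d > 0" "\<And>y. dist y x < d \<Longrightarrow> f y < f x + e/2" by blast
    \<comment> \<open>With this slope the cone costs at least \<open>2 * M\<close> at distance d, so
      distant points y contribute no more than \<open>f x\<close>.\<close>
    obtain n where n: "real n > 2 * M / d" using reals_Archimedean2 by blast
    have "F n x \<le> f x + e/2"
    proof (subst F_def, rule cSUP_least)
      fix y
      show "f y - real n * dist x y \<le> f x + e/2"
      proof (cases "dist y x < d")
        case True
        have "real n * dist x y \<ge> 0" by simp
        then show ?thesis using d(2)[OF True] by linarith
      next
        case False
        have "2 * M \<le> real n * d" using n d(1) by (simp add: pos_divide_less_eq)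
        also have "\<dots> \<le> real n * dist x y" using False by (intro mult_left_mono) (auto simp: dist_commute)
        finally show ?thesis using bd[of x] bd[of y] that by linarith
      qed
    qed auto
    then show ?thesis using that by (intro exI[of _ n]) simp
  qed
  show "\<forall>x. F n (x + k) = F n x" if "\<forall>x. f (x + k) = f x" for n k
  proof
    fix x
    have "range (\<lambda>y. y + k) = UNIV" by (rule surjI[of _ "\<lambda>y. y - k"]) simp
    then have "F n (x + k) = (SUP y\<in>range (\<lambda>y. y + k). f y - real n * dist (x + k) y)" by (simp only: F_def)
    also have "\<dots> = (SUP y. f (y + k) - real n * dist (x + k) (y + k))" by (simp only: image_image)
    also have "\<dots> = F n x" by (simp add: that F_def)
    finally show "F n (x + k) = F n x" .
  qed
qed

text \<open>Katetov--Tong insertion.  With continuous \<open>F\<^sub>n\<close> decreasing to \<open>f\<close> and continuous \<open>G\<^sub>n\<close> increasing to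
  \<open>h\<close>, the function \<open>sup\<^sub>n min (G\<^sub>n) (F\<^sub>n)\<close> is also the infimum of \<open>F\<^sub>0\<close> and the functions \<open>max (G\<^sub>n) (F\<^sub>n\<^sub>+\<^sub>1)\<close>,
  since at each point the two sequences cross at most once.\<close>

lemma continuous_insertion:
  fixes f h :: "'a::real_normed_vector \<Rightarrow> real"
  assumes f: "usc_on UNIV f" "\<And>x. \<bar>f x\<bar> \<le> M" and h: "lsc_on UNIV h" "\<And>x. \<bar>h x\<bar> \<le> M"
    and fh: "\<And>x. f x \<le> h x"
  obtains g where "continuous_on UNIV g" "\<And>x. f x \<le> g x" "\<And>x. g x \<le> h x"
    "\<And>k x. \<forall>x. f (x + k) = f x \<Longrightarrow> \<forall>x. h (x + k) = h x \<Longrightarrow> g (x + k) = g x"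
proof -
  obtain F :: "nat \<Rightarrow> 'a \<Rightarrow> real" where F: "\<And>n. continuous_on UNIV (F n)" "\<And>n x. f x \<le> F n x" "\<And>n x. F (Suc n) x \<le> F n x"
    "\<And>n x. F n x \<le> M" "\<And>x e. 0 < e \<Longrightarrow> \<exists>n. F n x < f x + e"
    "\<And>n k. \<forall>x. f (x + k) = f x \<Longrightarrow> \<forall>x. F n (x + k) = F n x"
    using sup_convolution_approx[OF f] by blast
  have h': "usc_on UNIV (\<lambda>x. - h x)" "\<And>x. \<bar>- h x\<bar> \<le> M" using h by (auto simp: lsc_on_iff_usc_on)
  obtain G' :: "nat \<Rightarrow> 'a \<Rightarrow> real" where G': "\<And>n. continuous_on UNIV (G' n)" "\<And>n x. - h x \<le> G' n x" "\<And>n x. G' (Suc n) x \<le> G' n x"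
    "\<And>n x. G' n x \<le> M" "\<And>x e. 0 < e \<Longrightarrow> \<exists>n. G' n x < - h x + e"
    "\<And>n k. \<forall>x. - h (x + k) = - h x \<Longrightarrow> \<forall>x. G' n (x + k) = G' n x"
    using sup_convolution_approx[OF h'] by blast
  define G where "G = (\<lambda>n x. - G' n x)"
  have G: "\<And>n. continuous_on UNIV (G n)" "\<And>n x. G n x \<le> h x" "\<And>n x. G n x \<le> G (Suc n) x"
    "\<And>x e. 0 < e \<Longrightarrow> \<exists>n. G n x > h x - e"
    using G'(1-3) by (auto simp: G_def intro: continuous_on_minus minus_le_iff[THEN iffD1])
      (metis G'(5) add.commute diff_conv_add_uminus minus_diff_eq neg_less_iff_less)
  have Fanti: "F m x \<le> F n x" if "n \<le> m" for m n x
    using that by (induction rule: dec_induct) (auto intro: order_trans F(3))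
  have Gmono: "G n x \<le> G m x" if "n \<le> m" for m n x
    using that by (induction rule: dec_induct) (auto intro: order_trans G(3))
  define g where "g = (\<lambda>x. SUP n. min (G n x) (F n x))"
  have bdd: "bdd_above (range (\<lambda>n. min (G n x) (F n x)))" for x
    using F(4) by (auto intro!: bdd_aboveI[of _ M] simp: min_le_iff_disj)
  have g_ge: "min (G n x) (F n x) \<le> g x" for n x
    unfolding g_def by (intro cSUP_upper bdd UNIV_I)
  have g_le1: "g x \<le> max (G n x) (F (Suc n) x)" for n x
    unfolding g_def
  proof (rule cSUP_least)
    fix m show "min (G m x) (F m x) \<le> max (G n x) (F (Suc n) x)"
      using Gmono[of m n x] Fanti[of "Suc n" m x] by (cases "m \<le> n") auto
  qed auto
  have g_le0: "g x \<le> F 0 x" for x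
    unfolding g_def using Fanti[of 0 _ x] by (intro cSUP_least) (auto simp: min_le_iff_disj)
  have g_le_h: "g x \<le> h x" for x
    unfolding g_def using G(2) by (intro cSUP_least) (auto simp: min_le_iff_disj)
  \<comment> \<open>As a supremum of continuous functions g is lower semicontinuous. The second
    clause supplies upper semicontinuity through a continuous majorant that is almost tight at
    x.\<close>
  have dichotomy: "f x \<le> g x \<and> (\<forall>e>0. \<exists>E. continuous_on UNIV E \<and> (\<forall>y. g y \<le> E y) \<and> E x < g x + e)" for x
  proof (cases "\<exists>n. F n x \<le> G n x")
    case True
    \<comment> \<open>At the first crossing \<open>F N x <= g x\<close>, and one index earlier
      \<open>G n x <= g x\<close>; hence the majorant built from these two functions is tight at
      x.\<close>
    define N where "N = (LEAST n. F n x \<le> G n x)"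
    have N: "F N x \<le> G N x" unfolding N_def using True by (rule LeastI_ex)
    then have gN: "F N x \<le> g x" using g_ge[of N x] by simp
    have "\<exists>E. continuous_on UNIV E \<and> (\<forall>y. g y \<le> E y) \<and> E x \<le> g x"
    proof (cases N)
      case 0
      then show ?thesis using g_le0 F(1) gN by (intro exI[of _ "F 0"]) auto
    next
      case (Suc n)
      then have "\<not> F n x \<le> G n x" unfolding N_def by (metis N_def lessI not_less_Least)
      then have "G n x \<le> g x" using g_ge[of n x] by simp
      then show ?thesis using g_le1 F(1) G(1) gN Suc
        by (intro exI[of _ "\<lambda>y. max (G n y) (F (Suc n) y)"]) (auto intro: continuous_on_max)
    qed
    moreover have "f x \<le> g x" using gN F(2)[of x N] by linarith
    ultimately show ?thesis by (meson less_add_same_cancel1 order_le_less_trans)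
  next
    case False
    then have lt: "G n x < F n x" for n by (meson not_le)
    have gG: "G n x \<le> g x" for n using g_ge[of n x] lt[of n] by simp
    have "h x \<le> g x"
    proof (rule field_le_epsilon)
      fix e :: real assume "0 < e"
      then obtain n where "G n x > h x - e" using G(4) by blast
      then show "h x \<le> g x + e" using gG[of n] by linarith
    qed
    then have fg: "f x \<le> g x" using fh[of x] by linarith
    have "\<exists>E. continuous_on UNIV E \<and> (\<forall>y. g y \<le> E y) \<and> E x < g x + e" if e: "0 < e" for e
    proof -
      obtain n where n: "F n x < f x + e" using F(5)[OF e, of x] by blast
      have "max (G n x) (F (Suc n) x) < g x + e"
        using n F(3)[of n x] gG[of n] fg e by auto
      then show ?thesis using g_le1 F(1) G(1)
        by (intro exI[of _ "\<lambda>y. max (G n y) (F (Suc n) y)"]) (auto intro: continuous_on_max)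
    qed
    with fg show ?thesis by blast
  qed
  have cont: "continuous_on UNIV g"
    unfolding continuous_on_def
  proof
    fix x :: 'a
    have "(g \<longlongrightarrow> g x) (at x)"
    proof (rule order_tendstoI)
      fix c assume "g x < c"
      then have "0 < c - g x" by simp
      then have "\<exists>E. continuous_on UNIV E \<and> (\<forall>y. g y \<le> E y) \<and> E x < g x + (c - g x)"
        using dichotomy[of x] by blast
      then obtain E where E: "continuous_on UNIV E" "\<forall>y. g y \<le> E y" "E x < c" by auto
      have "(E \<longlongrightarrow> E x) (at x)" using E(1) by (simp add: continuous_on_def)
      then have "eventually (\<lambda>y. E y < c) (at x)" using E(3) by (rule order_tendstoD)
      then show "eventually (\<lambda>y. g y < c) (at x)"
        by eventually_elim (use E(2) in \<open>auto intro: le_less_trans\<close>)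
    next
      fix c assume "c < g x"
      then obtain n where n: "c < min (G n x) (F n x)"
        unfolding g_def using less_cSUP_iff[OF _ bdd] by (metis UNIV_not_empty)
      have "continuous_on UNIV (\<lambda>y. min (G n y) (F n y))" by (intro continuous_on_min F(1) G(1))
      then have "((\<lambda>y. min (G n y) (F n y)) \<longlongrightarrow> min (G n x) (F n x)) (at x)" by (simp add: continuous_on_def)
      then have "eventually (\<lambda>y. c < min (G n y) (F n y)) (at x)" using n by (rule order_tendstoD)
      then show "eventually (\<lambda>y. c < g y) (at x)"
        by eventually_elim (rule less_le_trans[OF _ g_ge])
    qed
    then show "(g \<longlongrightarrow> g x) (at x within UNIV)" .
  qed
  have per: "g (x + k) = g x" if "\<forall>x. f (x + k) = f x" "\<forall>x. h (x + k) = h x" for k x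
    using F(6)[OF that(1)] G'(6)[of k] that(2) by (simp add: g_def G_def)
  show thesis
  proof (rule that[of g])
    show "f x \<le> g x" for x using dichotomy by blast
  qed (fact cont g_le_h per)+
qed

lemma integer_translate_to_cell: "\<exists>k. (\<forall>i. k $ i \<in> \<int>) \<and> x + k \<in> cbox 0 (\<chi> i. 1)" for x :: "real^'d"
proof (intro exI conjI allI)
  show "(\<chi> i. - of_int \<lfloor>x $ i\<rfloor>) $ i \<in> \<int>" for i by simp
  show "x + (\<chi> i. - of_int \<lfloor>x $ i\<rfloor>) \<in> cbox 0 (\<chi> i. 1)"
    unfolding mem_box_cart by (auto simp: algebra_simps) linarith
qed

section \<open>Real-valued upper envelopes of bounded functions\<close>

definition uenv :: "real \<Rightarrow> (real \<Rightarrow> real^'d \<Rightarrow> real) \<Rightarrow> real \<Rightarrow> real^'d \<Rightarrow> real" where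
  "uenv T u t x = real_of_ereal (usc_env T u t x)"

text \<open>At t = 0 the centre is outside \<open>QT\<close>, and a supremum over an empty set would
  be minus infinity. Moving forward in time, capped at T, gives a point.\<close>

lemma QT_cball_nonempty:
  assumes "0 < T" "0 \<le> t" "t \<le> T" "0 < d"
  shows "\<exists>z. z \<in> QT T \<inter> cball (t, x) d"
proof (intro exI[of _ "(min T (t + d), x)"])
  show "(min T (t + d), x) \<in> QT T \<inter> cball (t, x) d"
    using assms by (auto simp: dist_Pair_Pair dist_real_def min_def)
qed

lemma uenv_ereal:
  assumes "bounded_cyl T u M" "0 < T" "0 \<le> t" "t \<le> T"
  shows "usc_env T u t x = ereal (uenv T u t x)" "\<bar>uenv T u t x\<bar> \<le> M"
proof -
  let ?S = "\<lambda>d. SUP z\<in>QT T \<inter> cball (t, x) d. ereal (u (fst z) (snd z))"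
  have bd: "ereal (u (fst z) (snd z)) \<le> ereal M" "ereal (- M) \<le> ereal (u (fst z) (snd z))" if "z \<in> QT T" for z
    using bounded_cylD[OF assms(1), of "fst z" "snd z"] that by (auto simp: QT_def abs_le_iff)
  have le: "?S d \<le> ereal M" for d by (intro SUP_least bd) auto
  have ge: "ereal (- M) \<le> ?S d" if "0 < d" for d
  proof -
    obtain z where z: "z \<in> QT T \<inter> cball (t, x) d" using QT_cball_nonempty[OF assms(2-4) \<open>0 < d\<close>] by blast
    then show ?thesis using bd(2)[of z] by (intro SUP_upper2[of z]) auto
  qed
  have 1: "usc_env T u t x \<le> ereal M"
    unfolding usc_env_def by (rule INF_lower2[of 1]) (use le in auto)
  have 2: "ereal (- M) \<le> usc_env T u t x"
    unfolding usc_env_def by (rule INF_greatest) (use ge in auto)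
  from 1 2 show *: "usc_env T u t x = ereal (uenv T u t x)"
    unfolding uenv_def by (cases "usc_env T u t x") auto
  show "\<bar>uenv T u t x\<bar> \<le> M" using 1 2 unfolding * by (simp add: abs_le_iff)
qed

lemma uenv_upper:
  assumes "bounded_cyl T u M" "0 < T" "0 \<le> t" "t \<le> T" "0 < e"
  obtains d where "d > 0" "\<And>s y. 0 < s \<Longrightarrow> s \<le> T \<Longrightarrow> dist (s, y) (t, x) \<le> d \<Longrightarrow> u s y < uenv T u t x + e"
proof -
  have "usc_env T u t x < ereal (uenv T u t x + e)"
    using uenv_ereal(1)[OF assms(1-4)] assms(5) by simp
  then obtain d where d: "d > 0" "(SUP z\<in>QT T \<inter> cball (t, x) d. ereal (u (fst z) (snd z))) < ereal (uenv T u t x + e)"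
    unfolding usc_env_def INF_less_iff by auto
  show thesis
  proof
    fix s y assume "0 < s" "s \<le> T" "dist (s, y) (t, x) \<le> d"
    then have "(s, y) \<in> QT T \<inter> cball (t, x) d" by (simp add: dist_commute)
    then have "ereal (u s y) \<le> (SUP z\<in>QT T \<inter> cball (t, x) d. ereal (u (fst z) (snd z)))"
      by (rule SUP_upper2) simp
    then have "ereal (u s y) < ereal (uenv T u t x + e)" using d(2) by (rule le_less_trans)
    then show "u s y < uenv T u t x + e" by simp
  qed (rule d)
qed

lemma uenv_lower:
  assumes "bounded_cyl T u M" "0 < T" "0 \<le> t" "t \<le> T" "0 < e" "0 < d"
  obtains s y where "0 < s" "s \<le> T" "dist (s, y) (t, x) < d" "u s y > uenv T u t x - e"
proof -
  have "ereal (uenv T u t x - e) < usc_env T u t x"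
    using uenv_ereal(1)[OF assms(1-4)] assms(5) by simp
  also have "\<dots> \<le> (SUP z\<in>QT T \<inter> cball (t, x) (d/2). ereal (u (fst z) (snd z)))"
    unfolding usc_env_def by (rule INF_lower) (use assms in auto)
  finally obtain z where z: "z \<in> QT T \<inter> cball (t, x) (d/2)" "ereal (uenv T u t x - e) < ereal (u (fst z) (snd z))"
    unfolding less_SUP_iff by auto
  show thesis
    using that[of "fst z" "snd z"] z assms(6) by (auto simp: QT_def dist_commute)
qed

lemma uenv_le:
  assumes "bounded_cyl T u M" "0 < T" "0 \<le> t" "t \<le> T" "0 < d"
    and "\<And>s y. 0 < s \<Longrightarrow> s \<le> T \<Longrightarrow> dist (s, y) (t, x) < d \<Longrightarrow> u s y \<le> c"
  shows "uenv T u t x \<le> c"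
proof (rule field_le_epsilon)
  fix e :: real assume "0 < e"
  from uenv_lower[OF assms(1-4) this assms(5), of x] obtain s y where
    "0 < s" "s \<le> T" "dist (s, y) (t, x) < d" "u s y > uenv T u t x - e" .
  then show "uenv T u t x \<le> c + e" using assms(6)[of s y] by linarith
qed

lemma uenv_ge:
  assumes "bounded_cyl T u M" "0 < T" "0 \<le> t" "t \<le> T"
    and "\<And>e. 0 < e \<Longrightarrow> \<exists>s y. 0 < s \<and> s \<le> T \<and> dist (s, y) (t, x) < e \<and> u s y > c - e"
  shows "uenv T u t x \<ge> c"
proof (rule field_le_epsilon)
  fix e :: real assume "0 < e"
  then have "0 < e/2" by simp
  from uenv_upper[OF assms(1-4) this, of x] obtain d where d: "d > 0"
    "\<And>s y. 0 < s \<Longrightarrow> s \<le> T \<Longrightarrow> dist (s, y) (t, x) \<le> d \<Longrightarrow> u s y < uenv T u t x + e/2" by blast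
  have "min d (e/2) > 0" using d \<open>0 < e\<close> by simp
  from assms(5)[OF this] obtain s y where "0 < s" "s \<le> T" "dist (s, y) (t, x) < min d (e/2)" "u s y > c - min d (e/2)"
    by blast
  then show "c \<le> uenv T u t x + e" using d(2)[of s y] by auto
qed

text \<open>Restricted to positive times, since the envelope at time 0 does not see the values
  \<open>u 0\<close>.\<close>

lemma le_uenv:
  assumes "bounded_cyl T u M" "0 < t" "t \<le> T"
  shows "u t x \<le> uenv T u t x"
  by (rule uenv_ge[OF assms(1)]) (use assms in \<open>auto intro!: exI[of _ t] exI[of _ x]\<close>)

lemma uenv_eq_limit:
  assumes u: "bounded_cyl T u M" and T: "0 < T" and t: "0 \<le> t" "t \<le> T"
    and lim: "\<And>e. 0 < e \<Longrightarrow> \<exists>d>0. \<forall>s x. 0 < s \<and> s \<le> T \<and> dist (s, x) (t, y) < d \<longrightarrow> \<bar>u s x - c\<bar> < e"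
  shows "uenv T u t y = c"
proof (rule antisym)
  show "uenv T u t y \<le> c"
  proof (rule field_le_epsilon)
    fix e :: real assume "0 < e"
    from lim[OF this] obtain d where d: "d > 0"
      "\<And>s x. 0 < s \<Longrightarrow> s \<le> T \<Longrightarrow> dist (s, x) (t, y) < d \<Longrightarrow> \<bar>u s x - c\<bar> < e" by blast
    show "uenv T u t y \<le> c + e"
    proof (rule uenv_le[OF u T t d(1)])
      show "u s x \<le> c + e" if "0 < s" "s \<le> T" "dist (s, x) (t, y) < d" for s x
        using d(2)[of s x] that by linarith
    qed
  qed
  show "c \<le> uenv T u t y"
  proof (rule uenv_ge[OF u T t])
    fix e :: real assume "0 < e"
    from lim[OF this] obtain d where d: "d > 0"
      "\<And>s x. 0 < s \<Longrightarrow> s \<le> T \<Longrightarrow> dist (s, x) (t, y) < d \<Longrightarrow> \<bar>u s x - c\<bar> < e" by blast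
    have "0 < min d e / 2" using d(1) \<open>0 < e\<close> by simp
    from QT_cball_nonempty[OF T t this, of y] obtain s x where s:
      "0 < s" "s \<le> T" "dist (s, x) (t, y) \<le> min d e / 2" by (auto simp: dist_commute)
    then have near: "dist (s, x) (t, y) < d" "dist (s, x) (t, y) < e" using d(1) \<open>0 < e\<close> by linarith+
    have "\<bar>u s x - c\<bar> < e" by (rule d(2)[OF s(1,2) near(1)])
    then have "c - e < u s x" by linarith
    then show "\<exists>s x. 0 < s \<and> s \<le> T \<and> dist (s, x) (t, y) < e \<and> c - e < u s x"
      using s(1,2) near(2) by blast
  qed
qed

lemma bounded_cyl_uenv:
  assumes "bounded_cyl T u M" "0 < T"
  shows "bounded_cyl T (uenv T u) M"
  unfolding bounded_cyl_def using uenv_ereal(2)[OF assms] by simp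

lemma usc_on_uenv:
  fixes u :: "real \<Rightarrow> real^'d \<Rightarrow> real"
  assumes "bounded_cyl T u M" "0 < T"
  shows "usc_on (cyl T) (\<lambda>z. uenv T u (fst z) (snd z))"
  unfolding usc_on_def
proof (intro ballI allI impI)
  fix z :: "real \<times> (real^'d)" and e :: real assume "z \<in> cyl T" "0 < e"
  then obtain t x where z: "z = (t, x)" "0 \<le> t" "t \<le> T" by (cases z) auto
  have "0 < e/2" using \<open>0 < e\<close> by simp
  from uenv_upper[OF assms z(2,3) this, of x] obtain d where d: "d > 0"
    "\<And>s y. 0 < s \<Longrightarrow> s \<le> T \<Longrightarrow> dist (s, y) (t, x) \<le> d \<Longrightarrow> u s y < uenv T u t x + e/2" by blast
  show "\<exists>d>0. \<forall>z'\<in>cyl T. dist z' z < d \<longrightarrow> uenv T u (fst z') (snd z') < uenv T u (fst z) (snd z) + e"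
  proof (intro exI[of _ "d/2"] conjI ballI impI)
    fix z' :: "real \<times> (real^'d)" assume "z' \<in> cyl T" and dz: "dist z' z < d/2"
    then obtain t' x' where z': "z' = (t', x')" "0 \<le> t'" "t' \<le> T" by (cases z') auto
    have "uenv T u t' x' \<le> uenv T u t x + e/2"
    proof (rule uenv_le[OF assms z'(2,3)])
      fix s y assume s: "0 < s" "s \<le> T" "dist (s, y) (t', x') < d/2"
      then have "dist (s, y) (t, x) \<le> d"
        using dist_triangle[of "(s, y)" "(t, x)" "(t', x')"] dz by (simp add: z z')
      then show "u s y \<le> uenv T u t x + e/2" using d(2)[OF s(1,2)] by (simp add: less_imp_le)
    qed (use d in simp)
    then show "uenv T u (fst z') (snd z') < uenv T u (fst z) (snd z) + e" using \<open>0 < e\<close> by (simp add: z z')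
  qed (use d in simp)
qed

text \<open>The upper bound is a maximum over one period cell. The envelope hypothesis bounds u
  below locally at positive times, and upper semicontinuity at time 0 carries this to the initial
  values up to a loss of 1; compactness makes the lower bound global.\<close>

lemma periodic_usc_bounded:
  fixes u :: "real \<Rightarrow> real^'d \<Rightarrow> real"
  assumes per: "periodic_x T u" and usc: "usc_cyl T u" and T: "0 < T"
    and env: "\<And>t x. 0 \<le> t \<Longrightarrow> t \<le> T \<Longrightarrow> lsc_env T u t x > -\<infinity>"
  shows "\<exists>M. bounded_cyl T u M"
proof -
  let ?K = "{0..T} \<times> cbox (0::real^'d) (\<chi> i. 1)"
  have K: "compact ?K" "?K \<noteq> {}" "?K \<subseteq> cyl T"
  proof -
    have "(0, 0) \<in> ?K" using T by (simp add: mem_box_cart)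
    then show "?K \<noteq> {}" by blast
  qed (auto intro!: compact_Times simp: cyl_def)
  from usc_on_attains_sup[OF K(1,2) usc_on_subset[OF usc K(3)]] obtain z0 where
    z0: "\<And>z. z \<in> ?K \<Longrightarrow> u (fst z) (snd z) \<le> u (fst z0) (snd z0)" by metis
  have below: "\<exists>d>0. \<exists>B. \<forall>s y. 0 \<le> s \<and> s \<le> T \<and> dist (s, y) (t, x) < d \<longrightarrow> u s y \<ge> B"
    if t: "0 \<le> t" "t \<le> T" for t and x :: "real^'d"
  proof -
    have "usc_env T (\<lambda>s y. - u s y) t x < \<infinity>"
      using env[OF t, of x] unfolding lsc_env_def by (metis ereal_uminus_eq_iff ereal_uminus_uminus ereal_infty_less(1) less_irrefl uminus_ereal.simps(2))
    then obtain d where d: "d > 0" "(SUP z\<in>QT T \<inter> cball (t, x) d. ereal (- u (fst z) (snd z))) < \<infinity>"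
      unfolding usc_env_def INF_less_iff by auto
    then obtain B where B: "(SUP z\<in>QT T \<inter> cball (t, x) d. ereal (- u (fst z) (snd z))) \<le> ereal B"
      by (cases "SUP z\<in>QT T \<inter> cball (t, x) d. ereal (- u (fst z) (snd z))") auto
    have pos: "u s y \<ge> - B" if "0 < s" "s \<le> T" "dist (s, y) (t, x) < d" for s y
    proof -
      have "ereal (- u s y) \<le> (SUP z\<in>QT T \<inter> cball (t, x) d. ereal (- u (fst z) (snd z)))"
        using that by (intro SUP_upper2[of "(s, y)"]) (auto simp: dist_commute)
      also have "\<dots> \<le> ereal B" by (rule B)
      finally show ?thesis by simp
    qed
    have "u s y \<ge> - B - 1" if s: "0 \<le> s" "s \<le> T" "dist (s, y) (t, x) < d" for s y
    proof (cases "s = 0")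
      case False
      then show ?thesis using pos[of s y] s by simp
    next
      case True
      obtain d' where d': "d' > 0" "\<And>z'. z' \<in> cyl T \<Longrightarrow> dist z' (0, y) < d' \<Longrightarrow> u (fst z') (snd z') < u 0 y + 1"
        using usc T unfolding usc_on_def by (metis fst_conv snd_conv mem_cyl less_imp_le order_refl zero_less_one)
      \<comment> \<open>The time q is small enough for \<open>(q, y)\<close> to lie both where
        semicontinuity at \<open>(0, y)\<close> applies and where the local bound at positive times
        holds.\<close>
      define q where "q = min T (min (d'/2) ((d - dist (s, y) (t, x)) / 2))"
      have q: "0 < q" "q \<le> T" "q < d'" "q < d - dist (s, y) (t, x)"
        using T d' s by (auto simp: q_def min_def)
      have "dist (q, y) (0, y) = q" using q by (simp add: dist_Pair_Pair dist_real_def)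
      moreover from this have "dist (q, y) (t, x) < d"
        using dist_triangle[of "(q, y)" "(t, x)" "(s, y)"] q True by simp
      ultimately show ?thesis using d'(2)[of "(q, y)"] pos[of q y] q True by simp
    qed
    then show ?thesis using d by blast
  qed
  have "\<exists>B. \<forall>z\<in>?K. u (fst z) (snd z) \<ge> B"
  proof (rule ccontr)
    assume "\<not> ?thesis"
    then have "\<forall>n::nat. \<exists>z. z \<in> ?K \<and> u (fst z) (snd z) < - real n" by (meson not_le)
    then obtain zs where zs: "\<And>n::nat. zs n \<in> ?K" "\<And>n. u (fst (zs n)) (snd (zs n)) < - real n" by metis
    have sc: "seq_compact ?K" using K(1) by (simp add: compact_eq_seq_compact_metric)
    obtain z r where z: "z \<in> ?K" "strict_mono (r :: nat \<Rightarrow> nat)" "(zs \<circ> r) \<longlonglongrightarrow> z"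
      using seq_compactE[OF sc, of zs] zs(1) by metis
    have "0 \<le> fst z" "fst z \<le> T" using z(1) by auto
    from below[OF this, of "snd z"] obtain d B where d: "d > 0"
      "\<And>s y. 0 \<le> s \<Longrightarrow> s \<le> T \<Longrightarrow> dist (s, y) z < d \<Longrightarrow> u s y \<ge> B" unfolding prod.collapse by blast
    have "eventually (\<lambda>n. dist ((zs \<circ> r) n) z < d) sequentially" using z(3) d(1) by (rule tendstoD)
    moreover have "eventually (\<lambda>n. real n > - B) sequentially"
      using filterlim_real_sequentially by (simp add: filterlim_at_top_dense)
    ultimately have "eventually (\<lambda>n. False) sequentially"
    proof eventually_elim
      case (elim n)
      have "u (fst (zs (r n))) (snd (zs (r n))) \<ge> B"
        using zs(1)[of "r n"] elim(1) by (intro d(2)) auto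
      moreover have "real n \<le> real (r n)" using strict_mono_imp_increasing[OF z(2)] by simp
      ultimately show ?case using zs(2)[of "r n"] elim(2) by linarith
    qed
    then show False by simp
  qed
  then obtain B where B: "\<And>z. z \<in> ?K \<Longrightarrow> u (fst z) (snd z) \<ge> B" by blast
  have "bounded_cyl T u (max \<bar>B\<bar> \<bar>u (fst z0) (snd z0)\<bar>)"
    unfolding bounded_cyl_def
  proof (intro ballI allI)
    fix t and x :: "real^'d" assume t: "t \<in> {0..T}"
    obtain k where k: "\<forall>i. k $ i \<in> \<int>" "x + k \<in> cbox 0 (\<chi> i. 1)" using integer_translate_to_cell[of x] by blast
    have "u t x = u t (x + k)" using per t k(1) by (simp add: periodic_x_def)
    moreover have "(t, x + k) \<in> ?K" using k(2) t by simp
    from z0[OF this] B[OF this] have "u t (x + k) \<le> u (fst z0) (snd z0)" "B \<le> u t (x + k)" by simp_all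
    ultimately show "\<bar>u t x\<bar> \<le> max \<bar>B\<bar> \<bar>u (fst z0) (snd z0)\<bar>" by linarith
  qed
  then show ?thesis by blast
qed

subsection \<open>Translations and bumps\<close>

lemma test_fun_translate:
  assumes "test_fun T \<phi> \<phi>t D\<phi>"
  shows "test_fun T (\<lambda>t x. \<phi> t (x + k)) (\<lambda>t x. \<phi>t t (x + k)) (\<lambda>t x. D\<phi> t (x + k))"
  unfolding test_fun_def
proof (intro conjI ballI allI)
  have c1: "continuous_on (cyl T) (\<lambda>z. \<phi> (fst z) (snd z))" and c2: "continuous_on (QT T) (\<lambda>z. \<phi>t (fst z) (snd z))"
    and c3: "continuous_on (QT T) (\<lambda>z. D\<phi> (fst z) (snd z))"
    using assms by (auto simp: test_fun_def)
  have tr: "continuous_on S (\<lambda>z. (fst z, snd z + k))" for S :: "(real \<times> (real^'a)) set"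
    by (intro continuous_intros)
  have imc: "(\<lambda>z. (fst z, snd z + k)) ` cyl T \<subseteq> cyl T" by (auto simp: cyl_def)
  have im: "(\<lambda>z. (fst z, snd z + k)) ` QT T \<subseteq> QT T" by (auto simp: QT_def)
  show "continuous_on (cyl T) (\<lambda>z. \<phi> (fst z) (snd z + k))"
    using continuous_on_compose2[OF c1 tr imc] by simp
  show "continuous_on (QT T) (\<lambda>z. \<phi>t (fst z) (snd z + k))"
    using continuous_on_compose2[OF c2 tr im] by simp
  show "continuous_on (QT T) (\<lambda>z. D\<phi> (fst z) (snd z + k))"
    using continuous_on_compose2[OF c3 tr im] by simp
  show "set_integrable lborel {0<..<T} (\<lambda>t. \<phi>t t (x + k))" for x
    using assms by (simp add: test_fun_def)
  fix t x assume t: "t \<in> {0<..T}"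
  have "((\<lambda>z. \<phi> (fst z) (snd z)) has_derivative
          (\<lambda>h. fst h * \<phi>t t (x + k) + D\<phi> t (x + k) \<bullet> snd h)) (at (t, x + k) within QT T)"
    using assms t by (simp add: test_fun_def)
  then have "((\<lambda>z. \<phi> (fst z) (snd z)) has_derivative
          (\<lambda>h. fst h * \<phi>t t (x + k) + D\<phi> t (x + k) \<bullet> snd h)) (at ((\<lambda>z. (fst z, snd z + k)) (t, x)) within (\<lambda>z. (fst z, snd z + k)) ` QT T)"
    using im by (auto elim: has_derivative_subset)
  moreover have "((\<lambda>z. (fst z, snd z + k)) has_derivative (\<lambda>h. h)) (at (t, x) within QT T)"
    by (auto intro!: derivative_eq_intros)
  ultimately have "((\<lambda>z. (\<lambda>z. \<phi> (fst z) (snd z)) ((\<lambda>z. (fst z, snd z + k)) z)) has_derivative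
          (\<lambda>h. fst h * \<phi>t t (x + k) + D\<phi> t (x + k) \<bullet> snd h)) (at (t, x) within QT T)"
    by (rule has_derivative_in_compose[rotated])
  then show "((\<lambda>z. \<phi> (fst z) (snd z + k)) has_derivative
          (\<lambda>h. fst h * \<phi>t t (x + k) + D\<phi> t (x + k) \<bullet> snd h)) (at (t, x) within QT T)" by simp
qed

context hamilton_jacobi
begin

lemma visc_sub_translate:
  assumes v: "visc_sub \<alpha> T H v" "bounded_cyl T v M"
    and per: "\<And>t x r p. t \<in> {0..T} \<Longrightarrow> H t (x + k) r p = H t x r p"
  shows "visc_sub \<alpha> T H (\<lambda>t x. v t (x + k))"
proof (rule visc_subI)
  show "usc_on (cyl T) (\<lambda>z. v (fst z) (snd z + k))"
    unfolding usc_on_def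
  proof (intro ballI allI impI)
    fix z :: "real \<times> (real^'d)" and e :: real assume z: "z \<in> cyl T" "0 < e"
    have "(fst z, snd z + k) \<in> cyl T" using z by (auto simp: cyl_def)
    from usc_onE[OF visc_sub_usc[OF v(1)] this z(2)] obtain d where d: "d > 0"
      "\<And>z'. z' \<in> cyl T \<Longrightarrow> dist z' (fst z, snd z + k) < d \<Longrightarrow> v (fst z') (snd z') < v (fst z) (snd z + k) + e"
      unfolding fst_conv snd_conv by metis
    show "\<exists>d>0. \<forall>z'\<in>cyl T. dist z' z < d \<longrightarrow> v (fst z') (snd z' + k) < v (fst z) (snd z + k) + e"
    proof (intro exI[of _ d] conjI ballI impI d(1))
      fix z' assume z': "z' \<in> cyl T" "dist z' z < d"
      then have "dist (fst z', snd z' + k) (fst z, snd z + k) < d" by (simp add: dist_prod_def)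
      with z'(1) show "v (fst z') (snd z' + k) < v (fst z) (snd z + k) + e"
        using d(2)[of "(fst z', snd z' + k)"] by (auto simp: cyl_def)
    qed
  qed
  show "bounded_cyl T (\<lambda>t x. v t (x + k)) M" using v(2) by (simp add: bounded_cyl_def)
  fix a b c \<rho> \<phi> \<phi>t D\<phi> t x
  assume a: "0 \<le> a" "a < t" and tb: "t \<le> b" "b \<le> T" and \<rho>: "\<rho> > (0::real)" and \<phi>: "test_fun T \<phi> \<phi>t D\<phi>"
    and x: "x \<in> ball c \<rho>"
    and max: "\<And>s y. s \<in> {a..b} \<Longrightarrow> y \<in> cball c \<rho> \<Longrightarrow> v s (y + k) - \<phi> s y \<le> v t (x + k) - \<phi> t x"
  have ab: "a < b" using a tb by simp
  have xk: "x + k \<in> ball (c + k) \<rho>" using x by simp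
  have max': "v s y - \<phi> s (y + - k) \<le> v t (x + k) - \<phi> t ((x + k) + - k)" if "s \<in> {a..b}" "y \<in> cball (c + k) \<rho>" for s y
  proof -
    have "dist c (y - k) = dist (c + k) y" by (metis add.commute add_diff_cancel_left' diff_add_cancel dist_add_cancel2)
    then show ?thesis using max[of s "y - k"] that by simp
  qed
  have "Lop \<alpha> a (\<lambda>t x. \<phi> t (x + - k)) v t (x + k) (v t (x + k)) + H t (x + k) (v t (x + k)) (D\<phi> t ((x + k) + - k)) \<le> 0"
    by (rule visc_subD[OF v a(1) ab tb(2) \<rho> test_fun_translate[OF \<phi>] a(2) tb(1) xk max'])
  moreover have "Lop \<alpha> a (\<lambda>t x. \<phi> t (x + - k)) v t (x + k) r = Lop \<alpha> a \<phi> (\<lambda>t x. v t (x + k)) t x r" for r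
    unfolding Lop_def by (rule arg_cong[where f = "\<lambda>g. \<alpha> / Gamma (1 - \<alpha>) * g"], rule set_lebesgue_integral_cong)
      (auto simp: incr_def)
  ultimately show "Lop \<alpha> a \<phi> (\<lambda>t x. v t (x + k)) t x (v t (x + k)) + H t x (v t (x + k)) (D\<phi> t x) \<le> 0"
    using per[of t x] a tb by simp
qed

text \<open>With q the squared distance to \<open>(t0, x0)\<close>, the correction is
  \<open>r * ((r/2)\<^sup>2 - q)\<close>: positive at distance less than \<open>r/2\<close>,
  nonpositive beyond, and with value and gradient tending to 0 with r near the centre.\<close>

definition bump :: "real \<Rightarrow> real \<Rightarrow> real^'d \<Rightarrow> (real \<Rightarrow> real^'d \<Rightarrow> real) \<Rightarrow> real \<Rightarrow> real^'d \<Rightarrow> real" where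
  "bump r t0 x0 \<phi> t x = \<phi> t x + (r ^ 3 / 4 + (- r * (t - t0)\<^sup>2 + (- r) * (norm (x - x0))\<^sup>2))"

lemma test_fun_bump:
  assumes "test_fun T \<phi> \<phi>t D\<phi>"
  shows "test_fun T (bump r t0 x0 \<phi>) (\<lambda>t x. \<phi>t t x - r * (2 * t - 2 * t0)) (\<lambda>t x. D\<phi> t x - (2 * r) *\<^sub>R (x - x0))"
proof -
  have time: "test_fun T (\<lambda>t (x::real^'d). - r * (t - t0)\<^sup>2) (\<lambda>t x. - r * (2 * (t - t0))) (\<lambda>t x. 0)"
    by (rule test_fun_time_C1) (auto intro!: derivative_eq_intros continuous_intros)
  from test_fun_add[OF assms test_fun_add[OF test_fun_const test_fun_add[OF time test_fun_space_square]], of "r ^ 3 / 4" "- r" x0]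
  show ?thesis unfolding bump_def[abs_def] by simp
qed

text \<open>If the inequality failed for arbitrarily small r, the violating points would converge to
  \<open>(t0, x0)\<close>, and passing to the limit would contradict the strict inequality
  there.\<close>

lemma bump_certificate:
  assumes \<phi>: "test_fun T \<phi> \<phi>t D\<phi>" and w: "lsc_on (cyl T) (\<lambda>z. w (fst z) (snd z))" "bounded_cyl T w M"
    and a: "0 \<le> a" "a < t0" "t0 \<le> T"
    and neg: "Lop \<alpha> a \<phi> w t0 x0 (\<phi> t0 x0) + H t0 x0 (\<phi> t0 x0) (D\<phi> t0 x0) < 0"
  shows "\<exists>r0>0. \<forall>r t x. 0 < r \<and> r \<le> r0 \<and> t \<le> T \<and> (t - t0)\<^sup>2 + (norm (x - x0))\<^sup>2 < r\<^sup>2 \<longrightarrow>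
     Lop \<alpha> a (bump r t0 x0 \<phi>) w t x (bump r t0 x0 \<phi> t x)
       + H t x (bump r t0 x0 \<phi> t x) (D\<phi> t x - (2 * r) *\<^sub>R (x - x0)) \<le> 0"
proof (rule ccontr)
  assume "\<not> ?thesis"
  then have *: "\<exists>r t x. 0 < r \<and> r \<le> r0 \<and> t \<le> T \<and> (t - t0)\<^sup>2 + (norm (x - x0))\<^sup>2 < r\<^sup>2 \<and>
     \<not> Lop \<alpha> a (bump r t0 x0 \<phi>) w t x (bump r t0 x0 \<phi> t x)
       + H t x (bump r t0 x0 \<phi> t x) (D\<phi> t x - (2 * r) *\<^sub>R (x - x0)) \<le> 0" if "0 < r0" for r0
    using that by meson
  define r0 where "r0 = (\<lambda>n. min (t0 - a) (1 / real (Suc n)))"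
  have "0 < r0 n" for n using a by (simp add: r0_def)
  from *[OF this] obtain r tn xn where r: "\<And>n. 0 < r n" "\<And>n. r n \<le> r0 n" and tT: "\<And>n. tn n \<le> T"
    and q: "\<And>n. (tn n - t0)\<^sup>2 + (norm (xn n - x0))\<^sup>2 < (r n)\<^sup>2"
    and viol: "\<And>n. \<not> Lop \<alpha> a (bump (r n) t0 x0 \<phi>) w (tn n) (xn n) (bump (r n) t0 x0 \<phi> (tn n) (xn n))
       + H (tn n) (xn n) (bump (r n) t0 x0 \<phi> (tn n) (xn n)) (D\<phi> (tn n) (xn n) - (2 * r n) *\<^sub>R (xn n - x0)) \<le> 0"
    by metis
  have r_le: "r n \<le> 1 / real (Suc n)" "r n \<le> t0 - a" for n using r(2)[of n] by (auto simp: r0_def)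
  have r_lim: "r \<longlonglongrightarrow> 0"
  proof (rule tendsto_sandwich[where f = "\<lambda>_. 0" and h = "\<lambda>n. 1 / real (Suc n)"])
    show "(\<lambda>n. 1 / real (Suc n)) \<longlonglongrightarrow> 0" by (intro LIMSEQ_Suc lim_1_over_n)
  qed (simp_all only: r_le less_imp_le[OF r(1)] eventually_True tendsto_const)
  have tn: "\<bar>tn n - t0\<bar> < r n" for n
  proof (rule power_less_imp_less_base)
    show "\<bar>tn n - t0\<bar>\<^sup>2 < (r n)\<^sup>2" using q[of n] zero_le_power2[of "norm (xn n - x0)"] unfolding power2_abs by linarith
  qed (use r(1)[of n] in simp)
  have xn: "norm (xn n - x0) < r n" for n
  proof (rule power_less_imp_less_base)
    show "(norm (xn n - x0))\<^sup>2 < (r n)\<^sup>2" using q[of n] zero_le_power2[of "tn n - t0"] by linarith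
  qed (use r(1)[of n] in simp)
  have tn_lim: "tn \<longlonglongrightarrow> t0"
    unfolding tendsto_dist_iff[of tn]
    by (rule tendsto_sandwich[OF _ _ tendsto_const r_lim]) (simp_all add: dist_real_def less_imp_le[OF tn])
  have xn_lim: "xn \<longlonglongrightarrow> x0"
    unfolding tendsto_dist_iff[of xn]
    by (rule tendsto_sandwich[OF _ _ tendsto_const r_lim]) (simp_all add: dist_norm less_imp_le[OF xn])
  have ta: "a < tn n" for n using tn[of n] r_le(2)[of n] by linarith
  have t0: "tn n \<in> {0<..T}" "tn n \<in> {0..T}" for n using ta[of n] a tT[of n] by auto
  define \<rho> where "\<rho> = (\<lambda>n. bump (r n) t0 x0 \<phi> (tn n) (xn n))"
  have "(\<lambda>n. \<phi> (tn n) (xn n) + ((r n) ^ 3 / 4 + (- r n * (tn n - t0)\<^sup>2 + (- r n) * (norm (xn n - x0))\<^sup>2)))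
     \<longlonglongrightarrow> \<phi> t0 x0 + (0 ^ 3 / 4 + (- 0 * (t0 - t0)\<^sup>2 + (- 0) * (norm (x0 - x0))\<^sup>2))"
    by (intro tendsto_intros test_fun_tendsto[OF \<phi>] tn_lim xn_lim r_lim t0) simp
  then have \<rho>_lim: "\<rho> \<longlonglongrightarrow> \<phi> t0 x0" by (simp add: \<rho>_def bump_def)
  define p where "p = (\<lambda>n. D\<phi> (tn n) (xn n) - (2 * r n) *\<^sub>R (xn n - x0))"
  have "p \<longlonglongrightarrow> D\<phi> t0 x0 - (2 * 0) *\<^sub>R (x0 - x0)"
    unfolding p_def using a
    by (intro tendsto_intros test_fun_grad_tendsto[OF \<phi>] tn_lim xn_lim r_lim t0) auto
  then have p_lim: "p \<longlonglongrightarrow> D\<phi> t0 x0" by simp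
  \<comment> \<open>This is the constant of \<open>quadratic_le_min\<close> with
    \<open>c = 2 * T\<close>, where T bounds the distance between \<open>tn n\<close> and
    \<open>t0\<close>.\<close>
  define D where "D = (1 + T\<^sup>2) + 2 * T * (1 + T)"
  have wm: "slice_measurable T w" using w T0 by (intro lsc_on_imp_slice_measurable) auto
  have est: "Lop \<alpha> a (bump (r n) t0 x0 \<phi>) w (tn n) (xn n) (\<rho> n) \<le> Lop \<alpha> a \<phi> w (tn n) (xn n) (\<rho> n) + (r n * D) * Lconst" for n
  proof (rule Lop_le_add[OF test_fun_bump[OF \<phi>] wm w(2) a(1) ta tT \<phi> wm w(2) a(1) ta])
    fix \<tau> :: real assume \<tau>: "0 < \<tau>"
    show "incr a (bump (r n) t0 x0 \<phi>) w (tn n) (xn n) (\<rho> n) \<tau> \<le> incr a \<phi> w (tn n) (xn n) (\<rho> n) \<tau> + r n * D * min \<tau> 1"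
    proof (cases "\<tau> < tn n - a")
      case True
      then have \<tau>T: "\<tau> \<le> T" using a tT[of n] by simp
      have "(tn n - \<tau> - t0)\<^sup>2 - (tn n - t0)\<^sup>2 = \<tau>\<^sup>2 + 2 * (t0 - tn n) * \<tau>"
        by (simp add: power2_eq_square algebra_simps)
      also have "\<dots> \<le> \<tau>\<^sup>2 + 2 * T * \<tau>"
        using t0(1)[of n] a \<tau> by (intro add_left_mono mult_right_mono) auto
      also have "\<dots> \<le> D * min \<tau> 1"
        unfolding D_def using \<tau> \<tau>T T0 by (intro quadratic_le_min) auto
      finally have "r n * ((tn n - \<tau> - t0)\<^sup>2 - (tn n - t0)\<^sup>2) \<le> r n * (D * min \<tau> 1)"
        using r(1)[of n] by (intro mult_left_mono) auto
      then show ?thesis using True \<tau> by (simp add: incr_def bump_def algebra_simps)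
    next
      case False
      have "0 \<le> r n * D * min \<tau> 1" using r(1)[of n] \<tau> T0 by (auto simp: D_def intro!: mult_nonneg_nonneg add_nonneg_nonneg)
      then show ?thesis using False \<tau> by (simp add: incr_def)
    qed
  qed
  \<comment> \<open>Here upper semicontinuity of the operator is required. Since w is lower
    semicontinuous, the lower semicontinuity of \<open>Lop_limit\<close> is applied to -\<phi> and
    -w.\<close>
  have "Lop \<alpha> a (\<lambda>t x. - \<phi> t x) (\<lambda>t x. - w t x) t0 x0 (- \<phi> t0 x0) \<le> H t0 x0 (\<phi> t0 x0) (D\<phi> t0 x0) + (0 * D) * Lconst"
  proof (rule Lop_limit[OF test_fun_uminus[OF \<phi>] _ _ a(1,2) ta tT tn_lim xn_lim, where rn = "\<lambda>n. - \<rho> n"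
        and cn = "\<lambda>n. H (tn n) (xn n) (\<rho> n) (p n) + (r n * D) * Lconst" and M = M])
    show "usc_on (cyl T) (\<lambda>z. - w (fst z) (snd z))" using w(1) by (simp add: lsc_on_iff_usc_on)
    show "(\<lambda>n. - \<rho> n) \<longlonglongrightarrow> - \<phi> t0 x0" by (intro tendsto_intros \<rho>_lim)
    show "(\<lambda>n. H (tn n) (xn n) (\<rho> n) (p n) + (r n * D) * Lconst) \<longlonglongrightarrow> H t0 x0 (\<phi> t0 x0) (D\<phi> t0 x0) + (0 * D) * Lconst"
      by (intro tendsto_intros H_tendsto tn_lim xn_lim \<rho>_lim p_lim t0 r_lim)
    show "Lop \<alpha> a (\<lambda>t x. - \<phi> t x) (\<lambda>t x. - w t x) (tn n) (xn n) (- \<rho> n) \<le> H (tn n) (xn n) (\<rho> n) (p n) + (r n * D) * Lconst" for n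
    proof -
      have "0 < Lop \<alpha> a (bump (r n) t0 x0 \<phi>) w (tn n) (xn n) (\<rho> n) + H (tn n) (xn n) (\<rho> n) (p n)"
        using viol[of n] unfolding \<rho>_def p_def by (simp only: not_le)
      then show ?thesis using est[of n] unfolding Lop_uminus[OF \<phi> wm w(2) a(1) ta tT] by linarith
    qed
  qed (use w in simp)
  then have "- Lop \<alpha> a \<phi> w t0 x0 (\<phi> t0 x0) \<le> H t0 x0 (\<phi> t0 x0) (D\<phi> t0 x0)"
    unfolding Lop_uminus[OF \<phi> wm w(2) a] by simp
  then show False using neg by linarith
qed

end

subsection \<open>Perron's method\<close>

locale perron = hamilton_jacobi +
  fixes um up :: "real \<Rightarrow> real^'d \<Rightarrow> real" and g :: "real^'d \<Rightarrow> real" and M :: real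
  assumes um_sub: "visc_sub \<alpha> T H um"
    and up_super: "visc_sub \<alpha> T (reflect H) (\<lambda>t x. - up t x)"
    and um_bd: "bounded_cyl T um M" and up_bd: "bounded_cyl T up M"
    and um_up: "\<And>t x. 0 \<le> t \<Longrightarrow> t \<le> T \<Longrightarrow> um t x \<le> up t x"
    and g_cont: "continuous_on UNIV g"
    and um_g: "\<And>x. um 0 x \<le> g x" and g_up: "\<And>x. g x \<le> up 0 x"
begin

sublocale dual: hamilton_jacobi \<alpha> T "reflect H"
  by (rule hamilton_jacobi_dual)

section \<open>The admissible class and its supremum\<close>

lemma M_nonneg: "0 \<le> M"
  using bounded_cylD[OF um_bd, of 0 0] T0 by auto

lemma g_bd: "\<bar>g x\<bar> \<le> M"
  using bounded_cylD[OF um_bd, of 0 x] bounded_cylD[OF up_bd, of 0 x] um_g[of x] g_up[of x] T0 by auto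

text \<open>Only \<open>v\<close> has to stay below \<open>up\<close>, since the upper envelope of an element of the class need not
  do so; the second component carries the subsolution property and the initial values.\<close>

definition pair :: "(real \<Rightarrow> real^'d \<Rightarrow> real) \<Rightarrow> (real \<Rightarrow> real^'d \<Rightarrow> real) \<Rightarrow> bool" where
  "pair v V \<longleftrightarrow> (\<forall>t\<in>{0..T}. \<forall>x. um t x \<le> v t x \<and> v t x \<le> up t x \<and> v t x \<le> V t x) \<and>
     visc_sub \<alpha> T H V \<and> bounded_cyl T V M \<and> (\<forall>x. V 0 x \<le> g x) \<and>
     (\<forall>t x e. 0 < t \<and> t \<le> T \<and> 0 < e \<longrightarrow>
        (\<exists>s y. 0 < s \<and> s \<le> T \<and> dist (s, y) (t, x) < e \<and> v s y > V t x - e))"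

lemma pairD:
  assumes "pair v V"
  shows "visc_sub \<alpha> T H V" "bounded_cyl T V M" "\<And>x. V 0 x \<le> g x"
    "\<And>t x. 0 \<le> t \<Longrightarrow> t \<le> T \<Longrightarrow> um t x \<le> v t x" "\<And>t x. 0 \<le> t \<Longrightarrow> t \<le> T \<Longrightarrow> v t x \<le> up t x"
    "\<And>t x. 0 \<le> t \<Longrightarrow> t \<le> T \<Longrightarrow> v t x \<le> V t x"
    "\<And>t x e. 0 < t \<Longrightarrow> t \<le> T \<Longrightarrow> 0 < e \<Longrightarrow> \<exists>s y. 0 < s \<and> s \<le> T \<and> dist (s, y) (t, x) < e \<and> v s y > V t x - e"
  using assms unfolding pair_def by auto

lemma pair_self:
  assumes "visc_sub \<alpha> T H V" "bounded_cyl T V M" "\<And>x. V 0 x \<le> g x"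
    "\<And>t x. 0 \<le> t \<Longrightarrow> t \<le> T \<Longrightarrow> um t x \<le> V t x" "\<And>t x. 0 \<le> t \<Longrightarrow> t \<le> T \<Longrightarrow> V t x \<le> up t x"
  shows "pair V V"
proof -
  have "\<exists>s y. 0 < s \<and> s \<le> T \<and> dist (s, y) (t, x) < e \<and> V s y > V t x - e" if "0 < t" "t \<le> T" "0 < e" for t x e
    using that by (intro exI[of _ t] exI[of _ x]) auto
  then show ?thesis unfolding pair_def using assms by auto
qed

lemma pair_um: "pair um um"
  by (rule pair_self) (use um_sub um_bd um_g um_up in auto)

definition u :: "real \<Rightarrow> real^'d \<Rightarrow> real" where
  "u t x = (SUP v\<in>{v. \<exists>V. pair v V}. v t x)"

lemma u_upper:
  assumes "pair v V" "0 \<le> t" "t \<le> T"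
  shows "v t x \<le> u t x"
  unfolding u_def
proof (rule cSUP_upper)
  show "v \<in> {v. \<exists>V. pair v V}" using assms by blast
  show "bdd_above ((\<lambda>v. v t x) ` {v. \<exists>V. pair v V})"
    using pairD(5) assms by (auto intro!: bdd_aboveI[of _ "up t x"])
qed

lemma u_least:
  assumes "\<And>v V. pair v V \<Longrightarrow> v t x \<le> c"
  shows "u t x \<le> c"
  unfolding u_def using pair_um assms by (intro cSUP_least) auto

lemma u_approx:
  assumes "c < u t x"
  obtains v V where "pair v V" "c < v t x"
  using u_least[of t x c] assms by (meson not_le)

lemma um_u: "0 \<le> t \<Longrightarrow> t \<le> T \<Longrightarrow> um t x \<le> u t x"
  by (rule u_upper[OF pair_um])

lemma u_up: "0 \<le> t \<Longrightarrow> t \<le> T \<Longrightarrow> u t x \<le> up t x"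
  by (rule u_least) (rule pairD(5))

lemma u_bd: "bounded_cyl T u M"
  unfolding bounded_cyl_def
proof (intro ballI allI)
  fix t x assume "t \<in> {0..T}"
  then show "\<bar>u t x\<bar> \<le> M"
    using um_u[of t x] u_up[of t x] bounded_cylD[OF um_bd, of t x] bounded_cylD[OF up_bd, of t x] by auto
qed

text \<open>Within distance d continuity gives the bound e; beyond it the quadratic term is at least
  \<open>2 * M + 1\<close> and exceeds the oscillation of g. Barriers with a quadratic profile can
  thus trap g.\<close>

lemma g_quadratic:
  assumes "0 < e"
  obtains C where "C > 0" "\<And>x. \<bar>g x - g y\<bar> \<le> e + C * (norm (x - y))\<^sup>2"
proof -
  from continuous_onE[OF g_cont UNIV_I assms, of y]
  obtain d where d: "d > 0" "\<And>x. dist x y < d \<Longrightarrow> dist (g x) (g y) < e" by (metis UNIV_I)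
  define C where "C = (2 * M + 1) / d\<^sup>2"
  have C: "C > 0" using d(1) M_nonneg by (simp add: C_def)
  show thesis
  proof (rule that[OF C])
    fix x
    show "\<bar>g x - g y\<bar> \<le> e + C * (norm (x - y))\<^sup>2"
    proof (cases "dist x y < d")
      case True
      have "0 \<le> C * (norm (x - y))\<^sup>2" using C by simp
      then show ?thesis using d(2)[OF True] by (simp add: dist_real_def)
    next
      case False
      then have "C * d\<^sup>2 \<le> C * (norm (x - y))\<^sup>2"
        using d(1) C by (intro mult_left_mono power_mono) (auto simp: dist_norm)
      moreover have "C * d\<^sup>2 = 2 * M + 1" using d(1) by (simp add: C_def)
      ultimately show ?thesis using g_bd[of x] g_bd[of y] assms by linarith
    qed
  qed
qed

text \<open>From above, all second components of the class start below g and hence stay below one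
  common barrier. From below, the maximum of \<open>um\<close> with a decreasing barrier is itself a
  member of the class.\<close>

lemma near_initial:
  assumes "0 < e"
  obtains d where "d > 0" "\<And>s x. 0 \<le> s \<Longrightarrow> s \<le> T \<Longrightarrow> dist (s, x) (0, y) < d \<Longrightarrow> \<bar>u s x - g y\<bar> < e"
proof -
  \<comment> \<open>One half of e absorbs the offset of the barrier and the other its variation. The
    cap 1 keeps the offsets \<open>g y + e1\<close> and \<open>g y - e1\<close> within the bound
    \<open>M + 1\<close>.\<close>
  define e1 where "e1 = min (e/2) 1"
  have e1: "0 < e1" "e1 \<le> e/2" "e1 \<le> 1" using assms by (auto simp: e1_def)
  obtain C where C: "C > 0" "\<And>x. \<bar>g x - g y\<bar> \<le> e1 + C * (norm (x - y))\<^sup>2"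
    using g_quadratic[OF e1(1)] by metis
  have bd: "\<bar>g y + e1\<bar> \<le> M + 1" "\<bar>g y - e1\<bar> \<le> M + 1" using g_bd[of y] e1 by auto
  obtain K1 where K1: "\<And>v A K t x. visc_sub \<alpha> T H v \<Longrightarrow> bounded_cyl T v (M + 1) \<Longrightarrow> \<bar>A\<bar> \<le> M + 1 \<Longrightarrow> K1 \<le> K \<Longrightarrow>
      \<forall>x. v 0 x \<le> A + C * (norm (x - y))\<^sup>2 \<Longrightarrow> 0 \<le> t \<Longrightarrow> t \<le> T \<Longrightarrow> v t x \<le> barrier A C y K t x"
    using visc_sub_le_barrier[OF C(1), of "M + 1" y] by blast
  obtain K2 where K2: "\<And>v A K t x. visc_sub \<alpha> T (reflect H) v \<Longrightarrow> bounded_cyl T v (M + 1) \<Longrightarrow> \<bar>A\<bar> \<le> M + 1 \<Longrightarrow> K2 \<le> K \<Longrightarrow>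
      \<forall>x. v 0 x \<le> A + C * (norm (x - y))\<^sup>2 \<Longrightarrow> 0 \<le> t \<Longrightarrow> t \<le> T \<Longrightarrow> v t x \<le> barrier A C y K t x"
    using dual.visc_sub_le_barrier[OF C(1), of "M + 1" y] by blast
  obtain K3 where K3: "\<And>v A K. visc_sub \<alpha> T H v \<Longrightarrow> bounded_cyl T v (M + 1) \<Longrightarrow> \<bar>A\<bar> \<le> M + 1 \<Longrightarrow> K3 \<le> K \<Longrightarrow>
      visc_sub \<alpha> T H (\<lambda>t x. max (v t x) (barrier A (- C) y (- K) t x))"
    using visc_sub_max_barrier[OF C(1), of "M + 1" y] by blast
  define K where "K = max 0 (max K1 (max K2 K3))"
  have K: "K \<ge> 0" "K \<ge> K1" "K \<ge> K2" "K \<ge> K3" by (auto simp: K_def)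
  have bd': "bounded_cyl T um (M + 1)" "bounded_cyl T (\<lambda>t x. - up t x) (M + 1)"
    using um_bd up_bd by (auto intro: bounded_cyl_mono)
  have upper: "u t x \<le> barrier (g y + e1) C y K t x" if t: "0 \<le> t" "t \<le> T" for t x
  proof (rule u_least)
    fix v V assume vV: "pair v V"
    have "V t x \<le> barrier (g y + e1) C y K t x"
    proof (rule K1[OF pairD(1)[OF vV] bounded_cyl_mono[OF pairD(2)[OF vV]] bd(1) K(2) _ t])
      show "\<forall>x. V 0 x \<le> g y + e1 + C * (norm (x - y))\<^sup>2"
      proof
        fix x show "V 0 x \<le> g y + e1 + C * (norm (x - y))\<^sup>2"
          using pairD(3)[OF vV, of x] C(2)[of x] by linarith
      qed
    qed simp
    then show "v t x \<le> barrier (g y + e1) C y K t x" using pairD(6)[OF vV t, of x] by linarith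
  qed
  let ?b = "barrier (g y - e1) (- C) y (- K)"
  let ?V = "\<lambda>t x. max (um t x) (?b t x)"
  \<comment> \<open>Comparison of -up with the increasing barrier, for the reflected
    equation.\<close>
  have b_up: "?b t x \<le> up t x" if t: "0 \<le> t" "t \<le> T" for t x
  proof -
    have "- up t x \<le> barrier (- (g y - e1)) C y K t x"
    proof (rule K2[OF up_super bd'(2) _ K(3) _ t])
      show "\<bar>- (g y - e1)\<bar> \<le> M + 1" using bd by simp
      show "\<forall>x. - up 0 x \<le> - (g y - e1) + C * (norm (x - y))\<^sup>2"
      proof
        fix x show "- up 0 x \<le> - (g y - e1) + C * (norm (x - y))\<^sup>2"
          using g_up[of x] C(2)[of x] by linarith
      qed
    qed
    then show ?thesis using barrier_uminus[of "g y - e1" "- C" y "- K" t x] by simp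
  qed
  have "pair ?V ?V"
  proof (rule pair_self)
    show "visc_sub \<alpha> T H ?V" by (rule K3[OF um_sub bd'(1) bd(2) K(4)])
    show "?V t x \<le> up t x" if "0 \<le> t" "t \<le> T" for t x using b_up[OF that] um_up[OF that] by simp
    show "bounded_cyl T ?V M"
      unfolding bounded_cyl_def
    proof (intro ballI allI)
      fix t x assume "t \<in> {0..T}"
      then show "\<bar>?V t x\<bar> \<le> M"
        using b_up[of t x] bounded_cylD[OF um_bd, of t x] bounded_cylD[OF up_bd, of t x] by (auto simp: max_def)
    qed
    show "?V 0 x \<le> g x" for x
      using um_g[of x] C(2)[of x] by (simp add: barrier_zero)
  qed simp
  then have lower: "?b t x \<le> u t x" if "0 \<le> t" "t \<le> T" for t x
    using u_upper[of ?V ?V t x] that by simp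
  have bc: "continuous_on (cyl T) (\<lambda>z. barrier 0 C y K (fst z) (snd z))"
    by (rule test_fun_continuous[OF test_fun_barrier])
  have "(0, y) \<in> cyl T" "0 < e / 2" using T0 assms by simp_all
  from continuous_onE[OF bc this] obtain d where d: "d > 0"
    "\<And>z. z \<in> cyl T \<Longrightarrow> dist z (0, y) < d \<Longrightarrow> dist (barrier 0 C y K (fst z) (snd z)) (barrier 0 C y K 0 y) < e / 2"
    unfolding fst_conv snd_conv by metis
  show thesis
  proof (rule that[OF d(1)])
    fix s x assume s: "0 \<le> s" "s \<le> T" "dist (s, x) (0, y) < d"
    have "\<bar>barrier 0 C y K s x\<bar> < e / 2"
      using d(2)[of "(s, x)"] s by (simp add: dist_real_def barrier_zero)
    then have "\<bar>C * (norm (x - y))\<^sup>2 + K * s powr \<alpha>\<bar> < e/2" by (simp add: barrier_def)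
    moreover have "u s x \<le> g y + e1 + (C * (norm (x - y))\<^sup>2 + K * s powr \<alpha>)"
      using upper[OF s(1,2), of x] by (simp add: barrier_def)
    moreover have "u s x \<ge> g y - e1 - (C * (norm (x - y))\<^sup>2 + K * s powr \<alpha>)"
      using lower[OF s(1,2), of x] by (simp add: barrier_def)
    ultimately show "\<bar>u s x - g y\<bar> < e" using e1 by linarith
  qed
qed

section \<open>Envelopes of the supremum and their initial values\<close>

definition ubar :: "real \<Rightarrow> real^'d \<Rightarrow> real" where "ubar = uenv T u"
definition w :: "real \<Rightarrow> real^'d \<Rightarrow> real" where "w t x = - uenv T (\<lambda>t x. - u t x) t x"

lemma nu_bd: "bounded_cyl T (\<lambda>t x. - u t x) M"
  using u_bd by simp

lemma ubar_bd: "bounded_cyl T ubar M"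
  unfolding ubar_def by (rule bounded_cyl_uenv[OF u_bd T0])

lemma ubar_usc: "usc_cyl T ubar"
  unfolding ubar_def by (rule usc_on_uenv[OF u_bd T0])

lemma w_bd: "bounded_cyl T w M"
  using bounded_cyl_uenv[OF nu_bd T0] by (simp add: w_def bounded_cyl_def)

lemma w_lsc: "lsc_on (cyl T) (\<lambda>z. w (fst z) (snd z))"
  using usc_on_uenv[OF nu_bd T0] by (simp add: w_def lsc_on_iff_usc_on)

lemma ubar_0: "ubar 0 y = g y"
  unfolding ubar_def
proof (rule uenv_eq_limit[OF u_bd T0 order_refl less_imp_le[OF T0]])
  show "\<exists>d>0. \<forall>s x. 0 < s \<and> s \<le> T \<and> dist (s, x) (0, y) < d \<longrightarrow> \<bar>u s x - g y\<bar> < e" if "0 < e" for e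
  proof -
    from near_initial[OF that, of y] obtain d where "d > 0"
      "\<And>s x. 0 \<le> s \<Longrightarrow> s \<le> T \<Longrightarrow> dist (s, x) (0, y) < d \<Longrightarrow> \<bar>u s x - g y\<bar> < e" by blast
    then show ?thesis by (intro exI[of _ d]) auto
  qed
qed

lemma w_0: "w 0 y = g y"
proof -
  have "uenv T (\<lambda>t x. - u t x) 0 y = - g y"
  proof (rule uenv_eq_limit[OF nu_bd T0 order_refl less_imp_le[OF T0]])
    show "\<exists>d>0. \<forall>s x. 0 < s \<and> s \<le> T \<and> dist (s, x) (0, y) < d \<longrightarrow> \<bar>- u s x - - g y\<bar> < e" if "0 < e" for e
    proof -
      from near_initial[OF that, of y] obtain d where "d > 0"
        "\<And>s x. 0 \<le> s \<Longrightarrow> s \<le> T \<Longrightarrow> dist (s, x) (0, y) < d \<Longrightarrow> \<bar>u s x - g y\<bar> < e" by blast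
      then show ?thesis by (intro exI[of _ d]) (auto simp: abs_minus_commute)
    qed
  qed
  then show ?thesis by (simp add: w_def)
qed

lemma u_0: "u 0 x \<le> g x"
proof (rule u_least)
  fix v V assume "pair v V"
  then show "v 0 x \<le> g x" using pairD(3,6) T0 by (meson less_imp_le order_refl order_trans)
qed

lemma u_ubar: "0 \<le> t \<Longrightarrow> t \<le> T \<Longrightarrow> u t x \<le> ubar t x"
  using le_uenv[OF u_bd, of t x] u_0[of x] ubar_0[of x] by (cases "t = 0") (auto simp: ubar_def)

lemma w_u: "0 < t \<Longrightarrow> t \<le> T \<Longrightarrow> w t x \<le> u t x"
  using le_uenv[OF nu_bd, of t x] by (simp add: w_def)

lemma w_ubar: "0 \<le> t \<Longrightarrow> t \<le> T \<Longrightarrow> w t x \<le> ubar t x"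
  using w_u[of t x] u_ubar[of t x] w_0[of x] ubar_0[of x] by (cases "t = 0") auto

lemma w_up: "0 \<le> t \<Longrightarrow> t \<le> T \<Longrightarrow> w t x \<le> up t x"
  using w_u[of t x] u_up[of t x] w_0[of x] g_up[of x] by (cases "t = 0") auto

text \<open>Here the approximation clause of \<open>pair\<close> is decisive: V is approached by
  values of v, hence of u, at nearby positive times.\<close>

lemma pair_le_ubar:
  assumes "pair v V" "0 \<le> t" "t \<le> T"
  shows "V t x \<le> ubar t x"
proof (cases "t = 0")
  case True
  then show ?thesis using pairD(3)[OF assms(1)] ubar_0 by simp
next
  case False
  then have t: "0 < t" using assms by simp
  show ?thesis
    unfolding ubar_def
  proof (rule uenv_ge[OF u_bd T0 assms(2,3)])
    fix e :: real assume "0 < e"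
    from pairD(7)[OF assms(1) t assms(3) this, of x] obtain s y where
      s: "0 < s" "s \<le> T" "dist (s, y) (t, x) < e" "v s y > V t x - e" by blast
    then show "\<exists>s y. 0 < s \<and> s \<le> T \<and> dist (s, y) (t, x) < e \<and> u s y > V t x - e"
      using u_upper[OF assms(1), of s y] by (intro exI[of _ s] exI[of _ y]) auto
  qed
qed

text \<open>Stability is applied to the second components V, since the first components v carry no
  semicontinuity; the approximation of \<open>ubar\<close> passes through v and uses
  \<open>v <= V\<close>.\<close>

lemma ubar_sub: "visc_sub \<alpha> T H ubar"
proof (rule visc_sub_stability[where F = "{V. \<exists>v. pair v V}" and M = M])
  fix V assume "V \<in> {V. \<exists>v. pair v V}"
  then obtain v where v: "pair v V" by blast
  show "usc_cyl T V" by (rule visc_sub_usc[OF pairD(1)[OF v]])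
  show "bounded_cyl T V M" by (rule pairD(2)[OF v])
  show "weak_sub \<alpha> T H V" by (rule visc_sub_imp_weak_sub[OF pairD(1,2)[OF v]])
  show "V t x \<le> ubar t x" if "0 \<le> t" "t \<le> T" for t x by (rule pair_le_ubar[OF v that])
next
  fix t e :: real and x assume t: "0 < t" "t \<le> T" and e: "0 < e"
  then have "0 \<le> t" "0 < e / 2" by auto
  from uenv_lower[OF u_bd T0 this(1) t(2) this(2) e, of x] obtain s y where
    s: "0 < s" "s \<le> T" "dist (s, y) (t, x) < e" "u s y > ubar t x - e/2" unfolding ubar_def by blast
  have "ubar t x - e < u s y" using s(4) e by simp
  from u_approx[OF this] obtain v V where v: "pair v V" "ubar t x - e < v s y" by blast
  moreover have "v s y \<le> V s y" using pairD(6)[OF v(1), of s y] s by simp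
  moreover have "\<bar>s - t\<bar> < e" "dist y x < e"
    using s(3) dist_fst_le[of "(s, y)" "(t, x)"] dist_snd_le[of "(s, y)" "(t, x)"] by (auto simp: dist_real_def)
  ultimately show "\<exists>V\<in>{V. \<exists>v. pair v V}. \<exists>s y. s \<le> T \<and> \<bar>s - t\<bar> < e \<and> dist y x < e \<and> V s y > ubar t x - e"
    using s(2) by (intro bexI[of _ V] exI[of _ s] exI[of _ y]) auto
qed (rule ubar_usc ubar_bd)+

text \<open>The bump is glued twice, into u to keep the result below \<open>up\<close> and into
  \<open>ubar\<close> to get a semicontinuous subsolution. The resulting pair is admissible, so
  maximality puts the bump below u near the contact point, although u comes arbitrarily close to w
  there. The past before a enters only through w, which lies below \<open>ubar\<close>.\<close>

lemma no_bump:
  assumes \<phi>: "test_fun T \<phi> \<phi>t D\<phi>" and a: "0 \<le> a" "a < t0" "t0 \<le> T" and \<rho>: "\<rho> > 0" and x0: "x0 \<in> ball c \<rho>"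
    and touch: "\<phi> t0 x0 = w t0 x0" "\<And>s y. s \<in> {a..T} \<Longrightarrow> y \<in> cball c \<rho> \<Longrightarrow> \<phi> s y \<le> w s y"
    and strict: "w t0 x0 < up t0 x0"
  shows "Lop \<alpha> a \<phi> w t0 x0 (w t0 x0) + H t0 x0 (w t0 x0) (D\<phi> t0 x0) \<ge> 0"
proof (rule ccontr)
  assume "\<not> ?thesis"
  then have neg: "Lop \<alpha> a \<phi> w t0 x0 (\<phi> t0 x0) + H t0 x0 (\<phi> t0 x0) (D\<phi> t0 x0) < 0" by (simp add: touch)
  obtain r0 where r0: "r0 > 0" and cert: "\<And>r t x. 0 < r \<Longrightarrow> r \<le> r0 \<Longrightarrow> t \<le> T \<Longrightarrow> (t - t0)\<^sup>2 + (norm (x - x0))\<^sup>2 < r\<^sup>2 \<Longrightarrow>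
     Lop \<alpha> a (bump r t0 x0 \<phi>) w t x (bump r t0 x0 \<phi> t x)
       + H t x (bump r t0 x0 \<phi> t x) (D\<phi> t x - (2 * r) *\<^sub>R (x - x0)) \<le> 0"
    using bump_certificate[OF \<phi> w_lsc w_bd a neg] by blast
  \<comment> \<open>A third of the gap each is spent on the lift of the bump, the variation of
    \<phi> and the possible drop of \<open>up\<close>.\<close>
  define \<eta> where "\<eta> = (up t0 x0 - w t0 x0) / 3"
  have \<eta>: "\<eta> > 0" using strict by (simp add: \<eta>_def)
  have z0: "(t0, x0) \<in> cyl T" using a by simp
  have up_usc: "usc_on (cyl T) (\<lambda>z. - up (fst z) (snd z))" by (rule visc_sub_usc[OF up_super])
  from usc_onE[OF up_usc z0 \<eta>] obtain d1 where d1: "d1 > 0"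
    "\<And>z. z \<in> cyl T \<Longrightarrow> dist z (t0, x0) < d1 \<Longrightarrow> - up (fst z) (snd z) < - up t0 x0 + \<eta>"
    unfolding fst_conv snd_conv by metis
  from continuous_onE[OF test_fun_continuous[OF \<phi>] z0 \<eta>] obtain d2 where d2: "d2 > 0"
    "\<And>z. z \<in> cyl T \<Longrightarrow> dist z (t0, x0) < d2 \<Longrightarrow> dist (\<phi> (fst z) (snd z)) (\<phi> t0 x0) < \<eta>"
    unfolding fst_conv snd_conv by metis
  \<comment> \<open>The bounds provide, in order, the certificate, times after a, control of
    \<open>up\<close> and \<phi>, points inside the test ball, and a lift \<open>r ^ 3 / 4\<close>
    of at most \<eta>.\<close>
  define r where "r = min (min r0 (t0 - a)) (min (min d1 d2) (min (\<rho> - dist c x0) (min 1 \<eta>)))"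
  have r: "0 < r" "r \<le> r0" "r \<le> t0 - a" "r \<le> d1" "r \<le> d2" "r \<le> \<rho> - dist c x0" "r \<le> 1" "r \<le> \<eta>"
    using r0 a d1 d2 x0 \<eta> by (auto simp: r_def)
  have r3: "r ^ 3 / 4 \<le> \<eta>"
  proof -
    have "r ^ 3 \<le> r" using power_decreasing[of 1 3 r] r by simp
    then show ?thesis using r by linarith
  qed
  define q where "q = (\<lambda>s y. (s - t0)\<^sup>2 + (norm (y - x0))\<^sup>2)"
  define \<psi> where "\<psi> = bump r t0 x0 \<phi>"
  have \<psi>_q: "\<psi> s y = \<phi> s y + r ^ 3 / 4 - r * q s y" for s y by (simp add: \<psi>_def bump_def q_def algebra_simps)
  have q_nonneg: "q s y \<ge> 0" for s y by (simp add: q_def)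
  note tf = test_fun_bump[OF \<phi>, of r t0 x0, folded \<psi>_def]
  have q_dist: "q s y = (dist (s, y) (t0, x0))\<^sup>2" for s y
    by (subst dist_Pair_Pair) (simp add: q_def dist_norm)
  have q_less: "q s y < R\<^sup>2 \<longleftrightarrow> dist (s, y) (t0, x0) < R" if "0 < R" for s y R
    unfolding q_dist not_le[symmetric] using that by (subst power_mono_iff) auto
  have inside: "a < s" "y \<in> cball c \<rho>" "\<psi> s y \<le> up s y" if s: "q s y < r\<^sup>2" "s \<le> T" for s y
  proof -
    have ds: "dist (s, y) (t0, x0) < r" using s r(1) q_less by simp
    then have "\<bar>s - t0\<bar> < r" "dist y x0 < r"
      using dist_fst_le[of "(s, y)" "(t0, x0)"] dist_snd_le[of "(s, y)" "(t0, x0)"] by (auto simp: dist_real_def)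
    then show as: "a < s" and "y \<in> cball c \<rho>"
      using r(3,6) dist_triangle[of c y x0] by (auto simp: dist_commute)
    have "\<psi> s y \<le> \<phi> s y + \<eta>"
      using r3 mult_nonneg_nonneg[OF less_imp_le[OF r(1)] q_nonneg[of s y]] unfolding \<psi>_q by linarith
    moreover have sc: "(s, y) \<in> cyl T" using as a s(2) by simp
    have "\<phi> s y < w t0 x0 + \<eta>"
      using d2(2)[OF sc] ds r(5) touch(1) by (simp add: dist_real_def abs_less_iff)
    moreover have "up s y > up t0 x0 - \<eta>" using d1(2)[OF sc] ds r(4) by simp
    moreover have "up t0 x0 = w t0 x0 + 3 * \<eta>" by (simp add: \<eta>_def field_simps)
    ultimately show "\<psi> s y \<le> up s y" by linarith
  qed
  \<comment> \<open>Between radii \<open>r/2\<close> and r the bump lies below \<phi>, hence below w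
    and \<open>ubar\<close>. The gluing has no effect on V there, which makes V upper semicontinuous
    across the sphere of radius r.\<close>
  have outer: "\<psi> s y \<le> \<phi> s y" if "q s y \<ge> (r/2)\<^sup>2" for s y
  proof -
    have "r * (r/2)\<^sup>2 \<le> r * q s y" using that r(1) by (intro mult_left_mono) auto
    then show ?thesis by (simp add: \<psi>_q power2_eq_square power3_eq_cube)
  qed
  have rim: "\<psi> s y \<le> ubar s y" if "q s y \<ge> (r/2)\<^sup>2" "a \<le> s" "s \<le> T" "y \<in> cball c \<rho>" for s y
    using outer[OF that(1)] touch(2)[of s y] w_ubar[of s y] a that by auto
  define U where "U = (\<lambda>s y. if q s y < r\<^sup>2 then max (u s y) (\<psi> s y) else u s y)"
  define V where "V = (\<lambda>s y. if q s y < r\<^sup>2 then max (ubar s y) (\<psi> s y) else ubar s y)"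
  have V_eq: "V s y = ubar s y" if "q s y \<ge> (r/2)\<^sup>2" "s \<le> T" for s y
    using rim[OF that(1) _ that(2)] inside[of s y] that by (auto simp: V_def max_def)
  have ubar_V: "ubar s y \<le> V s y" for s y by (simp add: V_def)
  have V_bd: "bounded_cyl T V M"
    unfolding bounded_cyl_def
  proof (intro ballI allI)
    fix s y assume s: "s \<in> {0..T}"
    then show "\<bar>V s y\<bar> \<le> M"
      using bounded_cylD[OF ubar_bd, of s y] bounded_cylD[OF up_bd, of s y] inside(3)[of s y]
      by (auto simp: V_def max_def)
  qed
  have V_usc: "usc_cyl T V"
    unfolding usc_on_def
  proof (intro ballI allI impI)
    fix z :: "real \<times> (real^'d)" and e :: real assume z: "z \<in> cyl T" and e: "0 < e"
    obtain s y where sy: "z = (s, y)" by (cases z)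
    have usc_max: "usc_on (cyl T) (\<lambda>z. max (ubar (fst z) (snd z)) (\<psi> (fst z) (snd z)))"
      by (intro usc_on_max ubar_usc continuous_on_imp_usc_on test_fun_continuous[OF tf])
    show "\<exists>d>0. \<forall>z'\<in>cyl T. dist z' z < d \<longrightarrow> V (fst z') (snd z') < V (fst z) (snd z) + e"
    proof (cases "q s y < r\<^sup>2")
      case True
      have Vz: "V (fst z) (snd z) = max (ubar (fst z) (snd z)) (\<psi> (fst z) (snd z))" using True by (simp add: V_def sy)
      from usc_onE[OF usc_max z e] obtain d where d: "d > 0" "\<And>z'. z' \<in> cyl T \<Longrightarrow> dist z' z < d \<Longrightarrow>
          max (ubar (fst z') (snd z')) (\<psi> (fst z') (snd z')) < max (ubar (fst z) (snd z)) (\<psi> (fst z) (snd z)) + e"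
        by metis
      have "V (fst z') (snd z') \<le> max (ubar (fst z') (snd z')) (\<psi> (fst z') (snd z'))" for z' by (simp add: V_def)
      then show ?thesis unfolding Vz using d by (intro exI[of _ d]) (meson le_less_trans)
    next
      case False
      then have far: "dist z (t0, x0) \<ge> r" using q_less[OF r(1), of s y] by (simp add: sy)
      from usc_onE[OF ubar_usc z e] obtain d where d: "d > 0"
        "\<And>z'. z' \<in> cyl T \<Longrightarrow> dist z' z < d \<Longrightarrow> ubar (fst z') (snd z') < ubar (fst z) (snd z) + e" by metis
      have Vz: "V (fst z) (snd z) = ubar (fst z) (snd z)" using False by (simp add: V_def sy)
      have near: "V (fst z') (snd z') = ubar (fst z') (snd z')" if z': "z' \<in> cyl T" "dist z' z < r/2" for z'
      proof (rule V_eq)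
        have "r/2 \<le> dist z' (t0, x0)" using far z'(2) dist_triangle[of z "(t0, x0)" z'] by (simp add: dist_commute)
        then show "(r/2)\<^sup>2 \<le> q (fst z') (snd z')" using q_less[of "r/2" "fst z'" "snd z'"] r(1) by (simp add: not_less[symmetric])
        show "fst z' \<le> T" using z'(1) by (auto simp: cyl_def)
      qed
      show ?thesis unfolding Vz using r(1) d near by (intro exI[of _ "min d (r/2)"]) simp
    qed
  qed
  have wm: "slice_measurable T w" using w_lsc T0 by (intro lsc_on_imp_slice_measurable) auto
  have V_sub: "visc_sub \<alpha> T H V"
  proof (rule visc_sub_criterion[OF V_usc V_bd])
    fix t x assume t: "0 < t" "t \<le> T"
    show "sub_witness \<alpha> T H V t x"
    proof (cases "V t x = ubar t x")
      case True
      then show ?thesis using ubar_V by (intro sub_witness_sub[OF ubar_sub ubar_bd]) auto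
    next
      case False
      then have qr: "q t x < r\<^sup>2" and Vt: "V t x = \<psi> t x" by (auto simp: V_def max_def split: if_splits)
      note ins = inside[OF qr t(2)]
      show ?thesis
      proof (rule sub_witness_test[OF tf a(1) ins(1) wm w_bd])
        \<comment> \<open>The time segment from a to t can leave the ball of radius r; outside it
          \<open>rim\<close> still places \<psi> below \<open>ubar\<close>.\<close>
        show "\<psi> s x \<le> V s x" if s: "s \<in> {a..t}" for s
        proof (cases "q s x < r\<^sup>2")
          case False
          moreover have "(r/2)\<^sup>2 \<le> r\<^sup>2" using r(1) by (intro power_mono) auto
          ultimately have "\<psi> s x \<le> ubar s x" using s t(2) ins(2) by (intro rim) auto
          then show ?thesis using ubar_V[of s x] by linarith
        qed (simp add: V_def)
        show "w s x \<le> V s x" if "s \<in> {0..a}" for s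
          using w_ubar[of s x] ubar_V[of s x] that a by auto
        have "((\<lambda>y. q t y) \<longlongrightarrow> q t x) (at x)" unfolding q_def by (intro tendsto_intros)
        then have "eventually (\<lambda>y. q t y < r\<^sup>2) (at x)" using qr by (rule order_tendstoD)
        then show "eventually (\<lambda>y. \<psi> t y \<le> V t y) (at x)" by eventually_elim (simp add: V_def)
        show "Lop \<alpha> a \<psi> w t x (V t x) + H t x (V t x) (D\<phi> t x - (2 * r) *\<^sub>R (x - x0)) \<le> 0"
          unfolding Vt unfolding \<psi>_def using r(1,2) t(2) qr by (intro cert) (auto simp: q_def)
      qed (simp add: Vt)
    qed
  qed
  have "pair U V"
    unfolding pair_def
  proof (intro conjI ballI allI impI V_sub V_bd)
    fix t x assume t: "t \<in> {0..T}"
    show "um t x \<le> U t x" using um_u[of t x] t by (auto simp: U_def)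
    show "U t x \<le> up t x" using u_up[of t x] inside(3)[of t x] t by (auto simp: U_def)
    show "U t x \<le> V t x" using u_ubar[of t x] t by (auto simp: U_def V_def)
  next
    fix x
    \<comment> \<open>The ball contains only times after a, and \<open>a >= 0\<close>; so the
      initial values are those of \<open>ubar\<close>, namely g.\<close>
    have "\<not> q 0 x < r\<^sup>2" using inside(1)[of 0 x] a T0 by auto
    then show "V 0 x \<le> g x" by (simp add: V_def ubar_0)
  next
    fix t x e assume t: "0 < t \<and> t \<le> T \<and> (0::real) < e"
    show "\<exists>s y. 0 < s \<and> s \<le> T \<and> dist (s, y) (t, x) < e \<and> V t x - e < U s y"
    proof (cases "V t x = ubar t x")
      case True
      have "0 \<le> t" using t by simp
      from uenv_lower[OF u_bd T0 this, of e e x] t obtain s y where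
        s: "0 < s" "s \<le> T" "dist (s, y) (t, x) < e" "u s y > ubar t x - e" unfolding ubar_def by blast
      moreover have "u s y \<le> U s y" by (simp add: U_def)
      ultimately show ?thesis using True by (intro exI[of _ s] exI[of _ y]) auto
    next
      case False
      then have "q t x < r\<^sup>2" "V t x = \<psi> t x" by (auto simp: V_def max_def split: if_splits)
      then show ?thesis using t by (intro exI[of _ t] exI[of _ x]) (auto simp: U_def)
    qed
  qed
  from u_upper[OF this] have U_u: "U s y \<le> u s y" if "0 \<le> s" "s \<le> T" for s y using that by blast
  \<comment> \<open>A quarter of the lift at the centre: nearby, \<psi> exceeds
    \<open>w t0 x0 + 3 * e\<close>, while some value of u lies below
    \<open>w t0 x0 + e\<close>.\<close>
  define e where "e = r ^ 3 / 16"
  have e: "e > 0" using r(1) by (simp add: e_def)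
  from continuous_onE[OF test_fun_continuous[OF tf] z0 e] obtain d3 where d3: "d3 > 0"
    "\<And>z. z \<in> cyl T \<Longrightarrow> dist z (t0, x0) < d3 \<Longrightarrow> dist (\<psi> (fst z) (snd z)) (\<psi> t0 x0) < e"
    unfolding fst_conv snd_conv by metis
  have "0 \<le> t0" "0 < min d3 r" using a d3 r by auto
  from uenv_lower[OF nu_bd T0 this(1) a(3) e this(2), of x0] obtain s y where
    s: "0 < s" "s \<le> T" "dist (s, y) (t0, x0) < min d3 r" "- u s y > uenv T (\<lambda>t x. - u t x) t0 x0 - e" by blast
  have "u s y < w t0 x0 + e" using s(4) by (simp add: w_def)
  moreover have "\<psi> t0 x0 = w t0 x0 + 4 * e" by (simp add: \<psi>_q q_def touch e_def)
  moreover have "\<psi> s y > \<psi> t0 x0 - e" using d3(2)[of "(s, y)"] s by (simp add: dist_real_def abs_less_iff)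
  moreover have "\<psi> s y \<le> U s y" using q_less[OF r(1), of s y] s(3) by (simp add: U_def)
  moreover have "U s y \<le> u s y" using U_u s by simp
  ultimately show False using e by linarith
qed

text \<open>Where w meets \<open>up\<close>, the inequality \<open>w <= up\<close> lets the test
  function be transferred to \<open>up\<close>, whose larger past has the favourable sign. Elsewhere
  \<open>no_bump\<close> applies. Both cases yield tests up to time T, and stability of a
  one-element family supplies the other intervals.\<close>

lemma w_super: "visc_sub \<alpha> T (reflect H) (\<lambda>t x. - w t x)"
proof (rule dual.visc_sub_stability[where F = "{\<lambda>t x. - w t x}" and M = M])
  have usc: "usc_on (cyl T) (\<lambda>z. - w (fst z) (snd z))" using w_lsc by (simp add: lsc_on_iff_usc_on)
  have wm: "slice_measurable T w" using w_lsc T0 by (intro lsc_on_imp_slice_measurable) auto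
  have upm: "slice_measurable T (\<lambda>t x. - up t x)"
    using visc_sub_usc[OF up_super] T0 by (intro usc_on_imp_slice_measurable) auto
  have nupbd: "bounded_cyl T (\<lambda>t x. - up t x) M" using up_bd by simp
  have weak: "weak_sub \<alpha> T (reflect H) (\<lambda>t x. - w t x)"
    unfolding weak_sub_def
  proof (intro allI impI)
    fix a c \<rho> \<phi> \<phi>t D\<phi> t x
    assume *: "0 \<le> a \<and> a < t \<and> t \<le> T \<and> \<rho> > 0 \<and> test_fun T \<phi> \<phi>t D\<phi> \<and> x \<in> ball c \<rho> \<and>
        (\<forall>s\<in>{a..T}. \<forall>y\<in>cball c \<rho>. - w s y - \<phi> s y \<le> - w t x - \<phi> t x)"
    then have a: "0 \<le> a" "a < t" "t \<le> T" and \<rho>: "\<rho> > 0" and \<phi>: "test_fun T \<phi> \<phi>t D\<phi>" and x: "x \<in> ball c \<rho>"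
      and mx: "\<And>s y. s \<in> {a..T} \<Longrightarrow> y \<in> cball c \<rho> \<Longrightarrow> - w s y - \<phi> s y \<le> - w t x - \<phi> t x" by auto
    have t0: "0 \<le> t" and aT: "a < T" using a by auto
    show "Lop \<alpha> a \<phi> (\<lambda>t x. - w t x) t x (- w t x) + - H t x (- (- w t x)) (- D\<phi> t x) \<le> 0"
    proof (cases "w t x = up t x")
      case True
      have "Lop \<alpha> a \<phi> (\<lambda>t x. - up t x) t x (- up t x) + - H t x (- (- up t x)) (- D\<phi> t x) \<le> 0"
      proof (rule dual.visc_subD[OF up_super nupbd a(1) aT order_refl \<rho> \<phi> a(2,3) x])
        fix s y assume s: "s \<in> {a..T}" "y \<in> cball c \<rho>"
        then show "- up s y - \<phi> s y \<le> - up t x - \<phi> t x"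
          using mx[OF s] w_up[of s y] True a by auto
      qed
      moreover have "Lop \<alpha> a \<phi> (\<lambda>t x. - w t x) t x (- w t x) \<le> Lop \<alpha> a \<phi> (\<lambda>t x. - up t x) t x (- up t x)"
      proof (rule Lop_mono[OF \<phi> slice_measurable_uminus[OF wm] _ a \<phi> upm nupbd a(1,2)])
        fix \<tau> :: real assume "0 < \<tau>"
        then show "incr a \<phi> (\<lambda>t x. - w t x) t x (- w t x) \<tau> \<le> incr a \<phi> (\<lambda>t x. - up t x) t x (- up t x) \<tau>"
          using True w_up[of "max 0 (t - \<tau>)" x] a by (auto simp: incr_def)
      qed (use w_bd in simp)
      ultimately show ?thesis using True by simp
    next
      case False
      then have strict: "w t x < up t x" using w_up[OF t0 a(3), of x] by simp
      \<comment> \<open>The shift makes the test function equal to w at the contact point, as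
        \<open>no_bump\<close> requires; constants cancel in the increments.\<close>
      define \<psi> where "\<psi> = (\<lambda>s y. - \<phi> s y + (w t x + \<phi> t x))"
      have \<psi>: "test_fun T \<psi> (\<lambda>t x. - \<phi>t t x + 0) (\<lambda>t x. - D\<phi> t x + 0)"
        unfolding \<psi>_def by (intro test_fun_add test_fun_uminus \<phi> test_fun_const)
      have "Lop \<alpha> a \<psi> w t x (w t x) + H t x (w t x) (- D\<phi> t x + 0) \<ge> 0"
      proof (rule no_bump[OF \<psi> a \<rho> x _ _ strict])
        show "\<psi> t x = w t x" by (simp add: \<psi>_def)
        show "\<psi> s y \<le> w s y" if "s \<in> {a..T}" "y \<in> cball c \<rho>" for s y
          using mx[OF that] by (simp add: \<psi>_def)
      qed
      moreover have "Lop \<alpha> a \<psi> w t x (w t x) = Lop \<alpha> a (\<lambda>t x. - \<phi> t x) (\<lambda>t x. - (- w t x)) t x (- (- w t x))"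
        unfolding Lop_def by (rule arg_cong[where f = "\<lambda>g. \<alpha> / Gamma (1 - \<alpha>) * g"], rule set_lebesgue_integral_cong)
          (auto simp: incr_def \<psi>_def)
      moreover have "\<dots> = - Lop \<alpha> a \<phi> (\<lambda>t x. - w t x) t x (- w t x)"
        by (rule Lop_uminus[OF \<phi> slice_measurable_uminus[OF wm] _ a]) (use w_bd in simp)
      ultimately show ?thesis by simp
    qed
  qed
  show "usc_cyl T v" "bounded_cyl T v M"
    "weak_sub \<alpha> T (reflect H) v" "v t x \<le> - w t x"
    if "v \<in> {\<lambda>t x. - w t x}" for v t x
    using that usc w_bd weak by auto
  show "usc_on (cyl T) (\<lambda>z. - w (fst z) (snd z))" by (rule usc)
  show "bounded_cyl T (\<lambda>t x. - w t x) M" using w_bd by simp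
  show "\<exists>v\<in>{\<lambda>t x. - w t x}. \<exists>s y. s \<le> T \<and> \<bar>s - t\<bar> < e \<and> dist y x < e \<and> - w t x - e < v s y"
    if "0 < t" "t \<le> T" "0 < e" for t x e
    using that by (auto intro!: exI[of _ t] exI[of _ x])
qed

section \<open>Solution property and periodicity\<close>

lemma u_visc_sol: "visc_sol \<alpha> T H u"
  unfolding visc_sol_def
proof (intro conjI ballI allI)
  fix t x assume "t \<in> {0..T}"
  then show "usc_env T u t x < \<infinity>" "lsc_env T u t x > -\<infinity>"
    using uenv_ereal(1)[OF u_bd T0, of t x] uenv_ereal(1)[OF nu_bd T0, of t x] by (auto simp: lsc_env_def)
next
  show "visc_sub \<alpha> T H (\<lambda>t x. real_of_ereal (usc_env T u t x))"
    using ubar_sub by (simp add: ubar_def uenv_def[abs_def])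
  have "(\<lambda>t x. real_of_ereal (lsc_env T u t x)) = w"
    by (simp add: fun_eq_iff w_def uenv_def lsc_env_def)
  moreover have "visc_super \<alpha> T H w"
    using visc_super_iff_visc_sub_dual[OF w_bd] w_super by simp
  ultimately show "visc_super \<alpha> T H (\<lambda>t x. real_of_ereal (lsc_env T u t x))" by simp
qed

text \<open>Translation by k maps the admissible class into itself. Applying the inequality to k and
  to -k yields periodicity.\<close>

lemma u_translate:
  assumes H: "\<And>t x r p. t \<in> {0..T} \<Longrightarrow> H t (x + k) r p = H t x r p"
    and um: "\<And>t x. t \<in> {0..T} \<Longrightarrow> um t (x + k) = um t x" and up: "\<And>t x. t \<in> {0..T} \<Longrightarrow> up t (x + k) = up t x"
    and g: "\<And>x. g (x + k) = g x" and t: "t \<in> {0..T}"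
  shows "u t (x + k) \<le> u t x"
proof (rule u_least)
  fix v V assume vV: "pair v V"
  have "pair (\<lambda>t x. v t (x + k)) (\<lambda>t x. V t (x + k))"
    unfolding pair_def
  proof (intro conjI ballI allI impI)
    show "visc_sub \<alpha> T H (\<lambda>t x. V t (x + k))" by (rule visc_sub_translate[OF pairD(1,2)[OF vV] H])
    show "bounded_cyl T (\<lambda>t x. V t (x + k)) M" using pairD(2)[OF vV] by (simp add: bounded_cyl_def)
    show "V 0 (x + k) \<le> g x" for x using pairD(3)[OF vV, of "x + k"] g by simp
    fix t x assume t: "t \<in> {0..T}"
    show "um t x \<le> v t (x + k)" using pairD(4)[OF vV, of t "x + k"] um t by simp
    show "v t (x + k) \<le> up t x" using pairD(5)[OF vV, of t "x + k"] up t by simp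
    show "v t (x + k) \<le> V t (x + k)" using pairD(6)[OF vV, of t "x + k"] t by simp
  next
    fix t x e assume t: "0 < t \<and> t \<le> T \<and> (0::real) < e"
    then obtain s y where s: "0 < s" "s \<le> T" "dist (s, y) (t, x + k) < e" "v s y > V t (x + k) - e"
      using pairD(7)[OF vV, of t e "x + k"] by blast
    have "dist (s, y - k) (t, x) = dist (s, y) (t, x + k)"
      by (simp add: dist_Pair_Pair dist_norm algebra_simps)
    then show "\<exists>s y. 0 < s \<and> s \<le> T \<and> dist (s, y) (t, x) < e \<and> V t (x + k) - e < v s (y + k)"
      using s by (intro exI[of _ s] exI[of _ "y - k"]) simp
  qed
  then show "v t (x + k) \<le> u t x" using u_upper t by fastforce
qed

end

theorem theorem4p2:
  fixes \<alpha> T :: real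
    and H :: "real \<Rightarrow> real^'d \<Rightarrow> real \<Rightarrow> real^'d \<Rightarrow> real"
    and um up :: "real \<Rightarrow> real^'d \<Rightarrow> real"
  assumes "0 < \<alpha>" and "\<alpha> < 1" and "0 < T"
    and "continuous_on ({0..T} \<times> UNIV \<times> UNIV \<times> UNIV) (\<lambda>(t, x, r, p). H t x r p)"
    and "\<forall>t\<in>{0..T}. \<forall>x k r p. (\<forall>i. k $ i \<in> \<int>) \<longrightarrow> H t (x + k) r p = H t x r p"
    and "periodic_x T um" and "periodic_x T up"
    and "visc_sub \<alpha> T H um" and "visc_super \<alpha> T H up"
    and "\<forall>t\<in>{0..T}. \<forall>x. lsc_env T um t x > -\<infinity>"
    and "\<forall>t\<in>{0..T}. \<forall>x. usc_env T up t x < \<infinity>"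
    and "\<forall>t\<in>{0..T}. \<forall>x. um t x \<le> up t x"
  shows "\<exists>u. periodic_x T u \<and> visc_sol \<alpha> T H u \<and>
             (\<forall>t\<in>{0..T}. \<forall>x. um t x \<le> u t x \<and> u t x \<le> up t x)"
proof -
  interpret hamilton_jacobi \<alpha> T H using assms(1-4) by unfold_locales
  have "lsc_on (cyl T) (\<lambda>z. up (fst z) (snd z))" using assms(9) by (simp add: visc_super_def)
  then have up_usc: "usc_on (cyl T) (\<lambda>z. - up (fst z) (snd z))" by (simp add: lsc_on_iff_usc_on)
  have um_usc: "usc_cyl T um" using assms(8) by (rule visc_sub_usc)
  have "\<exists>M. bounded_cyl T um M"
    by (rule periodic_usc_bounded[OF assms(6) um_usc assms(3)]) (use assms(10) in auto)
  then obtain M1 where M1: "bounded_cyl T um M1" ..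
  have "\<exists>M. bounded_cyl T (\<lambda>t x. - up t x) M"
  proof (rule periodic_usc_bounded[OF _ up_usc assms(3)])
    show "periodic_x T (\<lambda>t x. - up t x)" using assms(7) by (simp add: periodic_x_def)
    show "lsc_env T (\<lambda>t x. - up t x) t x > -\<infinity>" if "0 \<le> t" "t \<le> T" for t x
      using assms(11) that by (simp add: lsc_env_def ereal_uminus_less_reorder)
  qed
  then obtain M2 where M2: "bounded_cyl T (\<lambda>t x. - up t x) M2" ..
  define M where "M = max M1 M2"
  have bd: "bounded_cyl T um M" "bounded_cyl T up M"
    using M1 M2 by (auto simp: M_def intro: bounded_cyl_mono)
  have slice: "usc_on UNIV (\<lambda>x. f 0 x)" if f: "usc_cyl T f" for f :: "real \<Rightarrow> real^'d \<Rightarrow> real"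
    unfolding usc_on_def
  proof (intro ballI allI impI)
    fix x :: "real^'d" and e :: real assume "0 < e"
    moreover have "(0, x) \<in> cyl T" using T0 by simp
    ultimately obtain d where d: "d > 0" "\<And>z'. z' \<in> cyl T \<Longrightarrow> dist z' (0, x) < d \<Longrightarrow> f (fst z') (snd z') < f 0 x + e"
      using usc_onE[OF f, of "(0, x)" e] unfolding fst_conv snd_conv by metis
    have "f 0 x' < f 0 x + e" if "dist x' x < d" for x'
      using d(2)[of "(0, x')"] that T0 by (simp add: dist_Pair_Pair)
    then show "\<exists>d>0. \<forall>x'\<in>UNIV. dist x' x < d \<longrightarrow> f 0 x' < f 0 x + e" using d(1) by blast
  qed
  have s1: "usc_on UNIV (\<lambda>x. um 0 x)" by (rule slice[OF um_usc])
  have s2: "lsc_on UNIV (\<lambda>x. up 0 x)"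
    unfolding lsc_on_iff_usc_on by (rule slice[of "\<lambda>t x. - up t x", OF up_usc])
  have b1: "\<bar>um 0 x\<bar> \<le> M" and b2: "\<bar>up 0 x\<bar> \<le> M" and le: "um 0 x \<le> up 0 x" for x
    using bounded_cylD[OF bd(1), of 0 x] bounded_cylD[OF bd(2), of 0 x] assms(12) T0 by auto
  obtain g where g: "continuous_on UNIV g" "\<And>x. um 0 x \<le> g x" "\<And>x. g x \<le> up 0 x"
    "\<And>k x. \<forall>x. um 0 (x + k) = um 0 x \<Longrightarrow> \<forall>x. up 0 (x + k) = up 0 x \<Longrightarrow> g (x + k) = g x"
    using continuous_insertion[OF s1 b1 s2 b2 le] by blast
  interpret perron \<alpha> T H um up g M
  proof unfold_locales
    show "visc_sub \<alpha> T (reflect H) (\<lambda>t x. - up t x)"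
      using visc_super_iff_visc_sub_dual[OF bd(2)] assms(9) by simp
  qed (use assms(8,12) bd g in auto)
  have tr: "u t (x + k) \<le> u t x" if "t \<in> {0..T}" "\<forall>i. k $ i \<in> \<int>" for t x k
  proof (rule u_translate)
    show "g (x + k) = g x" for x
      using assms(6,7) that(2) T0 by (intro g(4)) (auto simp: periodic_x_def)
  qed (use assms(5-7) that in \<open>auto simp: periodic_x_def\<close>)
  have "periodic_x T u"
    unfolding periodic_x_def
  proof (intro ballI allI impI antisym)
    fix t x and k :: "real^'d" assume t: "t \<in> {0..T}" and k: "\<forall>i. k $ i \<in> \<int>"
    show "u t (x + k) \<le> u t x" by (rule tr[OF t k])
    have "u t ((x + k) + - k) \<le> u t (x + k)" using k by (intro tr[OF t]) simp
    then show "u t x \<le> u t (x + k)" by simp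
  qed
  then show ?thesis using u_visc_sol um_u u_up by auto
qed

end
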